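(* Let $\mathcal{N}_{A'B'\to AB}$ be a bipartite quantum channel that is bidirectional teleportation-simulable with associated resource state $\theta_{L_AL_B}$ and that is resource-seizable (with respect to this $\theta_{L_AL_B}$). Then its sequential entanglement cost equals the entanglement cost of the resource state: $$E_C(\mathcal{N}_{A'B'\to AB}) = E_C(\theta_{L_AL_B}),$$ where on the right-hand side $E_C(\theta_{L_AL_B})$ is the standard (asymptotic, approximate, LOCC) entanglement cost of the bipartite state $\theta_{L_AL_B}$.
   Context: A bipartite channel $\mathcal{N}_{A'B'\to AB}$ has Alice holding $A',A$ and Bob holding $B',B$. It is bidirectional teleportation-simulable with associated resource state $\theta_{L_AL_B}$ if for all input states $\rho_{A'B'}$ one has $\mathcal{N}_{A'B'\to AB}(\rho_{A'B'})=\mathcal{L}_{L_AA'B'L_B\to AB}(\rho_{A'B'}\otimes\theta_{L_AL_B})$ for some LOCC channel $\mathcal{L}$ with respect to the cut $L_AA':L_BB'$. It is resource-seizable if moreover there exist a separable state $\rho_{A_MA'B'B_M}$ (separable with respect to $A_MA':B'B_M$) and an LOCC channel $\mathcal{D}_{A_MABB_M\to L_AL_B}$ (with respect to $A_MA:BB_M$) such that $\mathcal{D}(\mathcal{N}_{A'B'\to AB}(\rho_{A_MA'B'B_M}))=\theta_{L_AL_B}$. Sequential entanglement cost: For $n,M\in\mathbb{N}$, $\varepsilon\in[0,1]$, an $(n,M,\varepsilon)$ sequential LOCC-assisted simulation code for $\mathcal{N}$ consists of a maximally entangled state $\Phi_{\bar A_0\bar B_0}$ of Schmidt rank $M$ and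 LOCC channels $\mathcal{L}^{(i)}_{A_i'B_i'\bar A_{i-1}\bar B_{i-1}\to A_iB_i\bar A_i\bar B_i}$, $i=1,\dots,n$ (Alice holds all $A$-labelled systems, Bob all $B$-labelled ones). A sequential discrimination strategy consists of an initial state $\rho_{R_1A_1'B_1'}$, channels $\mathcal{A}^{(i)}_{R_iA_iB_i\to R_{i+1}A'_{i+1}B'_{i+1}}$ for $i=1,\dots,n-1$, and a final two-outcome measurement. Applied to $n$ uses of $\mathcal{N}$ it gives a final state $\rho_{R_nA_nB_n}$ (alternating $\mathcal{N}_{A_i'B_i'\to A_iB_i}$ and $\mathcal{A}^{(i)}$); applied to the simulation it gives $\tau_{R_nA_nB_n}$ (replacing the $i$-th channel use by $\mathcal{L}^{(i)}$, with the memory systems $\bar A_i\bar B_i$ carried forward, starting from $\Phi_{\bar A_0\bar B_0}$, and tracing out final memory). The code is an $(n,M,\varepsilon)$ code if $\frac12\sup\|\rho_{R_nA_nB_n}-\tau_{R_nA_nB_n}\|_1\le\varepsilon$, the supremum over all sequential discrimination strategies. A rate $R$ is achievable if for all $\varepsilon\in(0,1]$, $\delta>0$ and all sufficiently large $n$ there exists an $(n,2^{n(R+\delta)},\varepsilon)$ code; $E_C(\mathcal{N})$ is the infimum of achievable rates. *)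

theory Defs
  imports Complex_Main
begin

text \<open>A matrix of size m x n is a function nat => nat => complex that vanishes
outside {0..<m} x {0..<n}.  Composite systems use the Kronecker convention:
on a space of dimension d1*d2 the basis index is i1*d2 + i2 (first factor most
significant).  For bipartite operators, Alice's factor is always the first one.\<close>

type_synonym cmat = "nat \<Rightarrow> nat \<Rightarrow> complex"

definition mk :: "nat \<Rightarrow> nat \<Rightarrow> (nat \<Rightarrow> nat \<Rightarrow> complex) \<Rightarrow> cmat" where
  "mk m n f = (\<lambda>i j. if i < m \<and> j < n then f i j else 0)"

definition is_mat :: "nat \<Rightarrow> nat \<Rightarrow> cmat \<Rightarrow> bool" where
  "is_mat m n X \<longleftrightarrow> (\<forall>i j. \<not> (i < m \<and> j < n) \<longrightarrow> X i j = 0)"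

definition mmul :: "nat \<Rightarrow> nat \<Rightarrow> nat \<Rightarrow> cmat \<Rightarrow> cmat \<Rightarrow> cmat" where
  "mmul m k n X Y = mk m n (\<lambda>i j. \<Sum>l<k. X i l * Y l j)"

definition adj :: "cmat \<Rightarrow> cmat" where
  "adj X = (\<lambda>i j. cnj (X j i))"

definition idm :: "nat \<Rightarrow> cmat" where
  "idm d = mk d d (\<lambda>i j. if i = j then 1 else 0)"

definition diagm :: "nat \<Rightarrow> (nat \<Rightarrow> real) \<Rightarrow> cmat" where
  "diagm d s = mk d d (\<lambda>i j. if i = j then complex_of_real (s i) else 0)"

definition tr :: "nat \<Rightarrow> cmat \<Rightarrow> complex" where
  "tr d X = (\<Sum>i<d. X i i)"

definition kron :: "nat \<Rightarrow> nat \<Rightarrow> nat \<Rightarrow> nat \<Rightarrow> cmat \<Rightarrow> cmat \<Rightarrow> cmat" where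
  "kron m n p q A B = mk (m * p) (n * q) (\<lambda>i j. A (i div p) (j div q) * B (i mod p) (j mod q))"

definition unitary :: "nat \<Rightarrow> cmat \<Rightarrow> bool" where
  "unitary d U \<longleftrightarrow> is_mat d d U \<and> mmul d d d (adj U) U = idm d"

definition psd :: "nat \<Rightarrow> cmat \<Rightarrow> bool" where
  "psd d X \<longleftrightarrow> is_mat d d X \<and> adj X = X \<and>
     (\<forall>v :: nat \<Rightarrow> complex. 0 \<le> Re (\<Sum>i<d. \<Sum>j<d. cnj (v i) * X i j * v j))"

definition density :: "nat \<Rightarrow> cmat \<Rightarrow> bool" where
  "density d \<rho> \<longleftrightarrow> psd d \<rho> \<and> tr d \<rho> = 1"

definition separable :: "nat \<Rightarrow> nat \<Rightarrow> cmat \<Rightarrow> bool" where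
  "separable da db \<rho> \<longleftrightarrow> (\<exists>k (p :: nat \<Rightarrow> real) \<sigma> \<tau>.
     (\<forall>i<k. 0 \<le> p i \<and> density da (\<sigma> i) \<and> density db (\<tau> i)) \<and> (\<Sum>i<k. p i) = 1 \<and>
     \<rho> = mk (da * db) (da * db) (\<lambda>x y. \<Sum>i<k. complex_of_real (p i) * kron da da db db (\<sigma> i) (\<tau> i) x y))"

text \<open>Maximally entangled state of Schmidt rank M on an M x M system:
  |Phi><Phi| with Phi = (1/sqrt M) sum_i |i>|i>.\<close>
definition maxent :: "nat \<Rightarrow> cmat" where
  "maxent M = mk (M * M) (M * M)
     (\<lambda>p q. if p mod M = p div M \<and> q mod M = q div M then 1 / of_nat M else 0)"

text \<open>Trace norm: sum of the singular values (well defined by uniqueness of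
singular values).\<close>
definition trace_norm :: "nat \<Rightarrow> cmat \<Rightarrow> real" where
  "trace_norm d X = (SOME t. \<exists>U V (s :: nat \<Rightarrow> real). unitary d U \<and> unitary d V \<and>
      (\<forall>i<d. 0 \<le> s i) \<and> X = mmul d d d (mmul d d d U (diagm d s)) (adj V) \<and> t = (\<Sum>i<d. s i))"

definition tdist :: "nat \<Rightarrow> cmat \<Rightarrow> cmat \<Rightarrow> real" where
  "tdist d \<rho> \<sigma> = trace_norm d (\<lambda>i j. \<rho> i j - \<sigma> i j) / 2"

definition kraus_map :: "nat \<Rightarrow> nat \<Rightarrow> cmat list \<Rightarrow> cmat \<Rightarrow> cmat" where
  "kraus_map din dout Ks X = mk dout dout
     (\<lambda>i j. \<Sum>K\<leftarrow>Ks. \<Sum>k<din. \<Sum>l<din. K i k * X k l * cnj (K j l))"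

definition is_channel :: "nat \<Rightarrow> nat \<Rightarrow> (cmat \<Rightarrow> cmat) \<Rightarrow> bool" where
  "is_channel din dout \<Phi> \<longleftrightarrow> (\<exists>Ks. (\<forall>K\<in>set Ks. is_mat dout din K) \<and>
     mk din din (\<lambda>i j. \<Sum>K\<leftarrow>Ks. \<Sum>t<dout. cnj (K t i) * K t j) = idm din \<and>
     (\<forall>X. is_mat din din X \<longrightarrow> \<Phi> X = kraus_map din dout Ks X))"

definition instrument :: "nat \<Rightarrow> nat \<Rightarrow> nat \<Rightarrow> (nat \<Rightarrow> cmat list) \<Rightarrow> bool" where
  "instrument din dout k Ks \<longleftrightarrow> (\<forall>j<k. \<forall>K\<in>set (Ks j). is_mat dout din K) \<and>
     mk din din (\<lambda>i l. \<Sum>j<k. \<Sum>K\<leftarrow>Ks j. \<Sum>t<dout. cnj (K t i) * K t l) = idm din"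

definition id_tensor :: "nat \<Rightarrow> nat \<Rightarrow> nat \<Rightarrow> (cmat \<Rightarrow> cmat) \<Rightarrow> cmat \<Rightarrow> cmat" where
  "id_tensor r m m' N X = mk (r * m') (r * m')
     (\<lambda>p q. N (mk m m (\<lambda>k l. X ((p div m') * m + k) ((q div m') * m + l))) (p mod m') (q mod m'))"

definition tensor_id :: "nat \<Rightarrow> nat \<Rightarrow> nat \<Rightarrow> (cmat \<Rightarrow> cmat) \<Rightarrow> cmat \<Rightarrow> cmat" where
  "tensor_id m m' s N X = mk (m' * s) (m' * s)
     (\<lambda>p q. N (mk m m (\<lambda>k l. X (k * s + p mod s) (l * s + q mod s))) (p div s) (q div s))"

definition ptrace_right :: "nat \<Rightarrow> nat \<Rightarrow> cmat \<Rightarrow> cmat" where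
  "ptrace_right m s X = mk m m (\<lambda>i j. \<Sum>k<s. X (i * s + k) (j * s + k))"

text \<open>Reordering d1 x d2 x d3 x d4 into d1 x d3 x d2 x d4.\<close>
definition sm_idx :: "nat \<Rightarrow> nat \<Rightarrow> nat \<Rightarrow> nat \<Rightarrow> nat \<Rightarrow> nat" where
  "sm_idx d1 d2 d3 d4 p =
     (let x4 = p mod d4; r = p div d4; x2 = r mod d2; r2 = r div d2;
          x3 = r2 mod d3; x1 = r2 div d3 in ((x1 * d2 + x2) * d3 + x3) * d4 + x4)"

definition swap_mid :: "nat \<Rightarrow> nat \<Rightarrow> nat \<Rightarrow> nat \<Rightarrow> cmat \<Rightarrow> cmat" where
  "swap_mid d1 d2 d3 d4 X = mk (d1 * d2 * d3 * d4) (d1 * d2 * d3 * d4)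
     (\<lambda>p q. X (sm_idx d1 d2 d3 d4 p) (sm_idx d1 d2 d3 d4 q))"

text \<open>locc aI bI aO bO L: L is a (finite-round) LOCC channel from Alice dimension aI,
Bob dimension bI to Alice dimension aO, Bob dimension bO.  Each round one party
applies a local instrument, communicates the outcome, and the protocol continues
conditioned on it.\<close>
inductive locc :: "nat \<Rightarrow> nat \<Rightarrow> nat \<Rightarrow> nat \<Rightarrow> (cmat \<Rightarrow> cmat) \<Rightarrow> bool" where
  locc_id: "(\<forall>X. is_mat (aI * bI) (aI * bI) X \<longrightarrow> L X = X) \<Longrightarrow> locc aI bI aI bI L"
| locc_alice: "\<lbrakk> instrument aI a' k Ks; \<forall>j<k. locc a' bI aO bO (Ls j);
     \<forall>X. is_mat (aI * bI) (aI * bI) X \<longrightarrow>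
        L X = (\<lambda>p q. \<Sum>j<k. Ls j (tensor_id aI a' bI (kraus_map aI a' (Ks j)) X) p q) \<rbrakk>
   \<Longrightarrow> locc aI bI aO bO L"
| locc_bob: "\<lbrakk> instrument bI b' k Ks; \<forall>j<k. locc aI b' aO bO (Ls j);
     \<forall>X. is_mat (aI * bI) (aI * bI) X \<longrightarrow>
        L X = (\<lambda>p q. \<Sum>j<k. Ls j (id_tensor aI bI b' (kraus_map bI b' (Ks j)) X) p q) \<rbrakk>
   \<Longrightarrow> locc aI bI aO bO L"

text \<open>N : A'B' -> AB with dims ai (A'), bi (B'), ao (A), bo (B); resource theta on
L_A L_B with dims la, lb.  Alice's systems are ordered A' L_A, Bob's B' L_B.\<close>
definition tele_simulable ::
  "(cmat \<Rightarrow> cmat) \<Rightarrow> nat \<Rightarrow> nat \<Rightarrow> nat \<Rightarrow> nat \<Rightarrow> nat \<Rightarrow> nat \<Rightarrow> cmat \<Rightarrow> bool" where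
  "tele_simulable N ai bi ao bo la lb \<theta> \<longleftrightarrow> density (la * lb) \<theta> \<and>
     (\<exists>L. locc (ai * la) (bi * lb) ao bo L \<and>
        (\<forall>\<rho>. density (ai * bi) \<rho> \<longrightarrow>
           N \<rho> = L (swap_mid ai bi la lb (kron (ai * bi) (ai * bi) (la * lb) (la * lb) \<rho> \<theta>))))"

text \<open>Systems ordered A_M A' B' B_M (cut A_M A' : B' B_M).\<close>
definition resource_seizable ::
  "(cmat \<Rightarrow> cmat) \<Rightarrow> nat \<Rightarrow> nat \<Rightarrow> nat \<Rightarrow> nat \<Rightarrow> nat \<Rightarrow> nat \<Rightarrow> cmat \<Rightarrow> bool" where
  "resource_seizable N ai bi ao bo la lb \<theta> \<longleftrightarrow>
     (\<exists>am bm \<rho> D. 0 < am \<and> 0 < bm \<and> separable (am * ai) (bi * bm) \<rho> \<and>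
        locc (am * ao) (bo * bm) la lb D \<and>
        D (id_tensor am (ai * bi * bm) (ao * bo * bm) (tensor_id (ai * bi) (ao * bo) bm N) \<rho>) = \<theta>)"

text \<open>Rounds are indexed 0..n-1.  r i = dimension of the discriminator's memory R_i;
As i : R_i A B -> R_{i+1} A' B'.  The state after the (i+1)-th channel use:\<close>
primrec real_run :: "(cmat \<Rightarrow> cmat) \<Rightarrow> nat \<Rightarrow> nat \<Rightarrow> nat \<Rightarrow> nat \<Rightarrow> (nat \<Rightarrow> nat) \<Rightarrow> cmat
    \<Rightarrow> (nat \<Rightarrow> cmat \<Rightarrow> cmat) \<Rightarrow> nat \<Rightarrow> cmat" where
  "real_run N ai bi ao bo r \<rho>0 As 0 = id_tensor (r 0) (ai * bi) (ao * bo) N \<rho>0"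
| "real_run N ai bi ao bo r \<rho>0 As (Suc i) =
     id_tensor (r (Suc i)) (ai * bi) (ao * bo) N (As i (real_run N ai bi ao bo r \<rho>0 As i))"

text \<open>Simulation: memory dims ma i, mb i (of bar A_i, bar B_i; index 0 = initial
maximally entangled state); Ls i : A'_i B'_i bar A_i bar B_i -> A_i B_i bar A_{i+1} bar B_{i+1},
LOCC w.r.t. (A' bar A) : (B' bar B).  The global state is ordered R (A B or A' B') (bar A bar B).\<close>
definition L_full :: "nat \<Rightarrow> nat \<Rightarrow> nat \<Rightarrow> nat \<Rightarrow> (nat \<Rightarrow> nat) \<Rightarrow> (nat \<Rightarrow> nat)
    \<Rightarrow> (nat \<Rightarrow> cmat \<Rightarrow> cmat) \<Rightarrow> nat \<Rightarrow> cmat \<Rightarrow> cmat" where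
  "L_full ai bi ao bo ma mb Ls i X =
     swap_mid ao (ma (Suc i)) bo (mb (Suc i)) (Ls i (swap_mid ai bi (ma i) (mb i) X))"

primrec sim_run :: "nat \<Rightarrow> nat \<Rightarrow> nat \<Rightarrow> nat \<Rightarrow> (nat \<Rightarrow> nat) \<Rightarrow> (nat \<Rightarrow> nat)
    \<Rightarrow> (nat \<Rightarrow> cmat \<Rightarrow> cmat) \<Rightarrow> (nat \<Rightarrow> nat) \<Rightarrow> cmat \<Rightarrow> (nat \<Rightarrow> cmat \<Rightarrow> cmat) \<Rightarrow> nat \<Rightarrow> cmat" where
  "sim_run ai bi ao bo ma mb Ls r \<rho>0 As 0 =
     id_tensor (r 0) (ai * bi * (ma 0 * mb 0)) (ao * bo * (ma 1 * mb 1))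
       (L_full ai bi ao bo ma mb Ls 0)
       (kron (r 0 * (ai * bi)) (r 0 * (ai * bi)) (ma 0 * mb 0) (ma 0 * mb 0) \<rho>0 (maxent (ma 0)))"
| "sim_run ai bi ao bo ma mb Ls r \<rho>0 As (Suc i) =
     id_tensor (r (Suc i)) (ai * bi * (ma (Suc i) * mb (Suc i))) (ao * bo * (ma (Suc (Suc i)) * mb (Suc (Suc i))))
       (L_full ai bi ao bo ma mb Ls (Suc i))
       (tensor_id (r i * (ao * bo)) (r (Suc i) * (ai * bi)) (ma (Suc i) * mb (Suc i)) (As i)
          (sim_run ai bi ao bo ma mb Ls r \<rho>0 As i))"

definition seq_strategy :: "nat \<Rightarrow> nat \<Rightarrow> nat \<Rightarrow> nat \<Rightarrow> nat \<Rightarrow> (nat \<Rightarrow> nat) \<Rightarrow> cmat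
    \<Rightarrow> (nat \<Rightarrow> cmat \<Rightarrow> cmat) \<Rightarrow> bool" where
  "seq_strategy ai bi ao bo n r \<rho>0 As \<longleftrightarrow> (\<forall>i. 0 < r i) \<and> density (r 0 * (ai * bi)) \<rho>0 \<and>
     (\<forall>i. Suc i < n \<longrightarrow> is_channel (r i * (ao * bo)) (r (Suc i) * (ai * bi)) (As i))"

definition seq_code :: "(cmat \<Rightarrow> cmat) \<Rightarrow> nat \<Rightarrow> nat \<Rightarrow> nat \<Rightarrow> nat \<Rightarrow> nat \<Rightarrow> nat \<Rightarrow> real \<Rightarrow> bool" where
  "seq_code N ai bi ao bo n M \<epsilon> \<longleftrightarrow> 1 \<le> n \<and>
     (\<exists>ma mb Ls. ma 0 = M \<and> mb 0 = M \<and> (\<forall>i. 0 < ma i \<and> 0 < mb i) \<and>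
        (\<forall>i<n. locc (ai * ma i) (bi * mb i) (ao * ma (Suc i)) (bo * mb (Suc i)) (Ls i)) \<and>
        (\<forall>r \<rho>0 As. seq_strategy ai bi ao bo n r \<rho>0 As \<longrightarrow>
           tdist (r (n - 1) * (ao * bo))
             (real_run N ai bi ao bo r \<rho>0 As (n - 1))
             (ptrace_right (r (n - 1) * (ao * bo)) (ma n * mb n)
                (sim_run ai bi ao bo ma mb Ls r \<rho>0 As (n - 1))) \<le> \<epsilon>))"

definition achievable_chan :: "(cmat \<Rightarrow> cmat) \<Rightarrow> nat \<Rightarrow> nat \<Rightarrow> nat \<Rightarrow> nat \<Rightarrow> real \<Rightarrow> bool" where
  "achievable_chan N ai bi ao bo R \<longleftrightarrow>
     (\<forall>\<epsilon> \<delta>. 0 < \<epsilon> \<and> \<epsilon> \<le> 1 \<and> 0 < \<delta> \<longrightarrow>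
        (\<forall>\<^sub>F n in sequentially. \<exists>M. 1 \<le> M \<and> real M \<le> 2 powr (real n * (R + \<delta>)) \<and>
           seq_code N ai bi ao bo n M \<epsilon>))"

definition EC_chan :: "(cmat \<Rightarrow> cmat) \<Rightarrow> nat \<Rightarrow> nat \<Rightarrow> nat \<Rightarrow> nat \<Rightarrow> real" where
  "EC_chan N ai bi ao bo = Inf {R. achievable_chan N ai bi ao bo R}"

definition digit :: "nat \<Rightarrow> nat \<Rightarrow> nat \<Rightarrow> nat" where
  "digit b x k = (x div b ^ k) mod b"

text \<open>theta^{tensor n}, regrouped as (L_A^n) : (L_B^n).\<close>
definition btpow :: "nat \<Rightarrow> nat \<Rightarrow> nat \<Rightarrow> cmat \<Rightarrow> cmat" where
  "btpow la lb n \<theta> = mk (la ^ n * lb ^ n) (la ^ n * lb ^ n)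
     (\<lambda>p q. \<Prod>k<n. \<theta> (digit la (p div lb ^ n) k * lb + digit lb (p mod lb ^ n) k)
                       (digit la (q div lb ^ n) k * lb + digit lb (q mod lb ^ n) k))"

definition achievable_state :: "nat \<Rightarrow> nat \<Rightarrow> cmat \<Rightarrow> real \<Rightarrow> bool" where
  "achievable_state la lb \<theta> R \<longleftrightarrow>
     (\<forall>\<epsilon> \<delta>. 0 < \<epsilon> \<and> \<epsilon> \<le> 1 \<and> 0 < \<delta> \<longrightarrow>
        (\<forall>\<^sub>F n in sequentially. \<exists>M L. 1 \<le> M \<and> real M \<le> 2 powr (real n * (R + \<delta>)) \<and>
           locc M M (la ^ n) (lb ^ n) L \<and>
           tdist (la ^ n * lb ^ n) (L (maxent M)) (btpow la lb n \<theta>) \<le> \<epsilon>))"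

definition EC_state :: "nat \<Rightarrow> nat \<Rightarrow> cmat \<Rightarrow> real" where
  "EC_state la lb \<theta> = Inf {R. achievable_state la lb \<theta> R}"

end

theory Submission
  imports "HOL-Analysis.Function_Topology" "HOL-Analysis.Topology_Euclidean_Space" Defs
begin

text \<open>Both sides are infima over the same set of rates, because codes translate into each other
  with the same \<open>n\<close>, \<open>M\<close> and error.

  Given an LOCC map that turns \<open>\<Phi>\<close> into an approximation of $\theta^{\otimes n}$, the simulator
  applies it in the first round, keeps the copies as memory and consumes one copy per round by
  teleportation simulation. With exact copies this simulation is perfect, so the error is that of
  the initial state, by monotonicity of the trace norm under channels.

  Conversely the discriminator feeds a fresh seizing input to each channel use and turns the output
  into a copy of $\theta$ that it stores. Split between Alice and Bob this strategy is LOCC, so run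
  against the simulator it gives an LOCC map from \<open>\<Phi>\<close> to an approximation of $\theta^{\otimes n}$.

  Composite indices are handled by linearity: two linear maps that agree on Kronecker products agree.
\<close>

section \<open>Spectral decomposition of Hermitian matrices\<close>

text \<open>\<open>trace_norm\<close> is a choice among sums of singular values, so it says nothing
  until a singular value decomposition exists. Spectral theory supplies one for Hermitian matrices,
  and the comparison with \<open>tn_bound\<close> is made for whichever decomposition the choice
  returns.

  The remaining difficulty is the order of tensor factors. A run lists the discriminator's memory,
  the channel systems and the simulator's memory, each with Alice's part next to Bob's, while an
  LOCC map wants all of Alice's factors before all of Bob's. Operations move between the two orders
  by \<open>swap_mid\<close>, and these regroupings have to cancel from one round to the next.

  Simulability is promised only for density matrices without a reference system; linear extension to
  all matrices is what makes it valid beside the discriminator's memory. Separability of the seizing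
  input lets Alice and Bob prepare it by shared randomness, so that discriminator and simulator
  together form one LOCC protocol.\<close>

definition ip :: "nat \<Rightarrow> (nat \<Rightarrow> complex) \<Rightarrow> (nat \<Rightarrow> complex) \<Rightarrow> complex" where
  "ip d u v = (\<Sum>i<d. cnj (u i) * v i)"

definition app :: "nat \<Rightarrow> cmat \<Rightarrow> (nat \<Rightarrow> complex) \<Rightarrow> nat \<Rightarrow> complex" where
  "app d X v = (\<lambda>i. \<Sum>j<d. X i j * v j)"

definition orthonormal :: "nat \<Rightarrow> nat \<Rightarrow> (nat \<Rightarrow> nat \<Rightarrow> complex) \<Rightarrow> bool" where
  "orthonormal d k v \<longleftrightarrow> (\<forall>a<k. \<forall>b<k. ip d (v a) (v b) = (if a = b then 1 else 0))"

lemma ip_self: "ip d v v = of_real (\<Sum>i<d. (cmod (v i))\<^sup>2)"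
  unfolding ip_def of_real_sum
  by (intro sum.cong refl) (simp only: complex_norm_square mult.commute)

lemma ip_self_Re_nonneg: "0 \<le> Re (ip d v v)"
  unfolding ip_self by (simp add: sum_nonneg)

lemma ip_self_eq_0: "ip d v v = 0 \<Longrightarrow> i < d \<Longrightarrow> v i = 0"
  unfolding ip_self of_real_eq_0_iff
  by (subst (asm) sum_nonneg_eq_0_iff) auto

lemma ip_cnj: "cnj (ip d u v) = ip d v u"
  unfolding ip_def cnj_sum by (intro sum.cong refl) (simp add: mult.commute)

lemma ip_add_right: "ip d u (\<lambda>i. v i + w i) = ip d u v + ip d u w"
  by (simp add: ip_def algebra_simps sum.distrib)

lemma ip_add_left: "ip d (\<lambda>i. v i + w i) u = ip d v u + ip d w u"
  by (simp add: ip_def algebra_simps sum.distrib)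

lemma ip_scale_right: "ip d u (\<lambda>i. c * v i) = c * ip d u v"
  by (simp add: ip_def algebra_simps sum_distrib_left)

lemma ip_scale_left: "ip d (\<lambda>i. c * v i) u = cnj c * ip d v u"
  by (simp add: ip_def algebra_simps sum_distrib_left)

lemma ip_diff_right: "ip d u (\<lambda>i. v i - w i) = ip d u v - ip d u w"
  by (simp add: ip_def algebra_simps sum_subtractf)

lemma app_add: "app d X (\<lambda>i. v i + w i) = (\<lambda>i. app d X v i + app d X w i)"
  by (auto simp: app_def algebra_simps sum.distrib)

lemma app_scale: "app d X (\<lambda>i. c * v i) = (\<lambda>i. c * app d X v i)"
  by (auto simp: app_def algebra_simps sum_distrib_left)

lemma ip_app: "ip d u (app d X v) = (\<Sum>i<d. \<Sum>j<d. cnj (u i) * X i j * v j)"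
  by (simp add: ip_def app_def sum_distrib_left mult.assoc)

lemma ip_app_hermitian:
  assumes "adj X = X"
  shows "ip d (app d X u) v = ip d u (app d X v)"
proof -
  have e: "cnj (X i j) = X j i" for i j
    using fun_cong[OF fun_cong[OF assms, of j], of i] by (simp add: adj_def)
  have "ip d (app d X u) v = (\<Sum>i<d. \<Sum>j<d. cnj (u j) * X j i * v i)"
    by (simp add: ip_def app_def sum_distrib_left e mult_ac)
  also have "\<dots> = ip d u (app d X v)"
    unfolding ip_app by (rule sum.swap)
  finally show ?thesis .
qed

text \<open>The squared Frobenius norm of the projection onto the orthogonal complement.\<close>
lemma orthonormal_defect:
  assumes "orthonormal d k v"
  shows "(\<Sum>i<d. \<Sum>l<d. (cmod ((if l = i then 1 else 0) - (\<Sum>a<k. v a l * cnj (v a i))))\<^sup>2) = real d - real k"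
proof -
  define P where "P l i = (\<Sum>a<k. v a l * cnj (v a i))" for l i
  define D :: "nat \<Rightarrow> nat \<Rightarrow> complex" where "D l i = (if l = i then 1 else 0)" for l i
  have tr: "(\<Sum>i<d. P i i) = of_nat k"
  proof -
    have "(\<Sum>i<d. P i i) = (\<Sum>a<k. ip d (v a) (v a))"
      unfolding P_def ip_def by (subst sum.swap) (simp add: mult.commute)
    also have "\<dots> = (\<Sum>a<k. 1)"
      by (intro sum.cong refl) (use assms in \<open>simp add: orthonormal_def\<close>)
    finally show ?thesis by simp
  qed
  have sq: "(\<Sum>i<d. \<Sum>l<d. P l i * cnj (P l i)) = of_nat k"
  proof -
    have "(\<Sum>i<d. \<Sum>l<d. P l i * cnj (P l i))
      = (\<Sum>i<d. \<Sum>l<d. \<Sum>a<k. \<Sum>b<k. (cnj (v a i) * v b i) * (cnj (v b l) * v a l))"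
      unfolding P_def cnj_sum sum_product by (intro sum.cong refl) simp
    also have "\<dots> = (\<Sum>a<k. \<Sum>b<k. \<Sum>i<d. \<Sum>l<d. (cnj (v a i) * v b i) * (cnj (v b l) * v a l))"
      apply (subst (2) sum.swap)
      apply (subst (1) sum.swap)
      apply (subst (3) sum.swap)
      apply (subst (2) sum.swap)
      by (rule refl)
    also have "\<dots> = (\<Sum>a<k. \<Sum>b<k. ip d (v a) (v b) * ip d (v b) (v a))"
      unfolding ip_def sum_product by (rule refl)
    also have "\<dots> = (\<Sum>a<k. \<Sum>b<k. if a = b then 1 else 0)"
      by (intro sum.cong refl) (use assms in \<open>auto simp add: orthonormal_def\<close>)
    finally show ?thesis by simp
  qed
  have "complex_of_real (\<Sum>i<d. \<Sum>l<d. (cmod (D l i - P l i))\<^sup>2)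
     = (\<Sum>i<d. \<Sum>l<d. D l i - (D l i * P l i) - cnj (D l i * P l i) + P l i * cnj (P l i))"
    unfolding of_real_sum complex_norm_square
    by (intro sum.cong refl) (auto simp: D_def algebra_simps)
  also have "\<dots> = (\<Sum>i<d. \<Sum>l<d. D l i) - (\<Sum>i<d. \<Sum>l<d. D l i * P l i)
      - cnj (\<Sum>i<d. \<Sum>l<d. D l i * P l i) + (\<Sum>i<d. \<Sum>l<d. P l i * cnj (P l i))"
    by (simp add: sum.distrib sum_subtractf cnj_sum)
  also have "(\<Sum>i<d. \<Sum>l<d. D l i) = of_nat d"
    by (simp add: D_def)
  also have "(\<Sum>i<d. \<Sum>l<d. D l i * P l i) = (\<Sum>i<d. P i i)"
    by (intro sum.cong refl) (simp add: D_def if_distrib[of "\<lambda>x. x * _"] cong: if_cong)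
  finally have "complex_of_real (\<Sum>i<d. \<Sum>l<d. (cmod (D l i - P l i))\<^sup>2) = of_real (real d - real k)"
    unfolding tr sq by simp
  then show ?thesis
    unfolding of_real_eq_iff D_def P_def .
qed

text \<open>The columns of the projection onto the complement cannot all vanish, since their squared
  norms add up to \<open>d - k > 0\<close>; any nonzero column can be normalised. Entries from
  \<open>d\<close> on are set to 0 so that the candidates form a bounded set of functions.\<close>

lemma exists_unit_orthogonal:
  assumes "orthonormal d k v" "k < d"
  shows "\<exists>u. ip d u u = 1 \<and> (\<forall>a<k. ip d (v a) u = 0) \<and> (\<forall>i\<ge>d. u i = 0)"
proof -
  define w where "w i l = (if l < d then (if l = i then 1 else 0) - (\<Sum>a<k. v a l * cnj (v a i)) else 0)" for i l
  have "\<exists>i<d. ip d (w i) (w i) \<noteq> 0"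
  proof (rule ccontr)
    assume "\<not> ?thesis"
    then have *: "\<And>i. i < d \<Longrightarrow> ip d (w i) (w i) = 0" by blast
    have "(\<Sum>i<d. \<Sum>l<d. (cmod ((if l = i then 1 else 0) - (\<Sum>a<k. v a l * cnj (v a i))))\<^sup>2) = 0"
      using ip_self_eq_0[OF *] by (intro sum.neutral ballI) (auto simp: w_def)
    with orthonormal_defect[OF assms(1)] assms(2) show False by simp
  qed
  then obtain i where i: "i < d" "ip d (w i) (w i) \<noteq> 0" by blast
  have orth: "ip d (v b) (w i) = 0" if b: "b < k" for b
  proof -
    have "ip d (v b) (w i) = (\<Sum>l<d. cnj (v b l) * (if l = i then 1 else 0)) - (\<Sum>l<d. \<Sum>a<k. cnj (v b l) * v a l * cnj (v a i))"
      by (simp add: ip_def w_def algebra_simps sum_subtractf sum_distrib_left)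
    also have "(\<Sum>l<d. \<Sum>a<k. cnj (v b l) * v a l * cnj (v a i)) = (\<Sum>a<k. ip d (v b) (v a) * cnj (v a i))"
      by (subst sum.swap) (simp add: ip_def sum_distrib_right)
    also have "\<dots> = (\<Sum>a<k. if b = a then cnj (v a i) else 0)"
      by (intro sum.cong refl) (use assms(1) b in \<open>auto simp: orthonormal_def\<close>)
    also have "\<dots> = cnj (v b i)" using b by simp
    also have "(\<Sum>l<d. cnj (v b l) * (if l = i then 1 else 0)) = cnj (v b i)"
      using i by (simp add: if_distrib cong: if_cong)
    finally show ?thesis by simp
  qed
  define r where "r = (\<Sum>l<d. (cmod (w i l))\<^sup>2)"
  have r: "ip d (w i) (w i) = of_real r" by (simp add: ip_self r_def)
  have r0: "0 \<le> r" by (simp add: r_def sum_nonneg)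
  define u where "u = (\<lambda>l. complex_of_real (1 / sqrt r) * w i l)"
  have rp: "r > 0" using r r0 i by (simp add: order_less_le)
  have "ip d u u = complex_of_real ((1 / sqrt r) * ((1 / sqrt r) * r))"
    by (simp only: u_def ip_scale_right ip_scale_left r of_real_mult complex_cnj_complex_of_real)
  also have "(1 / sqrt r) * ((1 / sqrt r) * r) = 1"
    using rp by (simp add: field_simps)
  finally have "ip d u u = 1" by simp
  moreover have "\<forall>a<k. ip d (v a) u = 0"
    unfolding u_def ip_scale_right by (simp add: orth)
  moreover have "\<forall>i\<ge>d. u i = 0" by (simp add: u_def w_def)
  ultimately show ?thesis by blast
qed

text \<open>For \<open>k = d\<close> the defect is 0, and a vanishing sum of squares vanishes term
  by term. This leads from orthonormal columns to orthonormal rows.\<close>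

lemma orthonormal_complete:
  assumes "orthonormal d d v" "i < d" "l < d"
  shows "(\<Sum>a<d. v a l * cnj (v a i)) = (if l = i then 1 else 0)"
proof -
  have "(\<Sum>i<d. \<Sum>l<d. (cmod ((if l = i then 1 else 0) - (\<Sum>a<d. v a l * cnj (v a i))))\<^sup>2) = 0"
    using orthonormal_defect[OF assms(1)] by simp
  then have "(\<Sum>l<d. (cmod ((if l = i then 1 else 0) - (\<Sum>a<d. v a l * cnj (v a i))))\<^sup>2) = 0"
    by (subst (asm) sum_nonneg_eq_0_iff) (use assms(2) in \<open>auto intro: sum_nonneg\<close>)
  then have "(cmod ((if l = i then 1 else 0) - (\<Sum>a<d. v a l * cnj (v a i))))\<^sup>2 = 0"
    by (subst (asm) sum_nonneg_eq_0_iff) (use assms(3) in auto)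
  then show ?thesis by simp
qed

text \<open>All conditions are closed in the product topology, and the set lies in a product of unit
  discs, which is compact by Tychonoff's theorem. The vanishing tail bounds the coordinates that the
  inner product does not see.\<close>

lemma compact_unit_sphere_section:
  "compact {u :: nat \<Rightarrow> complex. ip d u u = 1 \<and> (\<forall>a<k. ip d (v a) u = 0) \<and> (\<forall>i\<ge>d. u i = 0)}"
    (is "compact ?S")
proof -
  let ?K = "PiE UNIV (\<lambda>i::nat. cball (0::complex) 1) :: (nat \<Rightarrow> complex) set"
  have "compactin (product_topology (\<lambda>i::nat. euclidean :: complex topology) UNIV) ?K"
    by (subst compactin_PiE) auto
  then have K: "compact ?K"
    by (simp add: euclidean_product_topology)
  have coord: "continuous_on UNIV (\<lambda>u::nat \<Rightarrow> complex. u i)" for i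
    by (rule continuous_on_product_coordinates)
  have eq: "?S = {u. ip d u u = 1} \<inter> (\<Inter>a\<in>{..<k}. {u. ip d (v a) u = 0}) \<inter> (\<Inter>i\<in>{d..}. {u. u i = 0})"
    by auto
  have "closed ?S"
    unfolding eq unfolding ip_def
    by (intro closed_Int closed_INT ballI closed_Collect_eq continuous_intros coord)
  moreover have "?S \<subseteq> ?K"
  proof
    fix u assume u: "u \<in> ?S"
    have "cmod (u i) \<le> 1" for i
    proof (cases "i < d")
      case True
      have "of_real (\<Sum>i<d. (cmod (u i))\<^sup>2) = (1::complex)" using u by (simp add: ip_self)
      then have "(\<Sum>i<d. (cmod (u i))\<^sup>2) = 1" using of_real_eq_1_iff by blast
      then have "(cmod (u i))\<^sup>2 \<le> 1"
        using member_le_sum[of i "{..<d}" "\<lambda>i. (cmod (u i))\<^sup>2"] True by simp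
      then show ?thesis by (simp add: power_le_one_iff abs_square_le_1)
    next
      case False
      with u show ?thesis by simp
    qed
    then show "u \<in> ?K" by (auto simp: dist_norm)
  qed
  ultimately show ?thesis
    using K compact_Int_closed[of ?K ?S] by (simp add: Int_absorb1)
qed

lemma nonneg_quadratic_linear_zero:
  fixes a b :: real
  assumes "\<And>t. 0 \<le> t\<^sup>2 * a + 2 * t * b" "0 \<le> b"
  shows "b = 0"
proof (rule ccontr)
  assume "b \<noteq> 0"
  with assms(2) have b: "b > 0" by simp
  \<comment> \<open>This value gives \<open>t\<^sup>2 * (1 + \<bar>a\<bar>) = - t * b\<close>, so
    the quadratic term eats at most half of the linear one and at most \<open>t * b < 0\<close>
    remains.\<close>
  define t where "t = - b / (1 + \<bar>a\<bar>)"
  have "t\<^sup>2 * a \<le> t\<^sup>2 * (1 + \<bar>a\<bar>)" by (intro mult_left_mono) auto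
  also have "t\<^sup>2 * (1 + \<bar>a\<bar>) = t * (t * (1 + \<bar>a\<bar>))" by (simp add: power2_eq_square)
  also have "t * (1 + \<bar>a\<bar>) = - b" by (simp add: t_def)
  finally have "t\<^sup>2 * a + 2 * t * b \<le> t * b" by (simp add: mult_ac)
  moreover have "t * b < 0" using b by (intro mult_neg_pos) (auto simp: t_def intro!: divide_neg_pos)
  ultimately show False using assms(1)[of t] by linarith
qed

text \<open>A maximiser of the Rayleigh quotient on the orthogonal complement of the eigenvectors found
  so far is again an eigenvector.\<close>
lemma next_eigenvector:
  assumes X: "adj X = X" and v: "orthonormal d k v" and k: "k < d"
    and eig: "\<And>a i. a < k \<Longrightarrow> i < d \<Longrightarrow> app d X (v a) i = of_real (\<mu> a) * v a i"
  shows "\<exists>u \<nu>. ip d u u = 1 \<and> (\<forall>a<k. ip d (v a) u = 0) \<and> (\<forall>i<d. app d X u i = of_real \<nu> * u i)"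
proof -
  let ?S = "{u. ip d u u = 1 \<and> (\<forall>a<k. ip d (v a) u = 0) \<and> (\<forall>i\<ge>d. u i = 0)}"
  have coord: "continuous_on ?S (\<lambda>u::nat \<Rightarrow> complex. u i)" for i
    by (rule continuous_on_subset[OF continuous_on_product_coordinates]) simp
  have "continuous_on ?S (\<lambda>u. Re (ip d u (app d X u)))"
    unfolding ip_app by (intro continuous_intros coord)
  moreover have "?S \<noteq> {}" using exists_unit_orthogonal[OF v k] by blast
  ultimately obtain u where u: "u \<in> ?S"
    and max: "\<And>w. w \<in> ?S \<Longrightarrow> Re (ip d w (app d X w)) \<le> Re (ip d u (app d X u))"
    using continuous_attains_sup[OF compact_unit_sphere_section, of d k v "\<lambda>u. Re (ip d u (app d X u))"]
    by blast
  define \<nu> where "\<nu> = Re (ip d u (app d X u))"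
  \<comment> \<open>The Rayleigh bound freed from normalisation: \<open>g\<close> is non-negative on
    the whole complement of the \<open>v a\<close> and vanishes at the maximiser
    \<open>u\<close>.\<close>
  define g where "g w = \<nu> * Re (ip d w w) - Re (ip d w (app d X w))" for w
  have g_nonneg: "0 \<le> g w" if w: "\<forall>a<k. ip d (v a) w = 0" for w
  proof (cases "ip d w w = 0")
    case True
    then have z: "\<And>i. i < d \<Longrightarrow> w i = 0" by (rule ip_self_eq_0)
    have "ip d w (app d X w) = 0" by (simp add: ip_def z)
    with True show ?thesis by (simp add: g_def)
  next
    case False
    define r where "r = (\<Sum>l<d. (cmod (w l))\<^sup>2)"
    have r: "ip d w w = of_real r" by (simp add: ip_self r_def)
    have r0: "0 \<le> r" by (simp add: r_def sum_nonneg)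
    have rp: "r > 0" using r r0 False by (simp add: order_less_le)
    define w' where "w' = (\<lambda>l. complex_of_real (1 / sqrt r) * (if l < d then w l else 0))"
    have w'w: "ip d x w' = complex_of_real (1 / sqrt r) * ip d x w" for x
      by (simp add: w'_def ip_def sum_distrib_left algebra_simps)
    have w'w2: "ip d w' x = complex_of_real (1 / sqrt r) * ip d w x" for x
      by (simp add: w'_def ip_def sum_distrib_left algebra_simps)
    have aw: "app d X w' = (\<lambda>i. complex_of_real (1 / sqrt r) * app d X w i)"
      by (auto simp: w'_def app_def sum_distrib_left algebra_simps)
    have sr: "sqrt r * sqrt r = r" using rp by simp
    have "ip d w' w' = complex_of_real ((1 / sqrt r) * ((1 / sqrt r) * r))"
      by (simp only: w'w w'w2 r of_real_mult)
    also have "(1 / sqrt r) * ((1 / sqrt r) * r) = 1"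
      using rp by (simp add: field_simps)
    finally have "w' \<in> ?S" using w by (auto simp: w'w) (simp add: w'_def)
    from max[OF this] have "Re (ip d w' (app d X w')) \<le> \<nu>" by (simp add: \<nu>_def)
    moreover have "ip d w' (app d X w') = complex_of_real ((1 / sqrt r) * (1 / sqrt r)) * ip d w (app d X w)"
      by (simp only: aw ip_scale_right w'w2 of_real_mult mult.assoc)
    moreover have "(1 / sqrt r) * (1 / sqrt r) = 1 / r"
      using sr by (simp add: field_simps)
    ultimately have "Re (ip d w (app d X w)) / r \<le> \<nu>" by simp
    then show ?thesis using rp r by (simp add: g_def field_simps)
  qed
  \<comment> \<open>The residual of the eigenvalue equation. It stays orthogonal to the earlier
    eigenvectors because a Hermitian matrix maps their complement into itself.\<close>
  define w where "w = (\<lambda>i. of_real \<nu> * u i - app d X u i)"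
  have uo: "ip d (v a) u = 0" if "a < k" for a using u that by blast
  have wo: "ip d (v a) w = 0" if a: "a < k" for a
  proof -
    have "ip d (v a) (app d X u) = ip d (app d X (v a)) u"
      by (simp add: ip_app_hermitian[OF X])
    also have "\<dots> = ip d (\<lambda>i. of_real (\<mu> a) * v a i) u"
      unfolding ip_def by (intro sum.cong refl) (simp add: eig[OF a])
    also have "\<dots> = 0" by (simp add: ip_scale_left uo[OF a])
    finally show ?thesis by (simp add: w_def ip_diff_right ip_scale_right uo[OF a])
  qed
  have uu: "ip d u u = 1" using u by blast
  \<comment> \<open>First-order optimality: moving from \<open>u\<close> along \<open>w\<close>
    changes \<open>g\<close> at linear order by twice the squared norm of \<open>w\<close>. As
    \<open>g\<close> is non-negative for every \<open>t\<close>, this norm must be 0.\<close>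
  have quad: "g (\<lambda>i. u i + of_real t * w i) = t\<^sup>2 * g w + 2 * t * Re (ip d w w)" for t
  proof -
    define A where "A = ip d u (app d X w)"
    define B where "B = ip d u w"
    have wu: "ip d w u = cnj B" by (simp add: B_def ip_cnj)
    have wau: "ip d w (app d X u) = cnj A" by (simp add: A_def ip_cnj ip_app_hermitian[OF X])
    have "ip d w w = of_real \<nu> * ip d w u - ip d w (app d X u)"
      by (subst (2) w_def) (simp add: ip_diff_right ip_scale_right)
    then have ww: "Re (ip d w w) = \<nu> * Re B - Re A" by (simp add: wu wau)
    have e1: "ip d (\<lambda>i. u i + of_real t * w i) (\<lambda>i. u i + of_real t * w i)
        = ip d u u + of_real t * (B + cnj B) + of_real t * of_real t * ip d w w"
      by (simp add: ip_add_left ip_add_right ip_scale_left ip_scale_right wu B_def[symmetric] algebra_simps)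
    have e2: "ip d (\<lambda>i. u i + of_real t * w i) (app d X (\<lambda>i. u i + of_real t * w i))
        = ip d u (app d X u) + of_real t * (A + cnj A) + of_real t * of_real t * ip d w (app d X w)"
      by (simp add: app_add app_scale ip_add_left ip_add_right ip_scale_left ip_scale_right wau A_def[symmetric] algebra_simps)
    show ?thesis
      unfolding g_def e1 e2 using uu
      by (simp add: \<nu>_def[symmetric] ww algebra_simps power2_eq_square)
  qed
  have "0 \<le> t\<^sup>2 * g w + 2 * t * Re (ip d w w)" for t
    unfolding quad[symmetric]
    by (rule g_nonneg) (simp add: ip_add_right ip_scale_right uo wo)
  from nonneg_quadratic_linear_zero[OF this ip_self_Re_nonneg] have "Re (ip d w w) = 0" .
  then have "ip d w w = 0" by (simp add: ip_self)
  then have "\<forall>i<d. w i = 0" using ip_self_eq_0 by blast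
  then have "\<forall>i<d. app d X u i = of_real \<nu> * u i" by (simp add: w_def)
  with u show ?thesis by blast
qed

lemma hermitian_eigenbasis_partial:
  assumes X: "adj X = X" and "k \<le> d"
  shows "\<exists>v \<mu>. orthonormal d k v \<and> (\<forall>a<k. \<forall>i<d. app d X (v a) i = of_real (\<mu> a) * v a i)"
  using assms(2)
proof (induction k)
  case 0
  show ?case by (simp add: orthonormal_def)
next
  case (Suc k)
  then obtain v \<mu> where v: "orthonormal d k v"
    and eig: "\<And>a i. a < k \<Longrightarrow> i < d \<Longrightarrow> app d X (v a) i = of_real (\<mu> a) * v a i"
    by (metis Suc_leD)
  from next_eigenvector[OF X v _ eig] Suc.prems obtain u \<nu>
    where u: "ip d u u = 1" "\<forall>a<k. ip d (v a) u = 0" "\<forall>i<d. app d X u i = of_real \<nu> * u i"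
    by (metis Suc_le_eq)
  have u': "ip d u (v a) = 0" if "a < k" for a
    using u(2) that ip_cnj[of d "v a" u] by simp
  have "orthonormal d (Suc k) (v(k := u))"
    using v u u' by (auto simp: orthonormal_def less_Suc_eq)
  moreover have "\<forall>a<Suc k. \<forall>i<d. app d X ((v(k := u)) a) i = of_real ((\<mu>(k := \<nu>)) a) * (v(k := u)) a i"
    using eig u(3) by (auto simp: less_Suc_eq)
  ultimately show ?case by blast
qed

text \<open>The last conclusion gives the eigenvalues as values of the quadratic form; through it
  positivity of \<open>X\<close> passes to them.\<close>

theorem spectral_decomposition:
  assumes "is_mat d d X" "adj X = X"
  obtains v \<mu> where "orthonormal d d v"
    "\<And>i j. i < d \<Longrightarrow> j < d \<Longrightarrow> X i j = (\<Sum>a<d. of_real (\<mu> a) * v a i * cnj (v a j))"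
    "\<And>a. a < d \<Longrightarrow> \<mu> a = Re (ip d (v a) (app d X (v a)))"
proof -
  from hermitian_eigenbasis_partial[OF assms(2), of d d] obtain v \<mu> where v: "orthonormal d d v"
    and eig: "\<And>a i. a < d \<Longrightarrow> i < d \<Longrightarrow> app d X (v a) i = of_real (\<mu> a) * v a i"
    by auto
  have "X i j = (\<Sum>a<d. of_real (\<mu> a) * v a i * cnj (v a j))" if ij: "i < d" "j < d" for i j
  proof -
    have "X i j = (\<Sum>l<d. X i l * (if l = j then 1 else 0))"
      using ij by (simp add: if_distrib cong: if_cong)
    also have "\<dots> = (\<Sum>l<d. X i l * (\<Sum>a<d. v a l * cnj (v a j)))"
      by (intro sum.cong refl) (use orthonormal_complete[OF v] ij in simp)
    also have "\<dots> = (\<Sum>a<d. app d X (v a) i * cnj (v a j))"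
      unfolding app_def sum_distrib_left sum_distrib_right
      by (subst sum.swap) (simp add: mult.assoc)
    also have "\<dots> = (\<Sum>a<d. of_real (\<mu> a) * v a i * cnj (v a j))"
      by (intro sum.cong refl) (use eig ij in simp)
    finally show ?thesis .
  qed
  moreover have "\<mu> a = Re (ip d (v a) (app d X (v a)))" if a: "a < d" for a
  proof -
    have "ip d (v a) (app d X (v a)) = ip d (v a) (\<lambda>i. of_real (\<mu> a) * v a i)"
      unfolding ip_def by (intro sum.cong refl) (use eig a in simp)
    also have "\<dots> = of_real (\<mu> a)" using v a by (simp add: ip_scale_right orthonormal_def)
    finally show ?thesis by simp
  qed
  ultimately show ?thesis using that v by blast
qed

section \<open>Positive matrices and the trace norm\<close>

lemma psd_sum_rank_one:
  assumes "psd d X"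
  obtains w where "X = mk d d (\<lambda>i j. \<Sum>a<d. w a i * cnj (w a j))"
proof -
  from assms have m: "is_mat d d X" and h: "adj X = X"
    and pos: "\<And>v. 0 \<le> Re (ip d v (app d X v))"
    by (auto simp: psd_def ip_app)
  from spectral_decomposition[OF m h] obtain v \<mu> where
    X: "\<And>i j. i < d \<Longrightarrow> j < d \<Longrightarrow> X i j = (\<Sum>a<d. of_real (\<mu> a) * v a i * cnj (v a j))"
    and mu: "\<And>a. a < d \<Longrightarrow> \<mu> a = Re (ip d (v a) (app d X (v a)))" by metis
  \<comment> \<open>Positivity makes every \<open>\<mu> a\<close> non-negative, so its square root
    can be absorbed into the eigenvector.\<close>
  define w where "w a = (\<lambda>i. of_real (sqrt (\<mu> a)) * v a i)" for a
  have "X = mk d d (\<lambda>i j. \<Sum>a<d. w a i * cnj (w a j))"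
  proof (intro ext)
    fix i j
    show "X i j = mk d d (\<lambda>i j. \<Sum>a<d. w a i * cnj (w a j)) i j"
    proof (cases "i < d \<and> j < d")
      case True
      have "of_real (\<mu> a) * v a i * cnj (v a j) = w a i * cnj (w a j)" if "a < d" for a
      proof -
        have "0 \<le> \<mu> a" using mu[OF that] pos by simp
        then have "of_real (\<mu> a) = complex_of_real (sqrt (\<mu> a)) * of_real (sqrt (\<mu> a))"
          by (simp flip: of_real_mult)
        then show ?thesis by (simp add: w_def)
      qed
      with True X show ?thesis by (simp add: mk_def)
    next
      case False
      with m show ?thesis by (auto simp: mk_def is_mat_def)
    qed
  qed
  with that show ?thesis .
qed

text \<open>For Hermitian matrices this is the same as having trace norm at most \<open>t\<close>, in a form
  for which monotonicity under channels is immediate.\<close>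
definition tn_bound :: "nat \<Rightarrow> cmat \<Rightarrow> real \<Rightarrow> bool" where
  "tn_bound d X t \<longleftrightarrow> (\<exists>P Q. psd d P \<and> psd d Q \<and> X = (\<lambda>i j. P i j - Q i j) \<and> Re (tr d P) + Re (tr d Q) \<le> t)"

lemma psd_ip: "psd d X \<longleftrightarrow> is_mat d d X \<and> adj X = X \<and> (\<forall>v. 0 \<le> Re (ip d v (app d X v)))"
  by (simp add: psd_def ip_app)

lemma sum_rotate:
  "(\<Sum>i\<in>A. \<Sum>j\<in>B. \<Sum>k\<in>C. f i j k) = (\<Sum>k\<in>C. \<Sum>i\<in>A. \<Sum>j\<in>B. f i j k)"
  by (rule trans[OF sum.cong[OF refl sum.swap] sum.swap])

text \<open>The quadratic form at \<open>v\<close> is the sum of the squared moduli of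
  \<open>ip d v (w a)\<close>. The number of terms is independent of \<open>d\<close>, so that one
  vector already gives a pure state.\<close>

lemma psd_sum_rank_oneI:
  fixes n :: nat
  shows "psd d (mk d d (\<lambda>i j. \<Sum>a<n. w a i * cnj (w a j)))"
proof -
  have "Re (ip d v (app d (mk d d (\<lambda>i j. \<Sum>a<n. w a i * cnj (w a j))) v)) \<ge> 0" for v
  proof -
    have "ip d v (app d (mk d d (\<lambda>i j. \<Sum>a<n. w a i * cnj (w a j))) v)
      = (\<Sum>i<d. \<Sum>j<d. \<Sum>a<n. (cnj (v i) * w a i) * (cnj (w a j) * v j))"
      unfolding ip_app mk_def by (simp add: sum_distrib_left sum_distrib_right mult_ac)
    also have "\<dots> = (\<Sum>a<n. \<Sum>i<d. \<Sum>j<d. (cnj (v i) * w a i) * (cnj (w a j) * v j))"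
      by (rule sum_rotate)
    also have "\<dots> = (\<Sum>a<n. ip d v (w a) * cnj (ip d v (w a)))"
      by (simp add: ip_cnj) (simp add: ip_def sum_product)
    also have "\<dots> = of_real (\<Sum>a<n. (cmod (ip d v (w a)))\<^sup>2)"
      by (simp only: complex_norm_square of_real_sum)
    finally show ?thesis by (simp add: sum_nonneg)
  qed
  then show ?thesis
    unfolding psd_ip by (auto simp: is_mat_def mk_def adj_def mult.commute fun_eq_iff)
qed

lemma svd_entry:
  assumes "i < d" "j < d"
  shows "mmul d d d (mmul d d d U (diagm d s)) (adj V) i j = (\<Sum>a<d. of_real (s a) * U i a * cnj (V j a))"
  using assms
  by (simp add: mmul_def mk_def diagm_def adj_def if_distrib[of "\<lambda>x. _ * x"] mult_ac cong: if_cong)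

lemma is_mat_mmul: "is_mat m n (mmul m k n X Y)"
  by (auto simp: is_mat_def mmul_def mk_def)

lemma unitary_orthonormal:
  assumes "unitary d U"
  shows "orthonormal d d (\<lambda>a i. U i a)"
proof -
  have "mmul d d d (adj U) U a b = idm d a b" for a b
    using assms by (simp add: unitary_def)
  from this show ?thesis
    by (auto simp: orthonormal_def ip_def mmul_def mk_def adj_def idm_def) metis+
qed

lemma orthonormal_unitary:
  assumes "orthonormal d d v"
  shows "unitary d (mk d d (\<lambda>i a. v a i))"
  using assms
  by (auto simp: unitary_def is_mat_def mk_def mmul_def idm_def adj_def orthonormal_def ip_def fun_eq_iff)

text \<open>The absolute values of the eigenvalues serve as singular values; the signs are moved
  into the right vectors.\<close>

lemma hermitian_svd:
  assumes "is_mat d d X" "adj X = X"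
  obtains U V s where "unitary d U" "unitary d V" "\<forall>i<d. 0 \<le> s i"
    "X = mmul d d d (mmul d d d U (diagm d s)) (adj V)"
proof -
  from spectral_decomposition[OF assms] obtain v \<mu> where v: "orthonormal d d v"
    and X: "\<And>i j. i < d \<Longrightarrow> j < d \<Longrightarrow> X i j = (\<Sum>a<d. of_real (\<mu> a) * v a i * cnj (v a j))" by metis
  \<comment> \<open>A zero eigenvalue gets sign 1, so that the right vectors remain unit
    vectors.\<close>
  define g where "g a = (if \<mu> a < 0 then -1 else 1 :: real)" for a
  define w where "w a i = of_real (g a) * v a i" for a i
  have "orthonormal d d w"
    unfolding orthonormal_def
  proof (intro allI impI)
    fix a b assume "a < d" "b < d"
    moreover have "w c = (\<lambda>i. of_real (g c) * v c i)" for c by (simp add: w_def fun_eq_iff)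
    ultimately show "ip d (w a) (w b) = (if a = b then 1 else 0)"
      using v by (simp only: ip_scale_left ip_scale_right) (auto simp: orthonormal_def g_def)
  qed
  note U = orthonormal_unitary[OF v] and V = orthonormal_unitary[OF this]
  let ?Y = "mmul d d d (mmul d d d (mk d d (\<lambda>i a. v a i)) (diagm d (\<lambda>a. \<bar>\<mu> a\<bar>))) (adj (mk d d (\<lambda>i a. w a i)))"
  have "X = ?Y"
  proof (intro ext)
    fix i j
    show "X i j = ?Y i j"
    proof (cases "i < d \<and> j < d")
      case True
      then show ?thesis
        by (simp add: svd_entry X) (auto simp: mk_def w_def g_def intro!: sum.cong)
    next
      case False
      then show ?thesis using assms(1) is_mat_mmul by (auto simp: is_mat_def)
    qed
  qed
  with that[OF U V, of "\<lambda>a. \<bar>\<mu> a\<bar>"] show ?thesis by auto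
qed

text \<open>Opens the choice inside \<open>trace_norm\<close>: it returns some decomposition that
  attains the chosen value, and the estimates below work with that one.\<close>

lemma trace_norm_svd:
  assumes "is_mat d d X" "adj X = X"
  obtains U V s where "unitary d U" "unitary d V" "\<And>i. i < d \<Longrightarrow> 0 \<le> s i"
    "X = mmul d d d (mmul d d d U (diagm d s)) (adj V)" "trace_norm d X = (\<Sum>i<d. s i)"
proof -
  define R where "R t \<longleftrightarrow> (\<exists>U V (s :: nat \<Rightarrow> real). unitary d U \<and> unitary d V \<and>
      (\<forall>i<d. 0 \<le> s i) \<and> X = mmul d d d (mmul d d d U (diagm d s)) (adj V) \<and> t = (\<Sum>i<d. s i))" for t
  have "\<exists>t. R t" unfolding R_def using hermitian_svd[OF assms] by metis
  then have "R (trace_norm d X)"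
    unfolding trace_norm_def R_def[symmetric] by (rule someI_ex)
  then show ?thesis unfolding R_def using that by blast
qed

text \<open>Positivity of the form at \<open>u - v\<close> and at \<open>u + v\<close>.\<close>

lemma psd_cross_le:
  assumes "psd d P"
  shows "2 * Re (ip d u (app d P v)) \<le> Re (ip d u (app d P u)) + Re (ip d v (app d P v))"
    and "- 2 * Re (ip d u (app d P v)) \<le> Re (ip d u (app d P u)) + Re (ip d v (app d P v))"
proof -
  from assms have h: "adj P = P" and pos: "\<And>v. 0 \<le> Re (ip d v (app d P v))"
    by (auto simp: psd_ip)
  have vu: "ip d v (app d P u) = cnj (ip d u (app d P v))"
    by (simp add: ip_cnj ip_app_hermitian[OF h])
  have *: "Re (ip d (\<lambda>i. u i + of_real c * v i) (app d P (\<lambda>i. u i + of_real c * v i)))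
      = Re (ip d u (app d P u)) + 2 * c * Re (ip d u (app d P v)) + c * c * Re (ip d v (app d P v))" for c
    by (simp only: app_add app_scale ip_add_left ip_add_right ip_scale_left ip_scale_right vu) (simp add: algebra_simps)
  show "2 * Re (ip d u (app d P v)) \<le> Re (ip d u (app d P u)) + Re (ip d v (app d P v))"
    using *[of "-1"] pos[of "\<lambda>i. u i + of_real (-1) * v i"] by simp
  show "- 2 * Re (ip d u (app d P v)) \<le> Re (ip d u (app d P u)) + Re (ip d v (app d P v))"
    using *[of 1] pos[of "\<lambda>i. u i + of_real 1 * v i"] by simp
qed

lemma trace_orthonormal:
  assumes "orthonormal d d v"
  shows "(\<Sum>a<d. ip d (v a) (app d P (v a))) = tr d P"
proof -
  have "(\<Sum>a<d. ip d (v a) (app d P (v a))) = (\<Sum>i<d. \<Sum>j<d. P i j * (\<Sum>a<d. v a j * cnj (v a i)))"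
    unfolding ip_app sum_distrib_left
    by (subst sum.swap, subst (2) sum.swap) (simp add: mult_ac)
  also have "\<dots> = (\<Sum>i<d. \<Sum>j<d. P i j * (if j = i then 1 else 0))"
    by (intro sum.cong refl) (use orthonormal_complete[OF assms] in simp)
  also have "\<dots> = tr d P" by (simp add: tr_def if_distrib cong: if_cong)
  finally show ?thesis .
qed

text \<open>A singular value is the matrix element of \<open>X\<close> between its left and right
  vectors. Splitting \<open>X\<close> into \<open>P\<close> minus \<open>Q\<close> and bounding the
  cross terms by averages of diagonal terms, the sum over both orthonormal bases becomes the two
  traces.\<close>

lemma trace_norm_le_of_tn_bound:
  assumes X: "is_mat d d X" "adj X = X" and "tn_bound d X t"
  shows "trace_norm d X \<le> t"
proof -
  from assms(3) obtain P Q where P: "psd d P" and Q: "psd d Q" and XPQ: "X = (\<lambda>i j. P i j - Q i j)"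
    and t: "Re (tr d P) + Re (tr d Q) \<le> t" by (auto simp: tn_bound_def)
  from trace_norm_svd[OF X] obtain U V s where U: "unitary d U" and V: "unitary d V"
    and s: "X = mmul d d d (mmul d d d U (diagm d s)) (adj V)" and n: "trace_norm d X = (\<Sum>i<d. s i)"
    by metis
  let ?u = "\<lambda>a i. U i a" and ?v = "\<lambda>a i. V i a"
  have u: "orthonormal d d ?u" and v: "orthonormal d d ?v" using U V by (auto intro: unitary_orthonormal)
  have e: "ip d (?u a) (app d X (?v a)) = of_real (s a)" if a: "a < d" for a
  proof -
    have "ip d (?u a) (app d X (?v a)) = (\<Sum>i<d. \<Sum>j<d. \<Sum>b<d. of_real (s b) * ((cnj (U i a) * U i b) * (cnj (V j b) * V j a)))"
      unfolding ip_app
      by (intro sum.cong refl) (simp add: s svd_entry sum_distrib_left sum_distrib_right mult_ac)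
    also have "\<dots> = (\<Sum>b<d. \<Sum>i<d. \<Sum>j<d. of_real (s b) * ((cnj (U i a) * U i b) * (cnj (V j b) * V j a)))"
      by (rule sum_rotate)
    also have "\<dots> = (\<Sum>b<d. of_real (s b) * (ip d (?u a) (?u b) * ip d (?v b) (?v a)))"
      by (simp only: ip_def sum_product) (simp only: sum_distrib_left)
    also have "\<dots> = (\<Sum>b<d. if a = b then of_real (s b) else 0)"
      by (intro sum.cong refl) (use u v a in \<open>auto simp: orthonormal_def\<close>)
    finally show ?thesis using a by simp
  qed
  have d: "ip d x (app d X y) = ip d x (app d P y) - ip d x (app d Q y)" for x y
    by (simp add: XPQ ip_app algebra_simps sum_subtractf)
  have "2 * s a \<le> Re (ip d (?u a) (app d P (?u a))) + Re (ip d (?v a) (app d P (?v a)))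
      + (Re (ip d (?u a) (app d Q (?u a))) + Re (ip d (?v a) (app d Q (?v a))))" if "a < d" for a
    using arg_cong[OF e[OF that], of Re] arg_cong[OF d[of "?u a" "?v a"], of Re] psd_cross_le(1)[OF P, of "?u a" "?v a"]
      psd_cross_le(2)[OF Q, of "?u a" "?v a"] by simp
  then have "(\<Sum>a<d. 2 * s a) \<le> (\<Sum>a<d. Re (ip d (?u a) (app d P (?u a))) + Re (ip d (?v a) (app d P (?v a)))
      + (Re (ip d (?u a) (app d Q (?u a))) + Re (ip d (?v a) (app d Q (?v a)))))"
    by (intro sum_mono) auto
  also have "\<dots> = 2 * (Re (tr d P) + Re (tr d Q))"
    by (simp only: sum.distrib Re_sum[symmetric] trace_orthonormal[OF u] trace_orthonormal[OF v]) simp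
  finally show ?thesis using t n by (simp add: sum_distrib_left[symmetric])
qed

text \<open>From a singular value decomposition with vectors $u_a$, $v_a$ one gets the decomposition
  of a Hermitian matrix into the positive parts built from $(u_a + v_a)/2$ and $(u_a - v_a)/2$.\<close>
lemma trace_norm_le_imp_tn_bound:
  assumes X: "is_mat d d X" "adj X = X" and "trace_norm d X \<le> t"
  shows "tn_bound d X t"
proof -
  from trace_norm_svd[OF X] obtain U V s where U: "unitary d U" and V: "unitary d V"
    and s0: "\<And>i. i < d \<Longrightarrow> 0 \<le> s i"
    and s: "X = mmul d d d (mmul d d d U (diagm d s)) (adj V)" and n: "trace_norm d X = (\<Sum>i<d. s i)"
    by metis
  define f where "f c a i = of_real (sqrt (s a) / 2) * (U i a + of_real c * V i a)" for c a i
  define P where "P c = mk d d (\<lambda>i j. \<Sum>a<d. f c a i * cnj (f c a j))" for c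
  have u: "orthonormal d d (\<lambda>a i. U i a)" and v: "orthonormal d d (\<lambda>a i. V i a)"
    using U V by (auto intro: unitary_orthonormal)
  have ff: "f c a i * cnj (f c a j) = of_real (s a / 4) * ((U i a + of_real c * V i a) * cnj (U j a + of_real c * V j a))"
    if "a < d" for c a i j
  proof -
    have "(complex_of_real (sqrt (s a) / 2)) * (of_real (sqrt (s a) / 2)) = of_real (s a / 4)"
      using s0[OF that] by (simp flip: of_real_mult)
    then show ?thesis by (simp add: f_def mult_ac)
  qed
  have h: "cnj (X j i) = X i j" for i j
    using fun_cong[OF fun_cong[OF X(2), of i], of j] by (simp add: adj_def)
  have "X = (\<lambda>i j. P 1 i j - P (-1) i j)"
  proof (intro ext)
    fix i j
    show "X i j = P 1 i j - P (-1) i j"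
    proof (cases "i < d \<and> j < d")
      case True
      have "P 1 i j - P (-1) i j = (\<Sum>a<d. f 1 a i * cnj (f 1 a j) - f (-1) a i * cnj (f (-1) a j))"
        using True by (simp add: P_def mk_def sum_subtractf)
      \<comment> \<open>The squares cancel and the cross terms survive. They make up half of
        \<open>X\<close> plus its adjoint, which is \<open>X\<close> because \<open>X\<close> is
        Hermitian.\<close>
      also have "\<dots> = (\<Sum>a<d. (of_real (s a) * U i a * cnj (V j a) + cnj (of_real (s a) * U j a * cnj (V i a))) / 2)"
        by (intro sum.cong refl) (simp add: ff, simp add: field_simps)
      also have "\<dots> = (X i j + cnj (X j i)) / 2"
        using True by (simp add: s svd_entry sum.distrib sum_divide_distrib[symmetric] cnj_sum)
      finally show ?thesis by (simp add: h)
    next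
      case False
      then show ?thesis using X(1) by (auto simp: P_def mk_def is_mat_def)
    qed
  qed
  moreover have "Re (tr d (P 1)) + Re (tr d (P (-1))) = (\<Sum>a<d. s a)"
  proof -
    have "tr d (P 1) + tr d (P (-1)) = (\<Sum>i<d. \<Sum>a<d. f 1 a i * cnj (f 1 a i) + f (-1) a i * cnj (f (-1) a i))"
      by (simp add: tr_def P_def mk_def sum.distrib)
    also have "\<dots> = (\<Sum>i<d. \<Sum>a<d. of_real (s a) * (cnj (U i a) * U i a + cnj (V i a) * V i a) / 2)"
      by (intro sum.cong refl) (simp add: ff, simp add: field_simps)
    also have "\<dots> = (\<Sum>a<d. of_real (s a) * (ip d (\<lambda>i. U i a) (\<lambda>i. U i a) + ip d (\<lambda>i. V i a) (\<lambda>i. V i a)) / 2)"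
      by (subst sum.swap) (simp add: ip_def sum.distrib[symmetric] sum_distrib_left sum_divide_distrib)
    also have "\<dots> = (\<Sum>a<d. of_real (s a))"
      by (intro sum.cong refl) (use u v in \<open>auto simp: orthonormal_def\<close>)
    finally have "Re (tr d (P 1) + tr d (P (-1))) = Re (\<Sum>a<d. of_real (s a))" by simp
    then show ?thesis by simp
  qed
  ultimately show ?thesis
    unfolding tn_bound_def
    using psd_sum_rank_oneI[of d "f 1" d] psd_sum_rank_oneI[of d "f (-1)" d] assms(3) n
    by (intro exI[of _ "P 1"] exI[of _ "P (-1)"]) (simp add: P_def)
qed

lemma tdist_le_iff:
  assumes "psd d \<rho>" "psd d \<sigma>"
  shows "tdist d \<rho> \<sigma> \<le> \<epsilon> \<longleftrightarrow> tn_bound d (\<lambda>i j. \<rho> i j - \<sigma> i j) (2 * \<epsilon>)"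
proof -
  have X: "is_mat d d (\<lambda>i j. \<rho> i j - \<sigma> i j)" "adj (\<lambda>i j. \<rho> i j - \<sigma> i j) = (\<lambda>i j. \<rho> i j - \<sigma> i j)"
    using assms by (auto simp: psd_def is_mat_def adj_def fun_eq_iff)
  show ?thesis
    using trace_norm_le_of_tn_bound[OF X, of "2 * \<epsilon>"] trace_norm_le_imp_tn_bound[OF X, of "2 * \<epsilon>"]
    by (auto simp: tdist_def)
qed

lemma tn_bound_minus: "tn_bound d (\<lambda>i j. A i j - B i j) t \<Longrightarrow> tn_bound d (\<lambda>i j. B i j - A i j) t"
proof -
  assume "tn_bound d (\<lambda>i j. A i j - B i j) t"
  then obtain P Q where *: "psd d P" "psd d Q" "(\<lambda>i j. A i j - B i j) = (\<lambda>i j. P i j - Q i j)"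
    "Re (tr d P) + Re (tr d Q) \<le> t" by (auto simp: tn_bound_def)
  have "B i j - A i j = Q i j - P i j" for i j
    using fun_cong[OF fun_cong[OF *(3), of i], of j] by (simp add: algebra_simps)
  with * show ?thesis unfolding tn_bound_def by (intro exI[of _ Q] exI[of _ P]) (auto simp: fun_eq_iff)
qed

section \<open>Linear, completely positive and trace-preserving maps\<close>

definition lin :: "nat \<Rightarrow> (cmat \<Rightarrow> cmat) \<Rightarrow> bool" where
  "lin d f \<longleftrightarrow>
    (\<forall>X Y. is_mat d d X \<longrightarrow> is_mat d d Y \<longrightarrow> f (\<lambda>i j. X i j + Y i j) = (\<lambda>i j. f X i j + f Y i j)) \<and>
    (\<forall>c X. is_mat d d X \<longrightarrow> f (\<lambda>i j. c * X i j) = (\<lambda>i j. c * f X i j))"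

text \<open>Complete positivity in Kraus form, without normalisation so that single branches of an
  instrument are covered. Like \<open>is_channel\<close>, it constrains only the values on
  \<open>m\<close> by \<open>m\<close> matrices.\<close>

definition cpm :: "nat \<Rightarrow> nat \<Rightarrow> (cmat \<Rightarrow> cmat) \<Rightarrow> bool" where
  "cpm m n f \<longleftrightarrow> (\<exists>Ks. (\<forall>K\<in>set Ks. is_mat n m K) \<and>
     (\<forall>X. is_mat m m X \<longrightarrow> f X = kraus_map m n Ks X))"

definition tp :: "nat \<Rightarrow> nat \<Rightarrow> (cmat \<Rightarrow> cmat) \<Rightarrow> bool" where
  "tp m n f \<longleftrightarrow> (\<forall>X. is_mat m m X \<longrightarrow> tr n (f X) = tr m X)"

abbreviation kr :: "nat \<Rightarrow> nat \<Rightarrow> cmat \<Rightarrow> cmat \<Rightarrow> cmat" where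
  "kr m p \<equiv> kron m m p p"

definition matrix_unit :: "nat \<Rightarrow> nat \<Rightarrow> cmat" where
  "matrix_unit k l = (\<lambda>i j. if i = k \<and> j = l then 1 else 0)"

lemma is_mat_mk [simp]: "is_mat m n (mk m n f)"
  by (simp add: is_mat_def mk_def)

lemma is_mat_kron [simp]: "is_mat (m * p) (n * q) (kron m n p q A B)"
  by (simp add: kron_def)

lemma is_mat_swap_mid [simp]: "is_mat (d1 * d2 * d3 * d4) (d1 * d2 * d3 * d4) (swap_mid d1 d2 d3 d4 X)"
  by (simp add: swap_mid_def)

lemma is_mat_id_tensor [simp]: "is_mat (r * m') (r * m') (id_tensor r m m' f X)"
  by (simp add: id_tensor_def)

lemma is_mat_tensor_id [simp]: "is_mat (m' * s) (m' * s) (tensor_id m m' s f X)"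
  by (simp add: tensor_id_def)

lemma is_mat_ptrace_right [simp]: "is_mat m m (ptrace_right m s X)"
  by (simp add: ptrace_right_def)

lemma is_mat_idm [simp]: "is_mat d d (idm d)"
  by (simp add: idm_def)

lemma is_mat_matrix_unit: "k < m \<Longrightarrow> l < n \<Longrightarrow> is_mat m n (matrix_unit k l)"
  by (auto simp: is_mat_def matrix_unit_def)

lemma is_mat_kraus_map [simp]: "is_mat n n (kraus_map m n Ks X)"
  by (simp add: kraus_map_def)

lemma is_mat_add: "is_mat m n X \<Longrightarrow> is_mat m n Y \<Longrightarrow> is_mat m n (\<lambda>i j. X i j + Y i j)"
  by (simp add: is_mat_def)

lemma is_mat_scale: "is_mat m n X \<Longrightarrow> is_mat m n (\<lambda>i j. c * X i j)"
  by (simp add: is_mat_def)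

lemma is_mat_sum: "(\<And>k. k \<in> S \<Longrightarrow> is_mat m n (X k)) \<Longrightarrow> is_mat m n (\<lambda>i j. \<Sum>k\<in>S. X k i j)"
  by (simp add: is_mat_def)

lemma is_mat_eqI:
  assumes "is_mat m n X" "is_mat m n Y" "\<And>i j. i < m \<Longrightarrow> j < n \<Longrightarrow> X i j = Y i j"
  shows "X = Y"
proof (intro ext)
  fix i j show "X i j = Y i j"
    using assms by (cases "i < m \<and> j < n") (auto simp: is_mat_def)
qed

lemma psd_is_mat: "psd d X \<Longrightarrow> is_mat d d X"
  by (simp add: psd_def)

lemma density_psd: "density d X \<Longrightarrow> psd d X"
  by (simp add: density_def)

section \<open>Linear maps\<close>

lemma lin_addD: "lin d f \<Longrightarrow> is_mat d d X \<Longrightarrow> is_mat d d Y \<Longrightarrow> f (\<lambda>i j. X i j + Y i j) = (\<lambda>i j. f X i j + f Y i j)"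
  by (simp add: lin_def)

lemma lin_scaleD: "lin d f \<Longrightarrow> is_mat d d X \<Longrightarrow> f (\<lambda>i j. c * X i j) = (\<lambda>i j. c * f X i j)"
  by (simp add: lin_def)

lemma lin_zero: "lin d f \<Longrightarrow> f (\<lambda>i j. 0) = (\<lambda>i j. 0)"
  using lin_scaleD[of d f "\<lambda>i j. 0" 0] by (simp add: is_mat_def)

lemma lin_diff:
  assumes "lin d f" "is_mat d d X" "is_mat d d Y"
  shows "f (\<lambda>i j. X i j - Y i j) = (\<lambda>i j. f X i j - f Y i j)"
  using lin_addD[OF assms(1,2) is_mat_scale[OF assms(3), of "-1"]] lin_scaleD[OF assms(1,3), of "-1"]
  by simp

lemma lin_sum:
  assumes "lin d f" "finite S" "\<And>k. k \<in> S \<Longrightarrow> is_mat d d (X k)"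
  shows "f (\<lambda>i j. \<Sum>k\<in>S. c k * X k i j) = (\<lambda>i j. \<Sum>k\<in>S. c k * f (X k) i j)"
  using assms(2,3)
proof (induction S rule: finite_induct)
  case empty
  then show ?case using lin_zero[OF assms(1)] by simp
next
  case (insert a S)
  have "is_mat d d (\<lambda>i j. c a * X a i j)" "is_mat d d (\<lambda>i j. \<Sum>k\<in>S. c k * X k i j)"
    using insert.prems by (auto intro!: is_mat_scale is_mat_sum)
  from lin_addD[OF assms(1) this] insert show ?case
    by (simp add: lin_scaleD[OF assms(1)])
qed

lemma lin_sum1:
  assumes "lin d f" "finite S" "\<And>k. k \<in> S \<Longrightarrow> is_mat d d (X k)"
  shows "f (\<lambda>i j. \<Sum>k\<in>S. X k i j) = (\<lambda>i j. \<Sum>k\<in>S. f (X k) i j)"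
  using lin_sum[OF assms(1,2), of X "\<lambda>_. 1"] assms(3) by simp

lemma linI_cong:
  assumes "lin d g" "\<And>X. is_mat d d X \<Longrightarrow> f X = g X"
  shows "lin d f"
  using assms unfolding lin_def by (simp add: is_mat_add is_mat_scale)

lemma lin_comp:
  assumes "lin d f" "lin e g" "\<And>X. is_mat d d X \<Longrightarrow> is_mat e e (f X)"
  shows "lin d (\<lambda>X. g (f X))"
  using assms unfolding lin_def by simp

lemma lin_sum_maps:
  assumes "\<And>k. k \<in> S \<Longrightarrow> lin d (f k)"
  shows "lin d (\<lambda>X i j. \<Sum>k\<in>S. f k X i j)"
  using assms unfolding lin_def by (simp add: sum.distrib sum_distrib_left)

lemma mat_expand:
  assumes "is_mat d d X"
  shows "X = (\<lambda>i j. \<Sum>k\<in>{..<d}\<times>{..<d}. X (fst k) (snd k) * matrix_unit (fst k) (snd k) i j)"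
proof (intro ext)
  fix i j
  have "(\<Sum>k\<in>{..<d}\<times>{..<d}. X (fst k) (snd k) * matrix_unit (fst k) (snd k) i j)
      = (\<Sum>k\<in>{..<d}\<times>{..<d}. if k = (i, j) then X i j else 0)"
    by (intro sum.cong refl) (auto simp: matrix_unit_def)
  also have "\<dots> = X i j" using assms by (auto simp: is_mat_def)
  finally show "X i j = (\<Sum>k\<in>{..<d}\<times>{..<d}. X (fst k) (snd k) * matrix_unit (fst k) (snd k) i j)" ..
qed

lemma lin_ext:
  assumes "lin d f" "lin d g" "\<And>k l. k < d \<Longrightarrow> l < d \<Longrightarrow> f (matrix_unit k l) = g (matrix_unit k l)" "is_mat d d X"
  shows "f X = g X"
proof -
  have *: "h X = (\<lambda>i j. \<Sum>k\<in>{..<d}\<times>{..<d}. X (fst k) (snd k) * h (matrix_unit (fst k) (snd k)) i j)" if "lin d h" for h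
    by (subst mat_expand[OF assms(4)], subst lin_sum[OF that]) (auto intro: is_mat_matrix_unit)
  have "f X = (\<lambda>i j. \<Sum>k\<in>{..<d}\<times>{..<d}. X (fst k) (snd k) * f (matrix_unit (fst k) (snd k)) i j)"
    by (rule *[OF assms(1)])
  also have "\<dots> = (\<lambda>i j. \<Sum>k\<in>{..<d}\<times>{..<d}. X (fst k) (snd k) * g (matrix_unit (fst k) (snd k)) i j)"
    by (intro ext sum.cong refl) (auto simp: assms(3))
  also have "\<dots> = g X" by (rule *[OF assms(2), symmetric])
  finally show ?thesis .
qed

text \<open>By polarisation the density matrices span all matrices.\<close>
lemma lin_ext_density:
  assumes f: "lin d f" and g: "lin d g" and eq: "\<And>X. density d X \<Longrightarrow> f X = g X" and X: "is_mat d d X"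
  shows "f X = g X"
proof (rule lin_ext[OF f g _ X])
  fix k l assume kl: "k < d" "l < d"
  define w where "w c i = (if i = k then 1 else 0) + (if i = l then c else 0)" for c :: complex and i :: nat
  define R where "R c = mk d d (\<lambda>i j. w c i * cnj (w c j))" for c :: complex
  have Rm: "is_mat d d (R c)" for c by (simp add: R_def)
  have R: "f (R c) = g (R c)" for c
  proof -
    have psd: "psd d (R c)"
      using psd_sum_rank_oneI[of d "\<lambda>_. w c" 1] by (simp add: R_def)
    define t where "t = (\<Sum>i<d. (cmod (w c i))\<^sup>2)"
    have tr: "tr d (R c) = of_real t"
      unfolding tr_def t_def of_real_sum complex_norm_square by (simp add: R_def mk_def)
    \<comment> \<open>For \<open>k = l\<close> and \<open>c = -1\<close> the vector
      \<open>w c\<close> is 0 and cannot be normalised to a state; there both maps send 0 to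
      0.\<close>
    show ?thesis
    proof (cases "t = 0")
      case True
      then have "\<And>i. i < d \<Longrightarrow> w c i = 0" unfolding t_def by (subst (asm) sum_nonneg_eq_0_iff) auto
      then have "R c = (\<lambda>i j. 0)" by (auto simp: R_def mk_def fun_eq_iff)
      then show ?thesis using lin_zero[OF f] lin_zero[OF g] by simp
    next
      case False
      moreover have "t \<ge> 0" by (simp add: t_def sum_nonneg)
      ultimately have t: "t > 0" by simp
      let ?S = "\<lambda>i j. of_real (1 / t) * R c i j"
      have "density d ?S"
        unfolding density_def psd_ip
      proof (intro conjI allI)
        show "is_mat d d ?S" by (intro is_mat_scale Rm)
        show "adj ?S = ?S"
          by (auto simp: adj_def R_def mk_def fun_eq_iff)
        show "tr d ?S = 1"
          using tr t by (simp add: tr_def sum_divide_distrib[symmetric])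
        fix v
        have "ip d v (app d ?S v) = of_real (1 / t) * ip d v (app d (R c) v)"
          by (simp add: ip_app sum_distrib_left mult_ac)
        then show "0 \<le> Re (ip d v (app d ?S v))"
          using psd t by (simp add: psd_ip)
      qed
      from eq[OF this] have "(\<lambda>i j. of_real (1 / t) * f (R c) i j) = (\<lambda>i j. of_real (1 / t) * g (R c) i j)"
        by (simp only: lin_scaleD[OF f Rm] lin_scaleD[OF g Rm])
      then show ?thesis using t by (simp add: fun_eq_iff)
    qed
  qed
  \<comment> \<open>The fourth roots of unity. Weighted by \<open>c\<close>, the entry at
    \<open>(k, l)\<close> of the rank-one matrix carries \<open>c * cnj c = 1\<close>, while the
    other three contributions carry \<open>c\<close> or its square and average to 0.\<close>
  define c where "c n = \<i> ^ n" for n :: nat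
  have "matrix_unit k l = (\<lambda>i j. \<Sum>n<4. (c n / 4) * R (c n) i j)"
  proof (rule is_mat_eqI[of d d])
    show "is_mat d d (matrix_unit k l)" using kl by (rule is_mat_matrix_unit)
    show "is_mat d d (\<lambda>i j. \<Sum>n<4. (c n / 4) * R (c n) i j)" by (intro is_mat_sum is_mat_scale Rm)
    fix i j assume ij: "i < d" "j < d"
    have "c 0 = 1" "c 1 = \<i>" "c 2 = -1" "c 3 = -\<i>"
      by (simp_all add: c_def power3_eq_cube)
    then have "(\<Sum>n<4. (c n / 4) * R (c n) i j)
        = (R 1 i j + \<i> * R \<i> i j - R (-1) i j - \<i> * R (-\<i>) i j) / 4"
      by (simp add: eval_nat_numeral)
    also have "\<dots> = matrix_unit k l i j"
      using ij by (cases "i = k"; cases "j = l"; cases "i = l"; cases "j = k")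
        (simp_all add: matrix_unit_def R_def mk_def w_def algebra_simps)
    finally show "matrix_unit k l i j = (\<Sum>n<4. (c n / 4) * R (c n) i j)" ..
  qed
  moreover have "h (\<lambda>i j. \<Sum>n<4. (c n / 4) * R (c n) i j) = (\<lambda>i j. \<Sum>n<4. (c n / 4) * h (R (c n)) i j)"
    if "lin d h" for h
    by (rule lin_sum[OF that]) (auto simp: Rm)
  ultimately show "f (matrix_unit k l) = g (matrix_unit k l)" using f g by (simp add: R)
qed

section \<open>Kronecker products\<close>

lemma idx_less: "i < m \<Longrightarrow> k < p \<Longrightarrow> i * p + k < m * (p :: nat)"
proof -
  assume "i < m" "k < p"
  then have "i * p + k < (i + 1) * p" by simp
  also have "\<dots> \<le> m * p" using \<open>i < m\<close> by (intro mult_le_mono1) simp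
  finally show ?thesis .
qed

lemma idx_div [simp]: "k < p \<Longrightarrow> (i * p + k) div p = (i :: nat)"
  by simp

lemma idx_mod [simp]: "k < p \<Longrightarrow> (i * p + k) mod p = (k :: nat)"
  by simp

lemma idx_cases:
  fixes x :: nat
  assumes "x < m * p"
  obtains i k where "x = i * p + k" "i < m" "k < p"
proof
  show "x = (x div p) * p + x mod p" by simp
  show "x div p < m" using assms by (simp add: less_mult_imp_div_less)
  show "x mod p < p" using assms by (cases p) auto
qed

lemma div_less_of: "x < m * p \<Longrightarrow> x div p < (m :: nat)"
  by (rule less_mult_imp_div_less)

lemma mod_less_of: "x < m * p \<Longrightarrow> x mod p < (p :: nat)"
  by (cases p) auto

lemma sum_idx: "(\<Sum>x<m * p. f x) = (\<Sum>i<m. \<Sum>k<p. f (i * p + k))" for f :: "nat \<Rightarrow> 'a :: comm_monoid_add"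
proof -
  have "(\<Sum>i<m. \<Sum>k<p. f (i * p + k)) = (\<Sum>z\<in>{..<m}\<times>{..<p}. f (fst z * p + snd z))"
    by (subst sum.cartesian_product) (simp add: case_prod_beta)
  also have "\<dots> = (\<Sum>x<m * p. f x)"
    by (rule sum.reindex_bij_witness[of _ "\<lambda>x. (x div p, x mod p)" "\<lambda>z. fst z * p + snd z"])
      (auto simp: idx_less div_less_of mod_less_of)
  finally show ?thesis ..
qed

lemma kron_at:
  assumes "i < m" "j < n" "k < p" "l < q"
  shows "kron m n p q A B (i * p + k) (j * q + l) = A i j * B k l"
  using assms by (simp add: kron_def mk_def idx_less)

text \<open>The index convention, first factor most significant, is itself associative.
  Reassociation is therefore an equality of matrices, and only the dimensions have to be rewritten
  by \<open>mult.assoc\<close>.\<close>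

lemma kron_assoc: "kr (m * p) q (kr m p A B) C = kr m (p * q) A (kr p q B C)"
proof (rule is_mat_eqI[of "m * p * q" "m * p * q"])
  show "is_mat (m * p * q) (m * p * q) (kr m (p * q) A (kr p q B C))"
    using is_mat_kron[of m "p * q" m "p * q"] by (simp add: mult.assoc)
  fix x y assume "x < m * p * q" "y < m * p * q"
  then obtain i k c j l d where x: "x = (i * p + k) * q + c" "i < m" "k < p" "c < q"
    and y: "y = (j * p + l) * q + d" "j < m" "l < p" "d < q"
    by (elim idx_cases) blast
  have x': "x = i * (p * q) + (k * q + c)" and y': "y = j * (p * q) + (l * q + d)"
    by (simp_all add: x y algebra_simps)
  have "kr (m * p) q (kr m p A B) C x y = A i j * B k l * C c d"
    unfolding x(1) y(1) using x(2-) y(2-) by (simp add: kron_at idx_less)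
  moreover have "kr m (p * q) A (kr p q B C) x y = A i j * (B k l * C c d)"
    unfolding x' y' using x(2-) y(2-) by (simp add: kron_at idx_less)
  ultimately show "kr (m * p) q (kr m p A B) C x y = kr m (p * q) A (kr p q B C) x y" by simp
qed simp

lemma kron_one_left:
  assumes "is_mat m m A"
  shows "kr 1 m (idm 1) A = A"
  using assms by (auto simp: kron_def mk_def idm_def is_mat_def fun_eq_iff)

lemma kron_one_right:
  assumes "is_mat m m A"
  shows "kr m 1 A (idm 1) = A"
  using assms by (auto simp: kron_def mk_def idm_def is_mat_def fun_eq_iff)

lemma kron_add_left: "kr m p (\<lambda>i j. A i j + A' i j) B = (\<lambda>i j. kr m p A B i j + kr m p A' B i j)"
  by (auto simp: kron_def mk_def fun_eq_iff algebra_simps)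

lemma kron_add_right: "kr m p A (\<lambda>i j. B i j + B' i j) = (\<lambda>i j. kr m p A B i j + kr m p A B' i j)"
  by (auto simp: kron_def mk_def fun_eq_iff algebra_simps)

lemma kron_scale_left: "kr m p (\<lambda>i j. c * A i j) B = (\<lambda>i j. c * kr m p A B i j)"
  by (auto simp: kron_def mk_def fun_eq_iff algebra_simps)

lemma kron_scale_right: "kr m p A (\<lambda>i j. c * B i j) = (\<lambda>i j. c * kr m p A B i j)"
  by (auto simp: kron_def mk_def fun_eq_iff algebra_simps)

lemma kron_sum_left: "kr m p (\<lambda>i j. \<Sum>k\<in>S. A k i j) B = (\<lambda>i j. \<Sum>k\<in>S. kr m p (A k) B i j)"
  by (auto simp: kron_def mk_def fun_eq_iff sum_distrib_right)

lemma kron_sum_right: "kr m p A (\<lambda>i j. \<Sum>k\<in>S. B k i j) = (\<lambda>i j. \<Sum>k\<in>S. kr m p A (B k) i j)"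
  by (auto simp: kron_def mk_def fun_eq_iff sum_distrib_left)

lemma lin_kron_left: "lin m (\<lambda>A. kr m p A B)"
  by (simp add: lin_def kron_add_left kron_scale_left)

lemma lin_kron_right: "lin p (\<lambda>B. kr m p A B)"
  by (simp add: lin_def kron_add_right kron_scale_right)

lemma matrix_unit_kron:
  assumes "k < m * p" "l < m * p"
  shows "matrix_unit k l = kr m p (matrix_unit (k div p) (l div p)) (matrix_unit (k mod p) (l mod p))"
proof (rule is_mat_eqI[of "m * p" "m * p"])
  show "is_mat (m * p) (m * p) (matrix_unit k l)" using assms by (rule is_mat_matrix_unit)
  fix i j assume ij: "i < m * p" "j < m * p"
  have eq: "(a = b) = (a div p = b div p \<and> a mod p = b mod p)" for a b :: nat
    by (metis div_mult_mod_eq)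
  show "matrix_unit k l i j = kr m p (matrix_unit (k div p) (l div p)) (matrix_unit (k mod p) (l mod p)) i j"
    using ij unfolding matrix_unit_def kron_def mk_def eq[of i k] eq[of j l] by simp
qed simp

text \<open>A matrix unit of the composite space is a product of matrix units, by splitting its two
  indices into quotient and remainder.\<close>

lemma lin_ext_kron:
  assumes "lin (m * p) f" "lin (m * p) g"
    and "\<And>A B. is_mat m m A \<Longrightarrow> is_mat p p B \<Longrightarrow> f (kr m p A B) = g (kr m p A B)"
    and "is_mat (m * p) (m * p) X"
  shows "f X = g X"
proof (rule lin_ext[OF assms(1,2) _ assms(4)])
  fix k l assume kl: "k < m * p" "l < m * p"
  have "is_mat m m (matrix_unit (k div p) (l div p))" "is_mat p p (matrix_unit (k mod p) (l mod p))"
    using kl by (auto intro!: is_mat_matrix_unit div_less_of mod_less_of)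
  from assms(3)[OF this] show "f (matrix_unit k l) = g (matrix_unit k l)" by (simp add: matrix_unit_kron[OF kl])
qed

lemma lin_ext_kron4:
  assumes f: "lin (m * n * (p * q)) f" and g: "lin (m * n * (p * q)) g"
    and eq: "\<And>A B C D. is_mat m m A \<Longrightarrow> is_mat n n B \<Longrightarrow> is_mat p p C \<Longrightarrow> is_mat q q D \<Longrightarrow>
      f (kr (m * n) (p * q) (kr m n A B) (kr p q C D)) = g (kr (m * n) (p * q) (kr m n A B) (kr p q C D))"
    and X: "is_mat (m * n * (p * q)) (m * n * (p * q)) X"
  shows "f X = g X"
proof (rule lin_ext_kron[OF f g _ X])
  fix U V assume U: "is_mat (m * n) (m * n) U" and V: "is_mat (p * q) (p * q) V"
  have l: "lin (m * n) (\<lambda>U. h (kr (m * n) (p * q) U V))" if "lin (m * n * (p * q)) h" for h V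
    by (rule lin_comp[OF lin_kron_left that]) simp
  have r: "lin (p * q) (\<lambda>V. h (kr (m * n) (p * q) U V))" if "lin (m * n * (p * q)) h" for h U
    by (rule lin_comp[OF lin_kron_right that]) simp
  show "f (kr (m * n) (p * q) U V) = g (kr (m * n) (p * q) U V)"
  proof (rule lin_ext_kron[OF l[OF f] l[OF g] _ U])
    fix A B assume AB: "is_mat m m A" "is_mat n n B"
    show "f (kr (m * n) (p * q) (kr m n A B) V) = g (kr (m * n) (p * q) (kr m n A B) V)"
      by (rule lin_ext_kron[OF r[OF f] r[OF g] _ V]) (rule eq[OF AB])
  qed
qed

lemma tr_kron: "tr (m * p) (kr m p A B) = tr m A * tr p B"
  by (simp add: tr_def sum_idx kron_at sum_product)

text \<open>\<open>id_tensor\<close> applies \<open>f\<close> block by block, and every block of a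
  product is a scalar multiple of \<open>B\<close>; linearity takes the scalar out.\<close>

lemma id_tensor_kron:
  assumes "lin m f" "is_mat m m B"
  shows "id_tensor r m m' f (kr r m A B) = kr r m' A (f B)"
proof (rule is_mat_eqI[of "r * m'" "r * m'"])
  fix i j assume "i < r * m'" "j < r * m'"
  then obtain a b k l where i: "i = a * m' + k" "a < r" "k < m'" and j: "j = b * m' + l" "b < r" "l < m'"
    by (elim idx_cases)
  have "mk m m (\<lambda>k l. kr r m A B (a * m + k) (b * m + l)) = (\<lambda>k l. A a b * B k l)"
    using assms(2) i j by (auto simp: mk_def kron_at is_mat_def fun_eq_iff)
  then show "id_tensor r m m' f (kr r m A B) i j = kr r m' A (f B) i j"
    using i j lin_scaleD[OF assms, of "A a b"]
    by (simp add: id_tensor_def mk_def[of "r * m'"] idx_less kron_at)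
qed simp_all

lemma tensor_id_kron:
  assumes "lin m f" "is_mat m m A"
  shows "tensor_id m m' s f (kr m s A B) = kr m' s (f A) B"
proof (rule is_mat_eqI[of "m' * s" "m' * s"])
  fix i j assume "i < m' * s" "j < m' * s"
  then obtain a b k l where i: "i = a * s + k" "a < m'" "k < s" and j: "j = b * s + l" "b < m'" "l < s"
    by (elim idx_cases)
  have "mk m m (\<lambda>c d. kr m s A B (c * s + k) (d * s + l)) = (\<lambda>c d. B k l * A c d)"
    using assms(2) i j by (auto simp: mk_def kron_at is_mat_def fun_eq_iff)
  then show "tensor_id m m' s f (kr m s A B) i j = kr m' s (f A) B i j"
    using i j lin_scaleD[OF assms, of "B k l"]
    by (simp add: tensor_id_def mk_def[of "m' * s"] idx_less kron_at)
qed simp_all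

lemma lin_id_tensor:
  assumes "lin m f"
  shows "lin (r * m) (id_tensor r m m' f)"
proof -
  have 1: "mk m m (\<lambda>k l. X (a + k) (b + l) + Y (a + k) (b + l))
      = (\<lambda>k l. mk m m (\<lambda>k l. X (a + k) (b + l)) k l + mk m m (\<lambda>k l. Y (a + k) (b + l)) k l)"
    "mk m m (\<lambda>k l. c * X (a + k) (b + l)) = (\<lambda>k l. c * mk m m (\<lambda>k l. X (a + k) (b + l)) k l)"
    for X Y :: cmat and a b c by (auto simp: mk_def fun_eq_iff)
  show ?thesis
    unfolding lin_def id_tensor_def 1
    by (simp add: lin_addD[OF assms] lin_scaleD[OF assms]) (auto simp: mk_def fun_eq_iff)
qed

lemma lin_tensor_id:
  assumes "lin m f"
  shows "lin (m * s) (tensor_id m m' s f)"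
proof -
  have 1: "mk m m (\<lambda>k l. X (k * s + a) (l * s + b) + Y (k * s + a) (l * s + b))
      = (\<lambda>k l. mk m m (\<lambda>k l. X (k * s + a) (l * s + b)) k l + mk m m (\<lambda>k l. Y (k * s + a) (l * s + b)) k l)"
    "mk m m (\<lambda>k l. c * X (k * s + a) (l * s + b)) = (\<lambda>k l. c * mk m m (\<lambda>k l. X (k * s + a) (l * s + b)) k l)"
    for X Y :: cmat and a b c by (auto simp: mk_def fun_eq_iff)
  show ?thesis
    unfolding lin_def tensor_id_def 1
    by (simp add: lin_addD[OF assms] lin_scaleD[OF assms]) (auto simp: mk_def fun_eq_iff)
qed

text \<open>The argument lists the digits in the new order 1, 3, 2, 4 and the value lists them in
  the old order: \<open>swap_mid\<close> pulls matrix entries back along this map.\<close>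

lemma sm_idx_at:
  assumes "i2 < d2" "i3 < d3" "i4 < d4"
  shows "sm_idx d1 d2 d3 d4 (((i1 * d3 + i3) * d2 + i2) * d4 + i4) = ((i1 * d2 + i2) * d3 + i3) * d4 + i4"
  using assms by (simp add: sm_idx_def Let_def)

lemma sm_idx_less:
  assumes "x < d1 * d2 * d3 * d4"
  shows "sm_idx d1 d2 d3 d4 x < d1 * d2 * d3 * d4"
proof -
  have "x < d1 * d3 * d2 * d4" using assms by (simp add: mult_ac)
  then obtain i1 i3 i2 i4 where "x = ((i1 * d3 + i3) * d2 + i2) * d4 + i4" "i1 < d1" "i2 < d2" "i3 < d3" "i4 < d4"
    by (elim idx_cases) blast
  then show ?thesis by (simp add: sm_idx_at idx_less)
qed

lemma lin_swap_mid: "lin d (swap_mid d1 d2 d3 d4)"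
  by (auto simp: lin_def swap_mid_def mk_def fun_eq_iff)

lemma swap_mid_kron:
  "swap_mid d1 d2 d3 d4 (kr (d1 * d2) (d3 * d4) (kr d1 d2 A B) (kr d3 d4 C D))
    = kr (d1 * d3) (d2 * d4) (kr d1 d3 A C) (kr d2 d4 B D)"
proof (rule is_mat_eqI[of "d1 * d2 * d3 * d4" "d1 * d2 * d3 * d4"])
  show "is_mat (d1 * d2 * d3 * d4) (d1 * d2 * d3 * d4) (kr (d1 * d3) (d2 * d4) (kr d1 d3 A C) (kr d2 d4 B D))"
    using is_mat_kron[of "d1 * d3" "d2 * d4" "d1 * d3" "d2 * d4"] by (simp add: mult_ac)
  fix x y assume xy: "x < d1 * d2 * d3 * d4" "y < d1 * d2 * d3 * d4"
  then have "x < d1 * d3 * d2 * d4" "y < d1 * d3 * d2 * d4" by (simp_all add: mult_ac)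
  then obtain i1 i3 i2 i4 j1 j3 j2 j4 where
    x: "x = ((i1 * d3 + i3) * d2 + i2) * d4 + i4" "i1 < d1" "i2 < d2" "i3 < d3" "i4 < d4"
    and y: "y = ((j1 * d3 + j3) * d2 + j2) * d4 + j4" "j1 < d1" "j2 < d2" "j3 < d3" "j4 < d4"
    by (elim idx_cases) blast
  have x': "x = (i1 * d3 + i3) * (d2 * d4) + (i2 * d4 + i4)" and y': "y = (j1 * d3 + j3) * (d2 * d4) + (j2 * d4 + j4)"
    by (simp_all add: x y algebra_simps)
  have "sm_idx d1 d2 d3 d4 x = (i1 * d2 + i2) * (d3 * d4) + (i3 * d4 + i4)"
    "sm_idx d1 d2 d3 d4 y = (j1 * d2 + j2) * (d3 * d4) + (j3 * d4 + j4)"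
    unfolding x(1) y(1) using x(2-) y(2-) by (simp_all add: sm_idx_at) (simp_all add: algebra_simps)
  then have "swap_mid d1 d2 d3 d4 (kr (d1 * d2) (d3 * d4) (kr d1 d2 A B) (kr d3 d4 C D)) x y
      = A i1 j1 * B i2 j2 * (C i3 j3 * D i4 j4)"
    using xy x(2-) y(2-) by (simp add: swap_mid_def mk_def kron_at idx_less)
  moreover have "kr (d1 * d3) (d2 * d4) (kr d1 d3 A C) (kr d2 d4 B D) x y
      = A i1 j1 * C i3 j3 * (B i2 j2 * D i4 j4)"
    unfolding x' y' using x(2-) y(2-) by (simp add: kron_at idx_less)
  ultimately show "swap_mid d1 d2 d3 d4 (kr (d1 * d2) (d3 * d4) (kr d1 d2 A B) (kr d3 d4 C D)) x y
      = kr (d1 * d3) (d2 * d4) (kr d1 d3 A C) (kr d2 d4 B D) x y" by simp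
qed simp

lemma ptrace_right_kron:
  assumes "is_mat m m A"
  shows "ptrace_right m s (kr m s A B) = (\<lambda>i j. tr s B * A i j)"
proof (rule is_mat_eqI[of m m])
  show "is_mat m m (\<lambda>i j. tr s B * A i j)" by (rule is_mat_scale[OF assms])
  fix i j assume "i < m" "j < m"
  then show "ptrace_right m s (kr m s A B) i j = tr s B * A i j"
    by (simp add: ptrace_right_def mk_def kron_at tr_def sum_distrib_left mult.commute)
qed simp

lemma lin_ptrace_right: "lin d (ptrace_right m s)"
  by (auto simp: lin_def ptrace_right_def mk_def fun_eq_iff sum.distrib sum_distrib_left)

lemma lin_tr: "lin d (\<lambda>X i j. tr n X)"
  by (auto simp: lin_def tr_def sum.distrib sum_distrib_left)

section \<open>Completely positive maps\<close>

definition kraus_term :: "nat \<Rightarrow> nat \<Rightarrow> cmat \<Rightarrow> cmat \<Rightarrow> cmat" where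
  "kraus_term m n K X = mk n n (\<lambda>i j. \<Sum>k<m. \<Sum>l<m. K i k * X k l * cnj (K j l))"

lemma is_mat_kraus_term [simp]: "is_mat n n (kraus_term m n K X)"
  by (simp add: kraus_term_def)

lemma sum_sum_list: "(\<Sum>i\<in>A. \<Sum>x\<leftarrow>xs. f i x) = (\<Sum>x\<leftarrow>xs. \<Sum>i\<in>A. f i x)"
  by (induction xs) (simp_all add: sum.distrib)

lemma sum_list_concat_map: "sum_list (concat (map f xs)) = (\<Sum>x\<leftarrow>xs. sum_list (f x) :: 'a :: comm_monoid_add)"
  by (induction xs) simp_all

lemma sum_delta2:
  fixes m :: nat
  assumes "a < m" "b < m"
  shows "(\<Sum>k<m. \<Sum>l<m. if k = a then if l = b then g k l else 0 else 0) = (g a b :: complex)"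
proof -
  have "(\<Sum>k<m. \<Sum>l<m. if k = a then if l = b then g k l else 0 else 0)
      = (\<Sum>k<m. if k = a then g a b else 0)"
    using assms(2) by (intro sum.cong refl) auto
  then show ?thesis using assms(1) by simp
qed

lemma kraus_map_kraus_term: "kraus_map m n Ks X = (\<lambda>i j. \<Sum>K\<leftarrow>Ks. kraus_term m n K X i j)"
  by (auto simp: kraus_map_def kraus_term_def mk_def fun_eq_iff intro!: arg_cong[of _ _ sum_list])

lemma kraus_term_sum_list: "kraus_term m n K (\<lambda>i j. \<Sum>x\<leftarrow>xs. Y x i j) = (\<lambda>i j. \<Sum>x\<leftarrow>xs. kraus_term m n K (Y x) i j)"
proof (induction xs)
  case Nil
  show ?case by (auto simp: kraus_term_def mk_def fun_eq_iff)
next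
  case (Cons x xs)
  have "kraus_term m n K (\<lambda>i j. \<Sum>x\<leftarrow>x # xs. Y x i j) = (\<lambda>i j. kraus_term m n K (Y x) i j + kraus_term m n K (\<lambda>i j. \<Sum>x\<leftarrow>xs. Y x i j) i j)"
    by (auto simp: kraus_term_def mk_def fun_eq_iff algebra_simps sum.distrib)
  then show ?case unfolding Cons.IH by simp
qed

lemma lin_kraus_term: "lin d (kraus_term m n K)"
  by (auto simp: lin_def kraus_term_def mk_def fun_eq_iff algebra_simps sum.distrib sum_distrib_left)

lemma lin_kraus_map: "lin d (kraus_map m n Ks)"
  using lin_kraus_term unfolding lin_def kraus_map_kraus_term by (simp add: sum_list_addf sum_list_const_mult)

lemma sum_swap22:
  "(\<Sum>a\<in>A. \<Sum>b\<in>B. \<Sum>c\<in>C. \<Sum>e\<in>E. f a b c e) = (\<Sum>c\<in>C. \<Sum>e\<in>E. \<Sum>a\<in>A. \<Sum>b\<in>B. f a b c e)"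
  by (subst sum_rotate) (intro sum.cong refl sum_rotate)

lemma kraus_term_comp: "kraus_term n p L (kraus_term m n K X) = kraus_term m p (mmul p n m L K) X"
proof (rule is_mat_eqI[of p p])
  fix i j assume ij: "i < p" "j < p"
  have "kraus_term n p L (kraus_term m n K X) i j
      = (\<Sum>a<n. \<Sum>b<n. \<Sum>k<m. \<Sum>l<m. (L i a * K a k) * X k l * (cnj (L j b * K b l)))"
    using ij by (simp add: kraus_term_def mk_def sum_distrib_left sum_distrib_right mult_ac)
  also have "\<dots> = (\<Sum>k<m. \<Sum>l<m. \<Sum>a<n. \<Sum>b<n. (L i a * K a k) * X k l * (cnj (L j b * K b l)))"
    by (rule sum_swap22)
  also have "\<dots> = (\<Sum>k<m. \<Sum>l<m. (\<Sum>a<n. L i a * K a k) * X k l * cnj (\<Sum>b<n. L j b * K b l))"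
    by (simp only: cnj_sum sum_distrib_right) (simp only: sum_distrib_left)
  also have "\<dots> = kraus_term m p (mmul p n m L K) X i j"
    using ij by (simp add: kraus_term_def mk_def mmul_def)
  finally show "kraus_term n p L (kraus_term m n K X) i j = kraus_term m p (mmul p n m L K) X i j" .
qed simp_all

lemma kraus_term_kron:
  "kraus_term (r * m) (s * n) (kron s r n m M K) (kr r m A B) = kr s n (kraus_term r s M A) (kraus_term m n K B)"
proof (rule is_mat_eqI[of "s * n" "s * n"])
  fix x y assume "x < s * n" "y < s * n"
  then obtain i k j l where x: "x = i * n + k" "i < s" "k < n" and y: "y = j * n + l" "j < s" "l < n"
    by (elim idx_cases)
  have "kraus_term (r * m) (s * n) (kron s r n m M K) (kr r m A B) x y
      = (\<Sum>a<r. \<Sum>c<m. \<Sum>b<r. \<Sum>e<m. (M i a * A a b * cnj (M j b)) * (K k c * B c e * cnj (K l e)))"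
    unfolding x(1) y(1) using x(2-) y(2-)
    by (simp add: kraus_term_def mk_def idx_less sum_idx kron_at) (simp add: mult_ac)
  also have "\<dots> = (\<Sum>a<r. \<Sum>b<r. \<Sum>c<m. \<Sum>e<m. (M i a * A a b * cnj (M j b)) * (K k c * B c e * cnj (K l e)))"
    by (intro sum.cong refl sum.swap)
  also have "\<dots> = (\<Sum>a<r. \<Sum>b<r. M i a * A a b * cnj (M j b)) * (\<Sum>c<m. \<Sum>e<m. K k c * B c e * cnj (K l e))"
    by (simp only: sum_distrib_right) (simp only: sum_distrib_left)
  also have "\<dots> = kr s n (kraus_term r s M A) (kraus_term m n K B) x y"
    unfolding x(1) y(1) using x(2-) y(2-) by (simp add: kron_at) (simp add: kraus_term_def mk_def)
  finally show "kraus_term (r * m) (s * n) (kron s r n m M K) (kr r m A B) x y = kr s n (kraus_term r s M A) (kraus_term m n K B) x y" .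
qed simp_all

lemma kraus_term_idm:
  assumes "is_mat m m X"
  shows "kraus_term m m (idm m) X = X"
proof (rule is_mat_eqI[of m m])
  fix i j assume ij: "i < m" "j < m"
  then have "kraus_term m m (idm m) X i j = (\<Sum>k<m. \<Sum>l<m. (if k = i then if l = j then X k l else 0 else 0))"
    unfolding kraus_term_def mk_def idm_def by (simp add: eq_commute) (intro sum.cong refl, auto)
  also have "\<dots> = X i j" using ij by (rule sum_delta2)
  finally show "kraus_term m m (idm m) X i j = X i j" .
qed (use assms in simp_all)

text \<open>Reindexing rows and columns is conjugation by a 0-1 matrix, so a rearrangement of
  systems has a single Kraus operator.\<close>

lemma kraus_term_perm:
  assumes "is_mat m m X" and s: "\<And>i. i < n \<Longrightarrow> s i < m"
  shows "kraus_term m n (\<lambda>i k. if i < n \<and> k = s i then 1 else 0) X = mk n n (\<lambda>i j. X (s i) (s j))"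
proof (rule is_mat_eqI[of n n])
  fix i j assume ij: "i < n" "j < n"
  then have "kraus_term m n (\<lambda>i k. if i < n \<and> k = s i then 1 else 0) X i j
      = (\<Sum>k<m. \<Sum>l<m. (if k = s i then if l = s j then X k l else 0 else 0))"
    unfolding kraus_term_def mk_def by (simp) (intro sum.cong refl, auto)
  also have "\<dots> = X (s i) (s j)" using ij s by (intro sum_delta2) auto
  finally show "kraus_term m n (\<lambda>i k. if i < n \<and> k = s i then 1 else 0) X i j = mk n n (\<lambda>i j. X (s i) (s j)) i j"
    using ij by (simp add: mk_def)
qed simp_all

lemma cpm_kraus_map: "(\<And>K. K \<in> set Ks \<Longrightarrow> is_mat n m K) \<Longrightarrow> cpm m n (kraus_map m n Ks)"
  by (auto simp: cpm_def)

lemma cpm_cong: "cpm m n g \<Longrightarrow> (\<And>X. is_mat m m X \<Longrightarrow> f X = g X) \<Longrightarrow> cpm m n f"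
  unfolding cpm_def by metis

lemma cpm_lin: "cpm m n f \<Longrightarrow> lin m f"
  unfolding cpm_def using linI_cong[OF lin_kraus_map] by metis

lemma cpm_is_mat: "cpm m n f \<Longrightarrow> is_mat m m X \<Longrightarrow> is_mat n n (f X)"
  unfolding cpm_def by auto

lemma cpm_id: "cpm m m (\<lambda>X. X)"
  unfolding cpm_def
  by (rule exI[of _ "[idm m]"]) (simp add: kraus_map_kraus_term kraus_term_idm)

lemma cpm_comp:
  assumes "cpm m n f" "cpm n p g"
  shows "cpm m p (\<lambda>X. g (f X))"
proof -
  from assms(1) obtain Ks where K: "\<And>X. is_mat m m X \<Longrightarrow> f X = kraus_map m n Ks X"
    by (auto simp: cpm_def)
  from assms(2) obtain Ls where L: "\<And>X. is_mat n n X \<Longrightarrow> g X = kraus_map n p Ls X"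
    by (auto simp: cpm_def)
  have "g (f X) = kraus_map m p (concat (map (\<lambda>L. map (mmul p n m L) Ks) Ls)) X" if "is_mat m m X" for X
  proof -
    have "g (f X) = kraus_map n p Ls (kraus_map m n Ks X)" using that by (simp add: K L)
    also have "\<dots> = (\<lambda>i j. \<Sum>L\<leftarrow>Ls. \<Sum>K\<leftarrow>Ks. kraus_term m p (mmul p n m L K) X i j)"
      by (simp only: kraus_map_kraus_term[of m n] kraus_map_kraus_term[of n p] kraus_term_sum_list kraus_term_comp)
    also have "\<dots> = kraus_map m p (concat (map (\<lambda>L. map (mmul p n m L) Ks) Ls)) X"
      by (simp add: kraus_map_kraus_term map_concat sum_list_concat_map o_def)
    finally show ?thesis .
  qed
  moreover have "\<forall>K\<in>set (concat (map (\<lambda>L. map (mmul p n m L) Ks) Ls)). is_mat p m K"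
    by (auto simp: is_mat_mmul)
  ultimately show ?thesis unfolding cpm_def by blast
qed

lemma cpm_zero: "cpm m n (\<lambda>X i j. 0)"
  unfolding cpm_def by (rule exI[of _ "[]"]) (simp add: kraus_map_kraus_term)

lemma cpm_add:
  assumes "cpm m n f" "cpm m n g"
  shows "cpm m n (\<lambda>X i j. f X i j + g X i j)"
proof -
  from assms obtain Ks Ls where
    "\<And>X. is_mat m m X \<Longrightarrow> f X = kraus_map m n Ks X" "\<forall>K\<in>set Ks. is_mat n m K"
    "\<And>X. is_mat m m X \<Longrightarrow> g X = kraus_map m n Ls X" "\<forall>K\<in>set Ls. is_mat n m K"
    unfolding cpm_def by blast
  then show ?thesis unfolding cpm_def
    by (intro exI[of _ "Ks @ Ls"]) (auto simp: kraus_map_kraus_term)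
qed

lemma cpm_sum:
  assumes "\<And>j. j < k \<Longrightarrow> cpm m n (f j)"
  shows "cpm m n (\<lambda>X p q. \<Sum>j<(k::nat). f j X p q)"
  using assms by (induction k) (simp_all add: cpm_zero cpm_add)

lemma cpm_id_tensor:
  assumes "cpm m n f"
  shows "cpm (r * m) (r * n) (id_tensor r m n f)"
proof -
  from assms obtain Ks where K: "\<And>X. is_mat m m X \<Longrightarrow> f X = kraus_map m n Ks X"
    by (auto simp: cpm_def)
  let ?Ls = "map (kron r r n m (idm r)) Ks"
  have "id_tensor r m n f X = kraus_map (r * m) (r * n) ?Ls X" if "is_mat (r * m) (r * m) X" for X
  proof (rule lin_ext_kron[OF lin_id_tensor[OF cpm_lin[OF assms]] lin_kraus_map _ that])
    fix A B assume A: "is_mat r r A" and B: "is_mat m m B"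
    have "kr r n A (\<lambda>i j. \<Sum>K\<leftarrow>Ks. kraus_term m n K B i j) = (\<lambda>i j. \<Sum>K\<leftarrow>Ks. kr r n A (kraus_term m n K B) i j)"
      by (auto simp: kron_def mk_def fun_eq_iff sum_list_const_mult)
    then show "id_tensor r m n f (kr r m A B) = kraus_map (r * m) (r * n) ?Ls (kr r m A B)"
      using A B by (simp add: id_tensor_kron[OF cpm_lin[OF assms]] K kraus_map_kraus_term kraus_term_kron kraus_term_idm o_def)
  qed
  moreover have "\<forall>L\<in>set ?Ls. is_mat (r * n) (r * m) L" by simp
  ultimately show ?thesis unfolding cpm_def by blast
qed

lemma cpm_tensor_id:
  assumes "cpm m n f"
  shows "cpm (m * s) (n * s) (tensor_id m n s f)"
proof -
  from assms obtain Ks where K: "\<And>X. is_mat m m X \<Longrightarrow> f X = kraus_map m n Ks X"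
    by (auto simp: cpm_def)
  let ?Ls = "map (\<lambda>K. kron n m s s K (idm s)) Ks"
  have "tensor_id m n s f X = kraus_map (m * s) (n * s) ?Ls X" if "is_mat (m * s) (m * s) X" for X
  proof (rule lin_ext_kron[OF lin_tensor_id[OF cpm_lin[OF assms]] lin_kraus_map _ that])
    fix A B assume A: "is_mat m m A" and B: "is_mat s s B"
    have "kr n s (\<lambda>i j. \<Sum>K\<leftarrow>Ks. kraus_term m n K A i j) B = (\<lambda>i j. \<Sum>K\<leftarrow>Ks. kr n s (kraus_term m n K A) B i j)"
      by (auto simp: kron_def mk_def fun_eq_iff sum_list_mult_const)
    then show "tensor_id m n s f (kr m s A B) = kraus_map (m * s) (n * s) ?Ls (kr m s A B)"
      using A B by (simp add: tensor_id_kron[OF cpm_lin[OF assms]] K kraus_map_kraus_term kraus_term_kron kraus_term_idm o_def)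
  qed
  moreover have "\<forall>L\<in>set ?Ls. is_mat (n * s) (m * s) L" by simp
  ultimately show ?thesis unfolding cpm_def by blast
qed

lemma cpm_swap_mid:
  assumes "m = d1 * d2 * d3 * d4"
  shows "cpm m m (swap_mid d1 d2 d3 d4)"
  unfolding cpm_def
  by (rule exI[of _ "[\<lambda>i k. if i < m \<and> k = sm_idx d1 d2 d3 d4 i then 1 else 0]"])
    (auto simp: kraus_map_kraus_term kraus_term_perm sm_idx_less assms swap_mid_def, auto simp: is_mat_def sm_idx_less)

text \<open>With \<open>\<sigma>\<close> a sum of rank-one terms in the vectors \<open>w a\<close>,
  the Kraus operators are the identity tensored with the columns \<open>w a\<close>.\<close>

lemma cpm_kron_right:
  assumes "psd c \<sigma>"
  shows "cpm d (d * c) (\<lambda>X. kr d c X \<sigma>)"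
proof -
  from psd_sum_rank_one[OF assms] obtain w where w: "\<sigma> = mk c c (\<lambda>i j. \<Sum>a<c. w a i * cnj (w a j))" .
  define W where "W a = (\<lambda>i k. if i < d * c \<and> k = i div c then w a (i mod c) else 0)" for a
  have "kr d c X \<sigma> = kraus_map d (d * c) (map W [0..<c]) X" if "is_mat d d X" for X
  proof (rule is_mat_eqI[of "d * c" "d * c"])
    fix i j assume ij: "i < d * c" "j < d * c"
    have c: "kraus_term d (d * c) (W a) X i j = X (i div c) (j div c) * (w a (i mod c) * cnj (w a (j mod c)))" for a
    proof -
      have "kraus_term d (d * c) (W a) X i j = (\<Sum>k<d. \<Sum>l<d. (if k = i div c then if l = j div c then X k l * (w a (i mod c) * cnj (w a (j mod c))) else 0 else 0))"
        unfolding kraus_term_def mk_def using ij by (simp add: W_def) (intro sum.cong refl, auto)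
      also have "\<dots> = X (i div c) (j div c) * (w a (i mod c) * cnj (w a (j mod c)))"
        using ij by (intro sum_delta2) (auto simp: div_less_of)
      finally show ?thesis .
    qed
    have "kr d c X \<sigma> i j = X (i div c) (j div c) * (\<Sum>a<c. w a (i mod c) * cnj (w a (j mod c)))"
      using ij by (simp add: kron_def mk_def w mod_less_of)
    also have "\<dots> = (\<Sum>a\<leftarrow>[0..<c]. kraus_term d (d * c) (W a) X i j)"
      by (simp add: c sum_distrib_left interv_sum_list_conv_sum_set_nat atLeast0LessThan)
    finally show "kr d c X \<sigma> i j = kraus_map d (d * c) (map W [0..<c]) X i j"
      by (simp add: kraus_map_kraus_term o_def)
  qed simp_all
  moreover have "\<forall>K\<in>set (map W [0..<c]). is_mat (d * c) d K"
    by (auto simp: W_def is_mat_def div_less_of)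
  ultimately show ?thesis unfolding cpm_def by blast
qed

text \<open>The trace regarded as a map into a one-dimensional system, with the dual basis vectors
  as Kraus operators. It makes the partial trace an instance of \<open>id_tensor\<close>.\<close>

lemma cpm_trace: "cpm s 1 (\<lambda>X i j. tr s X * idm 1 i j)"
proof -
  define W :: "nat \<Rightarrow> cmat" where "W a = (\<lambda>i k. if i = 0 \<and> k = a then 1 else 0)" for a
  have "(\<lambda>i j. tr s X * idm 1 i j) = kraus_map s 1 (map W [0..<s]) X" for X
  proof (rule is_mat_eqI[of 1 1])
    show "is_mat 1 1 (\<lambda>i j. tr s X * idm 1 i j)" by (intro is_mat_scale) simp
    fix i j :: nat assume "i < 1" "j < 1"
    then have ij: "i = 0" "j = 0" by simp_all
    have c: "kraus_term s 1 (W a) X 0 0 = X a a" if "a < s" for a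
    proof -
      have "kraus_term s 1 (W a) X 0 0 = (\<Sum>k<s. \<Sum>l<s. (if k = a then if l = a then X k l else 0 else 0))"
        unfolding kraus_term_def mk_def by (simp add: W_def) (intro sum.cong refl, auto)
      also have "\<dots> = X a a" using that that by (rule sum_delta2)
      finally show ?thesis .
    qed
    have "(\<Sum>a\<leftarrow>[0..<s]. kraus_term s 1 (W a) X 0 0) = tr s X"
      unfolding tr_def interv_sum_list_conv_sum_set_nat by (intro sum.cong) (auto simp: c[simplified])
    then show "tr s X * idm 1 i j = kraus_map s 1 (map W [0..<s]) X i j"
      by (simp add: ij kraus_map_kraus_term o_def) (simp add: idm_def mk_def)
  qed simp
  moreover have "\<forall>K\<in>set (map W [0..<s]). is_mat 1 s K" by (auto simp: W_def is_mat_def)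
  ultimately show ?thesis unfolding cpm_def by blast
qed

lemma ptrace_right_eq:
  assumes "is_mat (m * s) (m * s) X"
  shows "ptrace_right m s X = id_tensor m s 1 (\<lambda>X i j. tr s X * idm 1 i j) X"
proof (rule lin_ext_kron[OF lin_ptrace_right lin_id_tensor[OF cpm_lin[OF cpm_trace]] _ assms])
  fix A B assume A: "is_mat m m A" and B: "is_mat s s B"
  show "ptrace_right m s (kr m s A B) = id_tensor m s 1 (\<lambda>X i j. tr s X * idm 1 i j) (kr m s A B)"
    unfolding id_tensor_kron[OF cpm_lin[OF cpm_trace] B] ptrace_right_kron[OF A] kron_scale_right
    by (simp only: kron_one_right[OF A])
qed

lemma cpm_ptrace_right: "cpm (m * s) m (ptrace_right m s)"
  using cpm_cong[OF cpm_id_tensor[OF cpm_trace] ptrace_right_eq, of m s] by simp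

lemma psd_kraus_term:
  assumes "psd m X"
  shows "psd n (kraus_term m n K X)"
proof -
  from psd_sum_rank_one[OF assms] obtain w where w: "X = mk m m (\<lambda>i j. \<Sum>a<m. w a i * cnj (w a j))" .
  have "kraus_term m n K X = mk n n (\<lambda>i j. \<Sum>a<m. app m K (w a) i * cnj (app m K (w a) j))"
  proof (rule is_mat_eqI[of n n])
    fix i j assume ij: "i < n" "j < n"
    have "kraus_term m n K X i j = (\<Sum>k<m. \<Sum>l<m. \<Sum>a<m. (K i k * w a k) * cnj (K j l * w a l))"
      using ij by (simp add: kraus_term_def mk_def w sum_distrib_left sum_distrib_right mult_ac)
    also have "\<dots> = (\<Sum>a<m. \<Sum>k<m. \<Sum>l<m. (K i k * w a k) * cnj (K j l * w a l))"
      by (rule sum_rotate)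
    also have "\<dots> = (\<Sum>a<m. app m K (w a) i * cnj (app m K (w a) j))"
      by (simp only: app_def cnj_sum sum_product)
    finally show "kraus_term m n K X i j = mk n n (\<lambda>i j. \<Sum>a<m. app m K (w a) i * cnj (app m K (w a) j)) i j"
      using ij by (simp add: mk_def)
  qed simp_all
  then show ?thesis using psd_sum_rank_oneI by simp
qed

lemma psd_add:
  assumes "psd d X" "psd d Y"
  shows "psd d (\<lambda>i j. X i j + Y i j)"
  using assms unfolding psd_ip
  by (auto simp: is_mat_add adj_def fun_eq_iff ip_app algebra_simps sum.distrib)

lemma psd_zero: "psd d (\<lambda>i j. 0)"
  by (simp add: psd_ip is_mat_def adj_def ip_app)

lemma psd_cpm:
  assumes "cpm m n f" "psd m X"
  shows "psd n (f X)"
proof -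
  from assms obtain Ks where "f X = kraus_map m n Ks X"
    by (auto simp: cpm_def psd_def)
  moreover have "psd n (\<lambda>i j. \<Sum>K\<leftarrow>Ks. kraus_term m n K X i j)"
    by (induction Ks) (simp_all add: psd_zero psd_add psd_kraus_term[OF assms(2)])
  ultimately show ?thesis by (simp add: kraus_map_kraus_term)
qed

section \<open>Channels and instruments\<close>

lemma tr_kraus_map:
  "tr n (kraus_map m n Ks X) = (\<Sum>k<m. \<Sum>l<m. X k l * (\<Sum>K\<leftarrow>Ks. \<Sum>t<n. cnj (K t l) * K t k))"
proof -
  have "tr n (kraus_map m n Ks X) = (\<Sum>K\<leftarrow>Ks. \<Sum>t<n. \<Sum>k<m. \<Sum>l<m. X k l * (cnj (K t l) * K t k))"
    by (simp add: tr_def kraus_map_def mk_def sum_sum_list mult_ac)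
  also have "\<dots> = (\<Sum>K\<leftarrow>Ks. \<Sum>k<m. \<Sum>l<m. \<Sum>t<n. X k l * (cnj (K t l) * K t k))"
    by (subst sum_rotate[symmetric]) (rule refl)
  also have "\<dots> = (\<Sum>k<m. \<Sum>l<m. X k l * (\<Sum>K\<leftarrow>Ks. \<Sum>t<n. cnj (K t l) * K t k))"
    by (simp only: sum_list_const_mult[symmetric] sum_sum_list sum_distrib_left)
  finally show ?thesis .
qed

text \<open>Testing on matrix units recovers every entry of \<open>G\<close>. With \<open>G\<close>
  the sum of the products of Kraus operators with their adjoints, the completeness relation becomes
  preservation of the trace.\<close>

lemma trace_functional_iff:
  "(\<forall>X. is_mat m m X \<longrightarrow> (\<Sum>k<m. \<Sum>l<m. X k l * G l k) = tr m X) \<longleftrightarrow> mk m m G = idm m"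
proof
  assume *: "\<forall>X. is_mat m m X \<longrightarrow> (\<Sum>k<m. \<Sum>l<m. X k l * G l k) = tr m X"
  show "mk m m G = idm m"
  proof (rule is_mat_eqI[of m m])
    fix i j assume ij: "i < m" "j < m"
    have "(\<Sum>k<m. \<Sum>l<m. matrix_unit j i k l * G l k) = (\<Sum>k<m. \<Sum>l<m. if k = j then if l = i then G i j else 0 else 0)"
      by (intro sum.cong refl) (auto simp: matrix_unit_def)
    then have "(\<Sum>k<m. \<Sum>l<m. matrix_unit j i k l * G l k) = G i j" using ij by (simp add: sum_delta2)
    moreover have "tr m (matrix_unit j i) = (if i = j then 1 else 0)"
      using ij by (auto simp: tr_def matrix_unit_def intro!: sum.neutral)
    ultimately show "mk m m G i j = idm m i j"
      using * is_mat_matrix_unit[OF ij(2,1)] ij by (simp add: mk_def idm_def)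
  qed simp_all
next
  assume *: "mk m m G = idm m"
  have G: "G l k = (if l = k then 1 else 0)" if "k < m" "l < m" for k l
    using fun_cong[OF fun_cong[OF *, of l], of k] that by (simp add: mk_def idm_def)
  show "\<forall>X. is_mat m m X \<longrightarrow> (\<Sum>k<m. \<Sum>l<m. X k l * G l k) = tr m X"
  proof (intro allI impI)
    fix X :: cmat
    have "(\<Sum>k<m. \<Sum>l<m. X k l * G l k) = (\<Sum>k<m. \<Sum>l<m. if l = k then X k l else 0)"
      by (intro sum.cong refl) (auto simp: G)
    then show "(\<Sum>k<m. \<Sum>l<m. X k l * G l k) = tr m X" by (simp add: tr_def)
  qed
qed

text \<open>Any Kraus list that represents a trace-preserving map is complete, so positivity and
  trace can be treated separately and Kraus lists disappear from the later arguments.\<close>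

lemma is_channel_iff: "is_channel m n f \<longleftrightarrow> cpm m n f \<and> tp m n f"
proof -
  have *: "tp m n f \<longleftrightarrow> mk m m (\<lambda>i j. \<Sum>K\<leftarrow>Ks. \<Sum>t<n. cnj (K t i) * K t j) = idm m"
    if "\<forall>X. is_mat m m X \<longrightarrow> f X = kraus_map m n Ks X" for Ks
    unfolding tp_def trace_functional_iff[symmetric] using that by (simp add: tr_kraus_map)
  show ?thesis unfolding is_channel_def cpm_def using * by blast
qed

lemma instrument_iff:
  "instrument m n k Ks \<longleftrightarrow> (\<forall>j<k. \<forall>K\<in>set (Ks j). is_mat n m K) \<and>
     (\<forall>X. is_mat m m X \<longrightarrow> (\<Sum>j<k. tr n (kraus_map m n (Ks j) X)) = tr m X)"
proof -
  have "(\<Sum>j<k. tr n (kraus_map m n (Ks j) X))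
     = (\<Sum>i<m. \<Sum>l<m. X i l * (\<Sum>j<k. \<Sum>K\<leftarrow>Ks j. \<Sum>t<n. cnj (K t l) * K t i))" for X
    unfolding tr_kraus_map sum_distrib_left by (rule sum_rotate[symmetric])
  then show ?thesis
    unfolding instrument_def trace_functional_iff[symmetric] by simp
qed

lemma is_channel_cpm: "is_channel m n f \<Longrightarrow> cpm m n f"
  by (simp add: is_channel_iff)

lemma is_channel_lin: "is_channel m n f \<Longrightarrow> lin m f"
  using cpm_lin is_channel_cpm by blast

text \<open>The scalar trace is packed into a constant matrix, which turns the functional into a
  linear map to which \<open>lin_ext_kron\<close> applies.\<close>

lemma tr_ext_kron:
  assumes "lin (m * p) f"
    and "\<And>A B. is_mat m m A \<Longrightarrow> is_mat p p B \<Longrightarrow> tr n (f (kr m p A B)) = tr (m * p) (kr m p A B)"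
    and "is_mat (m * p) (m * p) X"
  shows "tr n (f X) = tr (m * p) X"
proof -
  have l: "lin (m * p) (\<lambda>X (i::nat) (j::nat). tr n (f X))"
    using assms(1) by (auto simp: lin_def tr_def sum.distrib sum_distrib_left)
  have "(\<lambda>(i::nat) (j::nat). tr n (f X)) = (\<lambda>i j. tr (m * p) X)"
    by (rule lin_ext_kron[OF l lin_tr _ assms(3)]) (simp add: assms(2))
  then show ?thesis by (simp add: fun_eq_iff)
qed

lemma is_channel_is_mat: "is_channel m n f \<Longrightarrow> is_mat m m X \<Longrightarrow> is_mat n n (f X)"
  using cpm_is_mat is_channel_cpm by blast

lemma is_channel_comp: "is_channel m n f \<Longrightarrow> is_channel n p g \<Longrightarrow> is_channel m p (\<lambda>X. g (f X))"
  unfolding is_channel_iff tp_def by (auto intro: cpm_comp simp: cpm_is_mat)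

lemma is_channel_id_tensor:
  assumes "is_channel m n f"
  shows "is_channel (r * m) (r * n) (id_tensor r m n f)"
proof -
  have f: "cpm m n f" "tp m n f" using assms by (auto simp: is_channel_iff)
  have "tr (r * n) (id_tensor r m n f X) = tr (r * m) X" if "is_mat (r * m) (r * m) X" for X
    by (rule tr_ext_kron[OF lin_id_tensor[OF cpm_lin[OF f(1)]] _ that])
      (use f(2) in \<open>simp add: id_tensor_kron[OF cpm_lin[OF f(1)]] tr_kron tp_def\<close>)
  then show ?thesis
    unfolding is_channel_iff tp_def using cpm_id_tensor[OF f(1)] by auto
qed

lemma is_channel_tensor_id:
  assumes "is_channel m n f"
  shows "is_channel (m * s) (n * s) (tensor_id m n s f)"
proof -
  have f: "cpm m n f" "tp m n f" using assms by (auto simp: is_channel_iff)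
  have "tr (n * s) (tensor_id m n s f X) = tr (m * s) X" if "is_mat (m * s) (m * s) X" for X
    by (rule tr_ext_kron[OF lin_tensor_id[OF cpm_lin[OF f(1)]] _ that])
      (use f(2) in \<open>simp add: tensor_id_kron[OF cpm_lin[OF f(1)]] tr_kron tp_def\<close>)
  then show ?thesis
    unfolding is_channel_iff tp_def using cpm_tensor_id[OF f(1)] by auto
qed

lemma is_channel_swap_mid:
  assumes m: "m = d1 * d2 * d3 * d4"
  shows "is_channel m m (swap_mid d1 d2 d3 d4)"
proof -
  have m': "d1 * d2 * (d3 * d4) = m" "d1 * d3 * (d2 * d4) = m" by (simp_all add: m mult_ac)
  have l: "lin m (\<lambda>X (i::nat) (j::nat). tr m (swap_mid d1 d2 d3 d4 X))"
    using lin_swap_mid[of m d1 d2 d3 d4] by (auto simp: lin_def tr_def sum.distrib sum_distrib_left)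
  have "tr m (swap_mid d1 d2 d3 d4 X) = tr m X" if X: "is_mat m m X" for X
  proof -
    have "(\<lambda>(i::nat) (j::nat). tr m (swap_mid d1 d2 d3 d4 X)) = (\<lambda>i j. tr m X)"
    proof (rule lin_ext_kron4[of d1 d2 d3 d4, unfolded m', OF l lin_tr _ X])
      fix A B C D
      have "tr m (kr (d1 * d3) (d2 * d4) (kr d1 d3 A C) (kr d2 d4 B D)) = tr d1 A * tr d3 C * (tr d2 B * tr d4 D)"
        unfolding m'(2)[symmetric] by (simp only: tr_kron)
      moreover have "tr m (kr (d1 * d2) (d3 * d4) (kr d1 d2 A B) (kr d3 d4 C D)) = tr d1 A * tr d2 B * (tr d3 C * tr d4 D)"
        unfolding m'(1)[symmetric] by (simp only: tr_kron)
      ultimately show "(\<lambda>(i::nat) (j::nat). tr m (swap_mid d1 d2 d3 d4 (kr (d1 * d2) (d3 * d4) (kr d1 d2 A B) (kr d3 d4 C D))))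
          = (\<lambda>i j. tr m (kr (d1 * d2) (d3 * d4) (kr d1 d2 A B) (kr d3 d4 C D)))"
        by (simp add: swap_mid_kron mult_ac)
    qed
    then show ?thesis by (simp add: fun_eq_iff)
  qed
  then show ?thesis
    unfolding is_channel_iff tp_def using cpm_swap_mid[OF m] by auto
qed

lemma is_channel_kron_right:
  assumes "density c \<sigma>"
  shows "is_channel d (d * c) (\<lambda>X. kr d c X \<sigma>)"
  using assms cpm_kron_right unfolding is_channel_iff tp_def density_def by (auto simp: tr_kron)

lemma is_channel_ptrace_right: "is_channel (m * s) m (ptrace_right m s)"
proof -
  have "tr m (ptrace_right m s X) = tr (m * s) X" if "is_mat (m * s) (m * s) X" for X
  proof (rule tr_ext_kron[OF lin_ptrace_right _ that])
    fix A B assume A: "is_mat m m A"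
    show "tr m (ptrace_right m s (kr m s A B)) = tr (m * s) (kr m s A B)"
      unfolding ptrace_right_kron[OF A] tr_kron
      by (simp add: tr_def[of m] sum_distrib_left[symmetric])
  qed
  then show ?thesis
    unfolding is_channel_iff tp_def using cpm_ptrace_right by auto
qed

lemma density_channel:
  assumes "is_channel m n f" "density m X"
  shows "density n (f X)"
  using assms psd_cpm unfolding is_channel_iff density_def tp_def by (auto simp: psd_is_mat)

lemma density_kron:
  assumes "density m A" "density n B"
  shows "density (m * n) (kr m n A B)"
  using density_channel[OF is_channel_kron_right[OF assms(2)] assms(1)] .

lemma tn_bound_channel:
  assumes f: "is_channel m n f" and X: "tn_bound m X t"
  shows "tn_bound n (f X) t"
proof -
  from X obtain P Q where *: "psd m P" "psd m Q" "X = (\<lambda>i j. P i j - Q i j)" "Re (tr m P) + Re (tr m Q) \<le> t"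
    by (auto simp: tn_bound_def)
  have "f X = (\<lambda>i j. f P i j - f Q i j)"
    unfolding *(3) by (rule lin_diff[OF is_channel_lin[OF f] psd_is_mat[OF *(1)] psd_is_mat[OF *(2)]])
  then show ?thesis
    unfolding tn_bound_def
    using f * psd_cpm by (intro exI[of _ "f P"] exI[of _ "f Q"]) (auto simp: is_channel_iff tp_def psd_is_mat)
qed

lemma tn_bound_channel_diff:
  assumes f: "is_channel m n f" and "is_mat m m X" "is_mat m m Y" and X: "tn_bound m (\<lambda>i j. X i j - Y i j) t"
  shows "tn_bound n (\<lambda>i j. f X i j - f Y i j) t"
  using tn_bound_channel[OF f X] lin_diff[OF is_channel_lin[OF f] assms(2,3)] by simp

section \<open>Functoriality\<close>

lemma id_tensor_cong:
  assumes "\<And>X. is_mat m m X \<Longrightarrow> f X = g X"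
  shows "id_tensor r m n f X = id_tensor r m n g X"
  unfolding id_tensor_def by (simp add: assms)

lemma tensor_id_cong:
  assumes "\<And>X. is_mat m m X \<Longrightarrow> f X = g X"
  shows "tensor_id m n s f X = tensor_id m n s g X"
  unfolding tensor_id_def by (simp add: assms)

lemma id_tensor_comp:
  assumes f: "cpm m n f" and g: "cpm n p g" and X: "is_mat (r * m) (r * m) X"
  shows "id_tensor r n p g (id_tensor r m n f X) = id_tensor r m p (\<lambda>X. g (f X)) X"
proof (rule lin_ext_kron[OF _ _ _ X])
  show "lin (r * m) (\<lambda>X. id_tensor r n p g (id_tensor r m n f X))"
    by (rule cpm_lin[OF cpm_comp[OF cpm_id_tensor[OF f] cpm_id_tensor[OF g]]])
  show "lin (r * m) (id_tensor r m p (\<lambda>X. g (f X)))"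
    by (rule cpm_lin[OF cpm_id_tensor[OF cpm_comp[OF f g]]])
  fix A B assume "is_mat r r A" "is_mat m m B"
  then show "id_tensor r n p g (id_tensor r m n f (kr r m A B)) = id_tensor r m p (\<lambda>X. g (f X)) (kr r m A B)"
    by (simp add: id_tensor_kron cpm_lin[OF f] cpm_lin[OF g] cpm_lin[OF cpm_comp[OF f g]] cpm_is_mat[OF f])
qed

lemma tensor_id_comp:
  assumes f: "cpm m n f" and g: "cpm n p g" and X: "is_mat (m * s) (m * s) X"
  shows "tensor_id n p s g (tensor_id m n s f X) = tensor_id m p s (\<lambda>X. g (f X)) X"
proof (rule lin_ext_kron[OF _ _ _ X])
  show "lin (m * s) (\<lambda>X. tensor_id n p s g (tensor_id m n s f X))"
    by (rule cpm_lin[OF cpm_comp[OF cpm_tensor_id[OF f] cpm_tensor_id[OF g]]])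
  show "lin (m * s) (tensor_id m p s (\<lambda>X. g (f X)))"
    by (rule cpm_lin[OF cpm_tensor_id[OF cpm_comp[OF f g]]])
  fix A B assume "is_mat m m A" "is_mat s s B"
  then show "tensor_id n p s g (tensor_id m n s f (kr m s A B)) = tensor_id m p s (\<lambda>X. g (f X)) (kr m s A B)"
    by (simp add: tensor_id_kron cpm_lin[OF f] cpm_lin[OF g] cpm_lin[OF cpm_comp[OF f g]] cpm_is_mat[OF f])
qed

lemma id_tensor_tensor_id_commute:
  assumes f: "cpm m n f" and g: "cpm p q g" and X: "is_mat (m * p) (m * p) X"
  shows "id_tensor n p q g (tensor_id m n p f X) = tensor_id m n q f (id_tensor m p q g X)"
proof (rule lin_ext_kron[OF _ _ _ X])
  show "lin (m * p) (\<lambda>X. id_tensor n p q g (tensor_id m n p f X))"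
    by (rule cpm_lin[OF cpm_comp[OF cpm_tensor_id[OF f] cpm_id_tensor[OF g]]])
  show "lin (m * p) (\<lambda>X. tensor_id m n q f (id_tensor m p q g X))"
    by (rule cpm_lin[OF cpm_comp[OF cpm_id_tensor[OF g] cpm_tensor_id[OF f]]])
  fix A B assume "is_mat m m A" "is_mat p p B"
  then show "id_tensor n p q g (tensor_id m n p f (kr m p A B)) = tensor_id m n q f (id_tensor m p q g (kr m p A B))"
    by (simp add: id_tensor_kron tensor_id_kron cpm_lin[OF f] cpm_lin[OF g])
qed

lemma id_tensor_assoc:
  assumes f: "cpm m n f" and X: "is_mat (r * s * m) (r * s * m) X"
  shows "id_tensor (r * s) m n f X = id_tensor r (s * m) (s * n) (id_tensor s m n f) X"
proof (rule lin_ext_kron[OF _ _ _ X])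
  note l = cpm_lin[OF cpm_id_tensor[OF f]]
  show "lin (r * s * m) (id_tensor (r * s) m n f)" by (rule l)
  show l2: "lin (r * s * m) (id_tensor r (s * m) (s * n) (id_tensor s m n f))"
    using cpm_lin[OF cpm_id_tensor[OF cpm_id_tensor[OF f]]] by (simp only: mult.assoc)
  fix U B assume U: "is_mat (r * s) (r * s) U" and B: "is_mat m m B"
  show "id_tensor (r * s) m n f (kr (r * s) m U B) = id_tensor r (s * m) (s * n) (id_tensor s m n f) (kr (r * s) m U B)"
  proof (rule lin_ext_kron[OF _ _ _ U])
    show "lin (r * s) (\<lambda>U. id_tensor (r * s) m n f (kr (r * s) m U B))"
      by (rule lin_comp[OF lin_kron_left l]) simp
    show "lin (r * s) (\<lambda>U. id_tensor r (s * m) (s * n) (id_tensor s m n f) (kr (r * s) m U B))"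
      by (rule lin_comp[OF lin_kron_left l2]) simp
    fix A C assume "is_mat r r A" "is_mat s s C"
    have "id_tensor (r * s) m n f (kr (r * s) m (kr r s A C) B) = kr (r * s) n (kr r s A C) (f B)"
      by (rule id_tensor_kron[OF cpm_lin[OF f] B])
    moreover have "id_tensor r (s * m) (s * n) (id_tensor s m n f) (kr r (s * m) A (kr s m C B)) = kr r (s * n) A (kr s n C (f B))"
      by (simp add: id_tensor_kron[OF l] id_tensor_kron[OF cpm_lin[OF f] B])
    ultimately show "id_tensor (r * s) m n f (kr (r * s) m (kr r s A C) B)
        = id_tensor r (s * m) (s * n) (id_tensor s m n f) (kr (r * s) m (kr r s A C) B)"
      by (simp only: kron_assoc)
  qed
qed

lemma swap_mid_inverse:
  assumes "is_mat m m X" "m = d1 * d2 * d3 * d4"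
  shows "swap_mid d1 d3 d2 d4 (swap_mid d1 d2 d3 d4 X) = X"
proof -
  have X: "is_mat (d1 * d2 * (d3 * d4)) (d1 * d2 * (d3 * d4)) X" using assms by (simp add: mult.assoc)
  have "lin (d1 * d2 * (d3 * d4)) (\<lambda>X. swap_mid d1 d3 d2 d4 (swap_mid d1 d2 d3 d4 X))"
    using lin_comp[OF lin_swap_mid lin_swap_mid is_mat_swap_mid] .
  moreover have "lin (d1 * d2 * (d3 * d4)) (\<lambda>X. X)" by (simp add: lin_def)
  ultimately show ?thesis
    by (rule lin_ext_kron4[OF _ _ _ X]) (simp add: swap_mid_kron)
qed

lemma is_mat_swap_mid' [simp]: "is_mat (d1 * d3 * (d2 * d4)) (d1 * d3 * (d2 * d4)) (swap_mid d1 d2 d3 d4 X)"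
  using is_mat_swap_mid[of d1 d2 d3 d4 X] by (simp add: mult_ac)

lemma is_channel_swap_mid': "is_channel (a * b * (c * e)) (a * c * (b * e)) (swap_mid a b c e)"
proof -
  have "a * b * (c * e) = a * b * c * e" "a * c * (b * e) = a * b * c * e" by (simp_all add: mult_ac)
  then show ?thesis using is_channel_swap_mid[OF refl, of a b c e] by metis
qed

lemma swap_mid_inverse': "is_mat (a * b * (c * e)) (a * b * (c * e)) X \<Longrightarrow> swap_mid a c b e (swap_mid a b c e X) = X"
  by (erule swap_mid_inverse) (simp add: mult.assoc)

text \<open>Both sides carry the factors \<open>a b c d e f\<close> into the order
  \<open>a c e b d f\<close>. One merges the last two bipartite systems first, the other the first
  two.\<close>

lemma swap_mid_assoc:
  assumes Z: "is_mat (a * b * (c * d) * (e * f)) (a * b * (c * d) * (e * f)) Z"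
  shows "swap_mid a b (c * e) (d * f) (id_tensor (a * b) (c * d * (e * f)) (c * e * (d * f)) (swap_mid c d e f) Z)
    = swap_mid (a * c) (b * d) e f (tensor_id (a * b * (c * d)) (a * c * (b * d)) (e * f) (swap_mid a b c d) Z)"
proof -
  let ?F = "\<lambda>Z. swap_mid a b (c * e) (d * f) (id_tensor (a * b) (c * d * (e * f)) (c * e * (d * f)) (swap_mid c d e f) Z)"
  let ?G = "\<lambda>Z. swap_mid (a * c) (b * d) e f (tensor_id (a * b * (c * d)) (a * c * (b * d)) (e * f) (swap_mid a b c d) Z)"
  let ?n = "a * b * (c * d) * (e * f)"
  have F: "lin ?n ?F"
    using lin_comp[OF lin_id_tensor[OF lin_swap_mid] lin_swap_mid is_mat_id_tensor, of "a * b" "c * d * (e * f)"]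
    by (simp only: mult.assoc)
  have G: "lin ?n ?G"
    by (rule lin_comp[OF lin_tensor_id[OF lin_swap_mid] lin_swap_mid is_mat_tensor_id])
  show ?thesis
  proof (rule lin_ext_kron[OF F G _ Z])
    fix S W assume S: "is_mat (a * b * (c * d)) (a * b * (c * d)) S" and W: "is_mat (e * f) (e * f) W"
    have lk: "lin (a * b * (c * d)) (\<lambda>S. H (kr (a * b * (c * d)) (e * f) S W'))" if "lin ?n H" for H W'
      by (rule lin_comp[OF lin_kron_left that]) simp
    have rk: "lin (e * f) (\<lambda>W. H (kr (a * b * (c * d)) (e * f) S' W))" if "lin ?n H" for H S'
      by (rule lin_comp[OF lin_kron_right that]) simp
    show "?F (kr (a * b * (c * d)) (e * f) S W) = ?G (kr (a * b * (c * d)) (e * f) S W)"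
    proof (rule lin_ext_kron4[OF lk[OF F] lk[OF G] _ S])
      fix A B C D assume A: "is_mat a a A" and B: "is_mat b b B" and C: "is_mat c c C" and D: "is_mat d d D"
      let ?S = "kr (a * b) (c * d) (kr a b A B) (kr c d C D)"
      show "?F (kr (a * b * (c * d)) (e * f) ?S W) = ?G (kr (a * b * (c * d)) (e * f) ?S W)"
      proof (rule lin_ext_kron[OF rk[OF F] rk[OF G] _ W])
        fix U V assume U: "is_mat e e U" and V: "is_mat f f V"
        have "?F (kr (a * b) (c * d * (e * f)) (kr a b A B) (kr (c * d) (e * f) (kr c d C D) (kr e f U V)))
            = kr (a * (c * e)) (b * (d * f)) (kr a (c * e) A (kr c e C U)) (kr b (d * f) B (kr d f D V))"
          by (simp add: id_tensor_kron lin_swap_mid swap_mid_kron)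
        moreover have "?G (kr (a * b * (c * d)) (e * f) ?S (kr e f U V))
            = kr (a * c * e) (b * d * f) (kr (a * c) e (kr a c A C) U) (kr (b * d) f (kr b d B D) V)"
          by (simp add: tensor_id_kron lin_swap_mid swap_mid_kron)
        ultimately show "?F (kr (a * b * (c * d)) (e * f) ?S (kr e f U V)) = ?G (kr (a * b * (c * d)) (e * f) ?S (kr e f U V))"
          by (simp only: kron_assoc mult.assoc)
      qed
    qed
  qed
qed

section \<open>LOCC maps\<close>

text \<open>Each rule refers to the map in its conclusion only through its values on matrices of the
  right size, so a case distinction on the last rule is enough.\<close>

lemma locc_cong:
  assumes "locc aI bI aO bO L" "\<And>X. is_mat (aI * bI) (aI * bI) X \<Longrightarrow> L' X = L X"
  shows "locc aI bI aO bO L'"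
  using assms(1)
proof cases
  case locc_id
  then show ?thesis using assms(2) by (auto intro: locc.locc_id)
next
  case (locc_alice a' k Ks Ls)
  then show ?thesis using assms(2) by (intro locc.locc_alice[of aI a' k Ks bI aO bO Ls]) auto
next
  case (locc_bob b' k Ks Ls)
  then show ?thesis using assms(2) by (intro locc.locc_bob[of bI b' k Ks aI aO bO Ls]) auto
qed

lemma instrument_cpm: "instrument m n k Ks \<Longrightarrow> j < k \<Longrightarrow> cpm m n (kraus_map m n (Ks j))"
  by (auto simp: instrument_iff intro: cpm_kraus_map)

lemma instrument_tr: "instrument m n k Ks \<Longrightarrow> is_mat m m X \<Longrightarrow> (\<Sum>j<k. tr n (kraus_map m n (Ks j) X)) = tr m X"
  by (auto simp: instrument_iff)

text \<open>Lets the rounds of a protocol be given by completely positive maps whose traces add up;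
  a Kraus list is then chosen for each outcome.\<close>

lemma instrumentI:
  assumes "\<And>j. j < k \<Longrightarrow> cpm m n (F j)" "\<And>X. is_mat m m X \<Longrightarrow> (\<Sum>j<k. tr n (F j X)) = tr m X"
  obtains Ks where "instrument m n k Ks" "\<And>j X. j < k \<Longrightarrow> is_mat m m X \<Longrightarrow> F j X = kraus_map m n (Ks j) X"
proof -
  have "\<forall>j. \<exists>Ks. j < k \<longrightarrow> (\<forall>K\<in>set Ks. is_mat n m K) \<and> (\<forall>X. is_mat m m X \<longrightarrow> F j X = kraus_map m n Ks X)"
    using assms(1) unfolding cpm_def by blast
  then obtain Ks where *: "\<And>j. j < k \<Longrightarrow> (\<forall>K\<in>set (Ks j). is_mat n m K) \<and> (\<forall>X. is_mat m m X \<longrightarrow> F j X = kraus_map m n (Ks j) X)"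
    by metis
  moreover have "instrument m n k Ks"
    unfolding instrument_iff
  proof (intro conjI allI impI)
    show "\<forall>K\<in>set (Ks j). is_mat n m K" if "j < k" for j using * that by blast
    fix X assume X: "is_mat m m X"
    have "(\<Sum>j<k. tr n (kraus_map m n (Ks j) X)) = (\<Sum>j<k. tr n (F j X))"
      by (intro sum.cong refl) (use * X in auto)
    then show "(\<Sum>j<k. tr n (kraus_map m n (Ks j) X)) = tr m X" using assms(2)[OF X] by simp
  qed
  ultimately show ?thesis using that by blast
qed

lemma locc_aliceI:
  fixes k :: nat
  assumes "\<And>j. j < k \<Longrightarrow> cpm aI a' (F j)" "\<And>X. is_mat aI aI X \<Longrightarrow> (\<Sum>j<k. tr a' (F j X)) = tr aI X"
    "\<And>j. j < k \<Longrightarrow> locc a' bI aO bO (Ls j)"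
    "\<And>X. is_mat (aI * bI) (aI * bI) X \<Longrightarrow> L X = (\<lambda>p q. \<Sum>j<k. Ls j (tensor_id aI a' bI (F j) X) p q)"
  shows "locc aI bI aO bO L"
proof -
  from instrumentI[of k aI a' F, OF assms(1,2)] obtain Ks where Ks: "instrument aI a' k Ks"
    "\<And>j X. j < k \<Longrightarrow> is_mat aI aI X \<Longrightarrow> F j X = kraus_map aI a' (Ks j) X" by metis
  have "tensor_id aI a' bI (F j) X = tensor_id aI a' bI (kraus_map aI a' (Ks j)) X" if "j < k" for j X
    by (rule tensor_id_cong) (rule Ks(2)[OF that])
  then show ?thesis using assms(3,4) by (intro locc_alice[OF Ks(1), of bI aO bO Ls]) simp_all
qed

lemma locc_bobI:
  fixes k :: nat
  assumes "\<And>j. j < k \<Longrightarrow> cpm bI b' (F j)" "\<And>X. is_mat bI bI X \<Longrightarrow> (\<Sum>j<k. tr b' (F j X)) = tr bI X"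
    "\<And>j. j < k \<Longrightarrow> locc aI b' aO bO (Ls j)"
    "\<And>X. is_mat (aI * bI) (aI * bI) X \<Longrightarrow> L X = (\<lambda>p q. \<Sum>j<k. Ls j (id_tensor aI bI b' (F j) X) p q)"
  shows "locc aI bI aO bO L"
proof -
  from instrumentI[of k bI b' F, OF assms(1,2)] obtain Ks where Ks: "instrument bI b' k Ks"
    "\<And>j X. j < k \<Longrightarrow> is_mat bI bI X \<Longrightarrow> F j X = kraus_map bI b' (Ks j) X" by metis
  have "id_tensor aI bI b' (F j) X = id_tensor aI bI b' (kraus_map bI b' (Ks j)) X" if "j < k" for j X
    by (rule id_tensor_cong) (rule Ks(2)[OF that])
  then show ?thesis using assms(3,4) by (intro locc_bob[OF Ks(1), of aI aO bO Ls]) simp_all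
qed

lemma tr_sum: "tr d (\<lambda>p q. \<Sum>j<(k::nat). Y j p q) = (\<Sum>j<k. tr d (Y j))"
  unfolding tr_def by (rule sum.swap)

text \<open>A single outcome need not preserve the trace, only the sum over all outcomes does; the
  whole sum is therefore extended from product matrices at once.\<close>

lemma tr_sum_tensor_id:
  assumes F: "\<And>j. j < k \<Longrightarrow> cpm m n (F j)" "\<And>X. is_mat m m X \<Longrightarrow> (\<Sum>j<(k::nat). tr n (F j X)) = tr m X"
    and X: "is_mat (m * s) (m * s) X"
  shows "(\<Sum>j<k. tr (n * s) (tensor_id m n s (F j) X)) = tr (m * s) X"
proof -
  have "tr (n * s) ((\<lambda>X p q. \<Sum>j<k. tensor_id m n s (F j) X p q) X) = tr (m * s) X"
  proof (rule tr_ext_kron[OF _ _ X])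
    show "lin (m * s) (\<lambda>X p q. \<Sum>j<k. tensor_id m n s (F j) X p q)"
      using F(1) by (intro lin_sum_maps lin_tensor_id cpm_lin) auto
    fix A B assume A: "is_mat m m A"
    have "(\<Sum>j<k. tr (n * s) (tensor_id m n s (F j) (kr m s A B))) = (\<Sum>j<k. tr n (F j A)) * tr s B"
      unfolding sum_distrib_right
      by (intro sum.cong refl) (simp add: tensor_id_kron[OF cpm_lin[OF F(1)] A] tr_kron)
    then show "tr (n * s) (\<lambda>p q. \<Sum>j<k. tensor_id m n s (F j) (kr m s A B) p q) = tr (m * s) (kr m s A B)"
      using F(2)[OF A] by (simp add: tr_sum tr_kron)
  qed
  then show ?thesis by (simp add: tr_sum)
qed

lemma tr_sum_id_tensor:
  assumes F: "\<And>j. j < k \<Longrightarrow> cpm m n (F j)" "\<And>X. is_mat m m X \<Longrightarrow> (\<Sum>j<(k::nat). tr n (F j X)) = tr m X"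
    and X: "is_mat (s * m) (s * m) X"
  shows "(\<Sum>j<k. tr (s * n) (id_tensor s m n (F j) X)) = tr (s * m) X"
proof -
  have "tr (s * n) ((\<lambda>X p q. \<Sum>j<k. id_tensor s m n (F j) X p q) X) = tr (s * m) X"
  proof (rule tr_ext_kron[OF _ _ X])
    show "lin (s * m) (\<lambda>X p q. \<Sum>j<k. id_tensor s m n (F j) X p q)"
      using F(1) by (intro lin_sum_maps lin_id_tensor cpm_lin) auto
    fix A B assume B: "is_mat m m B"
    have "(\<Sum>j<k. tr (s * n) (id_tensor s m n (F j) (kr s m A B))) = tr s A * (\<Sum>j<k. tr n (F j B))"
      unfolding sum_distrib_left
      by (intro sum.cong refl) (simp add: id_tensor_kron[OF cpm_lin[OF F(1)] B] tr_kron)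
    then show "tr (s * n) (\<lambda>p q. \<Sum>j<k. id_tensor s m n (F j) (kr s m A B) p q) = tr (s * m) (kr s m A B)"
      using F(2)[OF B] by (simp add: tr_sum tr_kron)
  qed
  then show ?thesis by (simp add: tr_sum)
qed

lemma locc_channel: "locc aI bI aO bO L \<Longrightarrow> is_channel (aI * bI) (aO * bO) L"
proof (induction rule: locc.induct)
  case (locc_id aI bI L)
  then show ?case
    unfolding is_channel_iff tp_def using cpm_cong[OF cpm_id, of "aI * bI" L] by auto
next
  case (locc_alice aI a' k Ks bI aO bO Ls L)
  let ?T = "\<lambda>j. tensor_id aI a' bI (kraus_map aI a' (Ks j))"
  have T: "cpm (aI * bI) (a' * bI) (?T j)" if "j < k" for j
    using instrument_cpm[OF locc_alice(1) that] by (rule cpm_tensor_id)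
  have Ls: "is_channel (a' * bI) (aO * bO) (Ls j)" if "j < k" for j using locc_alice(3) that by blast
  have "cpm (aI * bI) (aO * bO) (\<lambda>X p q. \<Sum>j<k. Ls j (?T j X) p q)"
    by (intro cpm_sum cpm_comp[OF T is_channel_cpm[OF Ls]])
  then have "cpm (aI * bI) (aO * bO) L"
    by (rule cpm_cong) (use locc_alice(2) in blast)
  moreover have "tr (aO * bO) (L X) = tr (aI * bI) X" if X: "is_mat (aI * bI) (aI * bI) X" for X
  proof -
    have "tr (aO * bO) (L X) = (\<Sum>j<k. tr (aO * bO) (Ls j (?T j X)))"
      using locc_alice(2) X by (simp add: tr_sum)
    also have "\<dots> = (\<Sum>j<k. tr (a' * bI) (?T j X))"
      using Ls by (intro sum.cong refl) (auto simp: is_channel_iff tp_def)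
    also have "\<dots> = tr (aI * bI) X"
      using instrument_cpm[OF locc_alice(1)] instrument_tr[OF locc_alice(1)] X by (intro tr_sum_tensor_id) auto
    finally show ?thesis .
  qed
  ultimately show ?case by (simp add: is_channel_iff tp_def)
next
  case (locc_bob bI b' k Ks aI aO bO Ls L)
  let ?T = "\<lambda>j. id_tensor aI bI b' (kraus_map bI b' (Ks j))"
  have T: "cpm (aI * bI) (aI * b') (?T j)" if "j < k" for j
    using instrument_cpm[OF locc_bob(1) that] by (rule cpm_id_tensor)
  have Ls: "is_channel (aI * b') (aO * bO) (Ls j)" if "j < k" for j using locc_bob(3) that by blast
  have "cpm (aI * bI) (aO * bO) (\<lambda>X p q. \<Sum>j<k. Ls j (?T j X) p q)"
    by (intro cpm_sum cpm_comp[OF T is_channel_cpm[OF Ls]])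
  then have "cpm (aI * bI) (aO * bO) L"
    by (rule cpm_cong) (use locc_bob(2) in blast)
  moreover have "tr (aO * bO) (L X) = tr (aI * bI) X" if X: "is_mat (aI * bI) (aI * bI) X" for X
  proof -
    have "tr (aO * bO) (L X) = (\<Sum>j<k. tr (aO * bO) (Ls j (?T j X)))"
      using locc_bob(2) X by (simp add: tr_sum)
    also have "\<dots> = (\<Sum>j<k. tr (aI * b') (?T j X))"
      using Ls by (intro sum.cong refl) (auto simp: is_channel_iff tp_def)
    also have "\<dots> = tr (aI * bI) X"
      using instrument_cpm[OF locc_bob(1)] instrument_tr[OF locc_bob(1)] X by (intro tr_sum_id_tensor) auto
    finally show ?thesis .
  qed
  ultimately show ?case by (simp add: is_channel_iff tp_def)
qed

text \<open>The second protocol is attached at the leaves of the first. Its linearity moves it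
  inside the sum over outcomes, where the induction hypothesis applies to every branch.\<close>

lemma locc_comp:
  assumes "locc a b c d L" "locc c d e f M"
  shows "locc a b e f (\<lambda>X. M (L X))"
  using assms
proof (induction arbitrary: M rule: locc.induct)
  case (locc_id aI bI L)
  then show ?case by (auto intro: locc_cong)
next
  case (locc_alice aI a' k Ks bI aO bO Ls L)
  have Ls: "locc a' bI aO bO (Ls j)" if "j < k" for j using locc_alice(3) that by blast
  note cp = instrument_cpm[OF locc_alice(1)] and M = is_channel_lin[OF locc_channel[OF locc_alice(4)]]
  show ?case
  proof (rule locc_aliceI[of k aI a' "\<lambda>j. kraus_map aI a' (Ks j)" bI e f "\<lambda>j X. M (Ls j X)"])
    fix X assume X: "is_mat (aI * bI) (aI * bI) X"
    have "is_mat (aO * bO) (aO * bO) (Ls j (tensor_id aI a' bI (kraus_map aI a' (Ks j)) X))" if "j < k" for j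
      by (rule is_channel_is_mat[OF locc_channel[OF Ls[OF that]]]) simp
    then have "M (\<lambda>p q. \<Sum>j<k. Ls j (tensor_id aI a' bI (kraus_map aI a' (Ks j)) X) p q) = (\<lambda>p q. \<Sum>j<k. M (Ls j (tensor_id aI a' bI (kraus_map aI a' (Ks j)) X)) p q)"
      by (intro lin_sum1[OF M]) auto
    then show "M (L X) = (\<lambda>p q. \<Sum>j<k. M (Ls j (tensor_id aI a' bI (kraus_map aI a' (Ks j)) X)) p q)"
      using locc_alice(2) X by simp
  next
    show "locc a' bI e f (\<lambda>X. M (Ls j X))" if "j < k" for j
      by (rule locc_alice(3)[rule_format, OF that, THEN conjunct2, rule_format, OF locc_alice(4)])
  qed (use cp instrument_tr[OF locc_alice(1)] in auto)
next
  case (locc_bob bI b' k Ks aI aO bO Ls L)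
  have Ls: "locc aI b' aO bO (Ls j)" if "j < k" for j using locc_bob(3) that by blast
  note cp = instrument_cpm[OF locc_bob(1)] and M = is_channel_lin[OF locc_channel[OF locc_bob(4)]]
  show ?case
  proof (rule locc_bobI[of k bI b' "\<lambda>j. kraus_map bI b' (Ks j)" aI e f "\<lambda>j X. M (Ls j X)"])
    fix X assume X: "is_mat (aI * bI) (aI * bI) X"
    have "is_mat (aO * bO) (aO * bO) (Ls j (id_tensor aI bI b' (kraus_map bI b' (Ks j)) X))" if "j < k" for j
      by (rule is_channel_is_mat[OF locc_channel[OF Ls[OF that]]]) simp
    then have "M (\<lambda>p q. \<Sum>j<k. Ls j (id_tensor aI bI b' (kraus_map bI b' (Ks j)) X) p q) = (\<lambda>p q. \<Sum>j<k. M (Ls j (id_tensor aI bI b' (kraus_map bI b' (Ks j)) X)) p q)"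
      by (intro lin_sum1[OF M]) auto
    then show "M (L X) = (\<lambda>p q. \<Sum>j<k. M (Ls j (id_tensor aI bI b' (kraus_map bI b' (Ks j)) X)) p q)"
      using locc_bob(2) X by simp
  next
    show "locc aI b' e f (\<lambda>X. M (Ls j X))" if "j < k" for j
      by (rule locc_bob(3)[rule_format, OF that, THEN conjunct2, rule_format, OF locc_bob(4)])
  qed (use cp instrument_tr[OF locc_bob(1)] in auto)
qed

lemma locc_local_alice:
  assumes "is_channel a a' f"
  shows "locc a b a' b (tensor_id a a' b f)"
  by (rule locc_aliceI[of 1 a a' "\<lambda>_. f" b a' b "\<lambda>_ X. X"])
    (use assms in \<open>auto simp: is_channel_iff tp_def intro: locc.locc_id\<close>)

lemma locc_local_bob:
  assumes "is_channel b b' f"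
  shows "locc a b a b' (id_tensor a b b' f)"
  by (rule locc_bobI[of 1 b b' "\<lambda>_. f" a a b' "\<lambda>_ X. X"])
    (use assms in \<open>auto simp: is_channel_iff tp_def intro: locc.locc_id\<close>)

text \<open>Alice draws \<open>j\<close> as the outcome of an instrument whose Kraus operators are
  those of \<open>F j\<close> scaled by the square root of \<open>p j\<close>, announces it, and Bob
  applies \<open>G j\<close>.\<close>

lemma locc_shared_randomness:
  assumes p: "\<And>j. j < k \<Longrightarrow> 0 \<le> p j" "(\<Sum>j<k. p j) = 1"
    and F: "\<And>j. j < k \<Longrightarrow> is_channel a a' (F j)" and G: "\<And>j. j < k \<Longrightarrow> is_channel b b' (G j)"
    and L: "\<And>X. is_mat (a * b) (a * b) X \<Longrightarrow>
      L X = (\<lambda>x y. \<Sum>j<(k::nat). of_real (p j) * id_tensor a' b b' (G j) (tensor_id a a' b (F j) X) x y)"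
  shows "locc a b a' b' L"
proof (rule locc_aliceI[of k a a' "\<lambda>j X x y. of_real (p j) * F j X x y" b a' b' "\<lambda>j. id_tensor a' b b' (G j)"])
  fix j assume j: "j < k"
  note F' = is_channel_cpm[OF F[OF j]]
  then obtain Ks where Ks: "\<forall>K\<in>set Ks. is_mat a' a K" "\<forall>X. is_mat a a X \<longrightarrow> F j X = kraus_map a a' Ks X"
    unfolding cpm_def by blast
  let ?Ls = "map (\<lambda>K i l. of_real (sqrt (p j)) * K i l) Ks"
  have c: "kraus_term a a' (\<lambda>i l. of_real (sqrt (p j)) * K i l) X = (\<lambda>x y. of_real (p j) * kraus_term a a' K X x y)" for K X
  proof -
    have "complex_of_real (sqrt (p j)) * of_real (sqrt (p j)) = of_real (p j)"
      using p(1)[OF j] by (simp flip: of_real_mult)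
    then have "(of_real (sqrt (p j)) * x) * y * (of_real (sqrt (p j)) * z) = of_real (p j) * (x * y * z)" for x y z :: complex
      by (metis (no_types, opaque_lifting) mult.assoc mult.left_commute)
    note e = this
    have "(\<Sum>k<a. \<Sum>l<a. (of_real (sqrt (p j)) * K x k) * X k l * cnj (of_real (sqrt (p j)) * K y l))
        = of_real (p j) * (\<Sum>k<a. \<Sum>l<a. K x k * X k l * cnj (K y l))" for x y
      by (simp only: sum_distrib_left complex_cnj_mult complex_cnj_complex_of_real e)
    then show ?thesis by (auto simp: kraus_term_def mk_def fun_eq_iff)
  qed
  show "cpm a a' (\<lambda>X x y. of_real (p j) * F j X x y)"
    unfolding cpm_def using Ks
    by (intro exI[of _ ?Ls]) (auto simp: is_mat_scale kraus_map_kraus_term o_def c sum_list_const_mult)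
  show "locc a' b a' b' (id_tensor a' b b' (G j))" by (rule locc_local_bob[OF G[OF j]])
next
  fix X assume X: "is_mat a a X"
  have "(\<Sum>j<k. tr a' (\<lambda>x y. of_real (p j) * F j X x y)) = (\<Sum>j<k. of_real (p j) * tr a X)"
  proof (intro sum.cong refl)
    fix j assume "j \<in> {..<k}"
    then have "tr a' (F j X) = tr a X" using F[of j] X by (simp add: is_channel_iff tp_def)
    then show "tr a' (\<lambda>x y. of_real (p j) * F j X x y) = of_real (p j) * tr a X"
      by (simp add: tr_def sum_distrib_left[symmetric])
  qed
  also have "\<dots> = of_real (\<Sum>j<k. p j) * tr a X" by (simp add: sum_distrib_right)
  finally show "(\<Sum>j<k. tr a' (\<lambda>x y. of_real (p j) * F j X x y)) = tr a X" using p(2) by simp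
next
  fix X assume X: "is_mat (a * b) (a * b) X"
  have "id_tensor a' b b' (G j) (tensor_id a a' b (\<lambda>X x y. of_real (p j) * F j X x y) X)
      = (\<lambda>x y. of_real (p j) * id_tensor a' b b' (G j) (tensor_id a a' b (F j) X) x y)" if j: "j < k" for j
  proof -
    have "tensor_id a a' b (\<lambda>X x y. of_real (p j) * F j X x y) X = (\<lambda>x y. of_real (p j) * tensor_id a a' b (F j) X x y)"
      by (auto simp: tensor_id_def mk_def fun_eq_iff)
    then show ?thesis
      by (simp add: lin_scaleD[OF lin_id_tensor[OF is_channel_lin[OF G[OF j]]]])
  qed
  then show "L X = (\<lambda>x y. \<Sum>j<k. id_tensor a' b b' (G j) (tensor_id a a' b (\<lambda>X x y. of_real (p j) * F j X x y) X) x y)"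
    using L[OF X] by simp
qed

section \<open>LOCC maps beside idle systems\<close>

definition flip :: "nat \<Rightarrow> nat \<Rightarrow> cmat \<Rightarrow> cmat" where
  "flip a b = swap_mid 1 a b 1"

lemma is_channel_flip: "is_channel (a * b) (b * a) (flip a b)"
  using is_channel_swap_mid'[of 1 a b 1] by (simp add: flip_def)

lemma flip_kron:
  assumes "is_mat a a A" "is_mat b b B"
  shows "flip a b (kr a b A B) = kr b a B A"
  using swap_mid_kron[of 1 a b 1 "idm 1" A B "idm 1"] assms
  by (simp only: flip_def kron_one_left kron_one_right mult_1_left mult_1_right)

text \<open>Lets \<open>L\<close> act while Alice holds an idle system \<open>c\<close> and Bob an
  idle system \<open>e\<close>. The cut places each idle factor beside its owner's active one,
  whereas \<open>tensor_id\<close> needs the active factors adjacent, hence the two swaps.\<close>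

definition liftR :: "nat \<Rightarrow> nat \<Rightarrow> nat \<Rightarrow> nat \<Rightarrow> nat \<Rightarrow> nat \<Rightarrow> (cmat \<Rightarrow> cmat) \<Rightarrow> cmat \<Rightarrow> cmat" where
  "liftR aI bI aO bO c e L X = swap_mid aO bO c e (tensor_id (aI * bI) (aO * bO) (c * e) L (swap_mid aI c bI e X))"

definition liftL :: "nat \<Rightarrow> nat \<Rightarrow> nat \<Rightarrow> nat \<Rightarrow> nat \<Rightarrow> nat \<Rightarrow> (cmat \<Rightarrow> cmat) \<Rightarrow> cmat \<Rightarrow> cmat" where
  "liftL c e aI bI aO bO L X = swap_mid c e aO bO (id_tensor (c * e) (aI * bI) (aO * bO) L (swap_mid c aI e bI X))"

lemma liftR_swap:
  assumes "is_mat (aI * bI * (c * e)) (aI * bI * (c * e)) Y"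
  shows "liftR aI bI aO bO c e L (swap_mid aI bI c e Y) = swap_mid aO bO c e (tensor_id (aI * bI) (aO * bO) (c * e) L Y)"
  by (simp add: liftR_def swap_mid_inverse'[OF assms])

lemma liftL_swap:
  assumes "is_mat (c * e * (aI * bI)) (c * e * (aI * bI)) Y"
  shows "liftL c e aI bI aO bO L (swap_mid c e aI bI Y) = swap_mid c e aO bO (id_tensor (c * e) (aI * bI) (aO * bO) L Y)"
  by (simp add: liftL_def swap_mid_inverse'[OF assms])

lemma liftR_channel:
  assumes "is_channel (aI * bI) (aO * bO) L"
  shows "is_channel (aI * c * (bI * e)) (aO * c * (bO * e)) (liftR aI bI aO bO c e L)"
  unfolding liftR_def[abs_def]
  by (intro is_channel_comp[OF is_channel_swap_mid' is_channel_comp[OF is_channel_tensor_id[OF assms] is_channel_swap_mid']])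

lemma liftL_channel:
  assumes "is_channel (aI * bI) (aO * bO) L"
  shows "is_channel (c * aI * (e * bI)) (c * aO * (e * bO)) (liftL c e aI bI aO bO L)"
  unfolding liftL_def[abs_def]
  by (intro is_channel_comp[OF is_channel_swap_mid' is_channel_comp[OF is_channel_id_tensor[OF assms] is_channel_swap_mid']])

lemma liftR_kron:
  assumes "lin (aI * bI) L" "is_mat aI aI A" "is_mat bI bI B"
  shows "liftR aI bI aO bO c e L (kr (aI * c) (bI * e) (kr aI c A C) (kr bI e B E))
    = swap_mid aO bO c e (kr (aO * bO) (c * e) (L (kr aI bI A B)) (kr c e C E))"
  unfolding liftR_def swap_mid_kron by (simp add: tensor_id_kron[OF assms(1)])

lemma liftL_kron:
  assumes "lin (aI * bI) L" "is_mat aI aI A" "is_mat bI bI B"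
  shows "liftL c e aI bI aO bO L (kr (c * aI) (e * bI) (kr c aI C A) (kr e bI E B))
    = swap_mid c e aO bO (kr (c * e) (aO * bO) (kr c e C E) (L (kr aI bI A B)))"
  unfolding liftL_def swap_mid_kron by (simp add: id_tensor_kron[OF assms(1)])

lemma swap_mid_sum: "swap_mid d1 d2 d3 d4 (\<lambda>x y. \<Sum>j<(k::nat). X j x y) = (\<lambda>x y. \<Sum>j<k. swap_mid d1 d2 d3 d4 (X j) x y)"
  by (auto simp: swap_mid_def mk_def fun_eq_iff)

text \<open>Every local instrument of the protocol is tensored with the identity on its owner's idle
  system, outcome by outcome. That the lifted branches add up to the lifted map is checked on
  products of four factors.\<close>

lemma locc_liftR: "locc aI bI aO bO L \<Longrightarrow> locc (aI * c) (bI * e) (aO * c) (bO * e) (liftR aI bI aO bO c e L)"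
proof (induction rule: locc.induct)
  case (locc_id aI bI L)
  have L: "lin (aI * bI) L"
    by (rule linI_cong[of _ "\<lambda>X. X"]) (use locc_id in \<open>auto simp: lin_def\<close>)
  have ch: "is_channel (aI * bI) (aI * bI) L"
    by (rule locc_channel[OF locc.locc_id[OF locc_id]])
  show ?case
  proof (rule locc.locc_id, intro allI impI)
    fix X assume X: "is_mat (aI * c * (bI * e)) (aI * c * (bI * e)) X"
    show "liftR aI bI aI bI c e L X = X"
      by (rule lin_ext_kron4[OF is_channel_lin[OF liftR_channel[OF ch]] _ _ X])
        (auto simp: lin_def liftR_kron[OF L] locc_id swap_mid_kron)
  qed
next
  case (locc_alice aI a' k Ks bI aO bO Ls L)
  note cp = instrument_cpm[OF locc_alice(1)]
  let ?F = "\<lambda>j. kraus_map aI a' (Ks j)"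
  have L: "is_channel (aI * bI) (aO * bO) L"
    using locc_alice by (intro locc_channel locc.locc_alice[OF locc_alice(1), of bI aO bO Ls]) auto
  have Ls: "is_channel (a' * bI) (aO * bO) (Ls j)" if "j < k" for j
    using locc_alice(3) that by (auto intro: locc_channel)
  let ?H = "\<lambda>X p q. \<Sum>j<k. liftR a' bI aO bO c e (Ls j) (tensor_id (aI * c) (a' * c) (bI * e) (tensor_id aI a' c (?F j)) X) p q"
  show ?case
  proof (rule locc_aliceI[of k "aI * c" "a' * c" "\<lambda>j. tensor_id aI a' c (?F j)" "bI * e" "aO * c" "bO * e"
        "\<lambda>j. liftR a' bI aO bO c e (Ls j)"])
    show "cpm (aI * c) (a' * c) (tensor_id aI a' c (?F j))" if "j < k" for j
      by (rule cpm_tensor_id[OF cp[OF that]])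
    show "(\<Sum>j<k. tr (a' * c) (tensor_id aI a' c (?F j) X)) = tr (aI * c) X" if "is_mat (aI * c) (aI * c) X" for X
      using cp instrument_tr[OF locc_alice(1)] that by (intro tr_sum_tensor_id) auto
    show "locc (a' * c) (bI * e) (aO * c) (bO * e) (liftR a' bI aO bO c e (Ls j))" if "j < k" for j
      using locc_alice(3) that by blast
    fix X assume X: "is_mat (aI * c * (bI * e)) (aI * c * (bI * e)) X"
    show "liftR aI bI aO bO c e L X
        = ?H X"
    proof (rule lin_ext_kron4[OF is_channel_lin[OF liftR_channel[OF L]] _ _ X])
      show "lin (aI * c * (bI * e)) ?H"
        by (rule lin_sum_maps, rule cpm_lin[OF cpm_comp[OF cpm_tensor_id[OF cpm_tensor_id[OF cp]] is_channel_cpm[OF liftR_channel[OF Ls]]]]) auto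
      fix A C B E
      let ?X = "kr (aI * c) (bI * e) (kr aI c A C) (kr bI e B E)"
      assume A: "is_mat aI aI A" and C: "is_mat c c C" and B: "is_mat bI bI B" and E: "is_mat e e E"
      have "L (kr aI bI A B) = (\<lambda>p q. \<Sum>j<k. Ls j (kr a' bI (?F j A) B) p q)"
        using locc_alice(2) A by (simp add: tensor_id_kron lin_kraus_map)
      then have "liftR aI bI aO bO c e L ?X
          = (\<lambda>p q. \<Sum>j<k. swap_mid aO bO c e (kr (aO * bO) (c * e) (Ls j (kr a' bI (?F j A) B)) (kr c e C E)) p q)"
        by (simp add: liftR_kron[OF is_channel_lin[OF L] A B] kron_sum_left swap_mid_sum)
      also have "\<dots> = ?H ?X"
        by (intro ext sum.cong refl)
          (simp add: tensor_id_kron lin_tensor_id lin_kraus_map A liftR_kron[OF is_channel_lin[OF Ls]] B)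
      finally show "liftR aI bI aO bO c e L ?X = \<dots>" .
    qed
  qed
next
  case (locc_bob bI b' k Ks aI aO bO Ls L)
  note cp = instrument_cpm[OF locc_bob(1)]
  let ?F = "\<lambda>j. kraus_map bI b' (Ks j)"
  have L: "is_channel (aI * bI) (aO * bO) L"
    using locc_bob by (intro locc_channel locc.locc_bob[OF locc_bob(1), of aI aO bO Ls]) auto
  have Ls: "is_channel (aI * b') (aO * bO) (Ls j)" if "j < k" for j
    using locc_bob(3) that by (auto intro: locc_channel)
  let ?H = "\<lambda>X p q. \<Sum>j<k. liftR aI b' aO bO c e (Ls j) (id_tensor (aI * c) (bI * e) (b' * e) (tensor_id bI b' e (?F j)) X) p q"
  show ?case
  proof (rule locc_bobI[of k "bI * e" "b' * e" "\<lambda>j. tensor_id bI b' e (?F j)" "aI * c" "aO * c" "bO * e"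
        "\<lambda>j. liftR aI b' aO bO c e (Ls j)"])
    show "cpm (bI * e) (b' * e) (tensor_id bI b' e (?F j))" if "j < k" for j
      by (rule cpm_tensor_id[OF cp[OF that]])
    show "(\<Sum>j<k. tr (b' * e) (tensor_id bI b' e (?F j) X)) = tr (bI * e) X" if "is_mat (bI * e) (bI * e) X" for X
      using cp instrument_tr[OF locc_bob(1)] that by (intro tr_sum_tensor_id) auto
    show "locc (aI * c) (b' * e) (aO * c) (bO * e) (liftR aI b' aO bO c e (Ls j))" if "j < k" for j
      using locc_bob(3) that by blast
    fix X assume X: "is_mat (aI * c * (bI * e)) (aI * c * (bI * e)) X"
    show "liftR aI bI aO bO c e L X
        = ?H X"
    proof (rule lin_ext_kron4[OF is_channel_lin[OF liftR_channel[OF L]] _ _ X])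
      show "lin (aI * c * (bI * e)) ?H"
        by (rule lin_sum_maps, rule cpm_lin[OF cpm_comp[OF cpm_id_tensor[OF cpm_tensor_id[OF cp]] is_channel_cpm[OF liftR_channel[OF Ls]]]]) auto
      fix A C B E
      let ?X = "kr (aI * c) (bI * e) (kr aI c A C) (kr bI e B E)"
      assume A: "is_mat aI aI A" and C: "is_mat c c C" and B: "is_mat bI bI B" and E: "is_mat e e E"
      have "L (kr aI bI A B) = (\<lambda>p q. \<Sum>j<k. Ls j (kr aI b' A (?F j B)) p q)"
        using locc_bob(2) B by (simp add: id_tensor_kron lin_kraus_map)
      then have "liftR aI bI aO bO c e L ?X
          = (\<lambda>p q. \<Sum>j<k. swap_mid aO bO c e (kr (aO * bO) (c * e) (Ls j (kr aI b' A (?F j B))) (kr c e C E)) p q)"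
        by (simp add: liftR_kron[OF is_channel_lin[OF L] A B] kron_sum_left swap_mid_sum)
      also have "\<dots> = ?H ?X"
        by (intro ext sum.cong refl)
          (simp add: tensor_id_kron id_tensor_kron lin_tensor_id lin_kraus_map B liftR_kron[OF is_channel_lin[OF Ls]] A)
      finally show "liftR aI bI aO bO c e L ?X = \<dots>" .
    qed
  qed
qed

text \<open>Acting on the right factors is acting on the left factors up to local flips.\<close>
lemma locc_liftL:
  assumes L: "locc aI bI aO bO L"
  shows "locc (c * aI) (e * bI) (c * aO) (e * bO) (liftL c e aI bI aO bO L)"
proof -
  let ?fi = "\<lambda>X. id_tensor (aI * c) (e * bI) (bI * e) (flip e bI) (tensor_id (c * aI) (aI * c) (e * bI) (flip c aI) X)"
  let ?fo = "\<lambda>X. id_tensor (c * aO) (bO * e) (e * bO) (flip bO e) (tensor_id (aO * c) (c * aO) (bO * e) (flip aO c) X)"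
  let ?M = "\<lambda>X. ?fo (liftR aI bI aO bO c e L (?fi X))"
  have fi: "locc (c * aI) (e * bI) (aI * c) (bI * e) ?fi"
    by (rule locc_comp[OF locc_local_alice[OF is_channel_flip] locc_local_bob[OF is_channel_flip]])
  have fo: "locc (aO * c) (bO * e) (c * aO) (e * bO) ?fo"
    by (rule locc_comp[OF locc_local_alice[OF is_channel_flip] locc_local_bob[OF is_channel_flip]])
  have M: "locc (c * aI) (e * bI) (c * aO) (e * bO) ?M"
    by (rule locc_comp[OF fi locc_comp[OF locc_liftR[OF L] fo]])
  have Lc: "is_channel (aI * bI) (aO * bO) L" by (rule locc_channel[OF L])
  note fl = is_channel_lin[OF is_channel_flip]
  have ki: "?fi (kr (c * aI) (e * bI) (kr c aI C A) (kr e bI E B)) = kr (aI * c) (bI * e) (kr aI c A C) (kr bI e B E)"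
    if "is_mat aI aI A" "is_mat c c C" "is_mat bI bI B" "is_mat e e E" for A C B E
    using that by (simp add: tensor_id_kron[OF fl] id_tensor_kron[OF fl] flip_kron)
  \<comment> \<open>The output of \<open>L\<close> need not be a product even on product inputs, so
    the flips after \<open>L\<close> are compared for a general \<open>Y\<close>.\<close>
  have ko: "?fo (swap_mid aO bO c e (kr (aO * bO) (c * e) Y (kr c e C E))) = swap_mid c e aO bO (kr (c * e) (aO * bO) (kr c e C E) Y)"
    if Y: "is_mat (aO * bO) (aO * bO) Y" and C: "is_mat c c C" and E: "is_mat e e E" for Y C E
  proof (rule lin_ext_kron[OF _ _ _ Y])
    show "lin (aO * bO) (\<lambda>Y. ?fo (swap_mid aO bO c e (kr (aO * bO) (c * e) Y (kr c e C E))))"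
      by (rule lin_comp[OF lin_kron_left lin_comp[OF is_channel_lin[OF is_channel_swap_mid'] is_channel_lin[OF locc_channel[OF fo]]]]) simp_all
    show "lin (aO * bO) (\<lambda>Y. swap_mid c e aO bO (kr (c * e) (aO * bO) (kr c e C E) Y))"
      by (rule lin_comp[OF lin_kron_right lin_swap_mid is_mat_kron])
    fix A B assume "is_mat aO aO A" "is_mat bO bO B"
    then show "?fo (swap_mid aO bO c e (kr (aO * bO) (c * e) (kr aO bO A B) (kr c e C E)))
        = swap_mid c e aO bO (kr (c * e) (aO * bO) (kr c e C E) (kr aO bO A B))"
      using C E by (simp add: swap_mid_kron tensor_id_kron[OF fl] id_tensor_kron[OF fl] flip_kron)
  qed
  show ?thesis
  proof (rule locc_cong[OF M])
    fix X assume X: "is_mat (c * aI * (e * bI)) (c * aI * (e * bI)) X"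
    show "liftL c e aI bI aO bO L X = ?M X"
    proof (rule lin_ext_kron4[OF is_channel_lin[OF liftL_channel[OF Lc]] is_channel_lin[OF locc_channel[OF M]] _ X])
      fix C A E B assume m: "is_mat c c C" "is_mat aI aI A" "is_mat e e E" "is_mat bI bI B"
      have Y: "is_mat (aO * bO) (aO * bO) (L (kr aI bI A B))" by (rule is_channel_is_mat[OF Lc]) simp
      show "liftL c e aI bI aO bO L (kr (c * aI) (e * bI) (kr c aI C A) (kr e bI E B))
          = ?M (kr (c * aI) (e * bI) (kr c aI C A) (kr e bI E B))"
        unfolding ki[OF m(2,1,4,3)] liftR_kron[OF is_channel_lin[OF Lc] m(2,4)] ko[OF Y m(1,3)]
        by (rule liftL_kron[OF is_channel_lin[OF Lc] m(2,4)])
    qed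
  qed
qed

section \<open>Preparing and discarding systems by LOCC\<close>

lemma separable_eq:
  assumes "separable c e \<rho>"
  obtains k p \<sigma> \<tau> where "\<And>i. i < k \<Longrightarrow> 0 \<le> p i" "\<And>i. i < k \<Longrightarrow> density c (\<sigma> i)" "\<And>i. i < k \<Longrightarrow> density e (\<tau> i)"
    "(\<Sum>i<(k::nat). p i) = 1" "\<rho> = (\<lambda>x y. \<Sum>i<k. complex_of_real (p i) * kr c e (\<sigma> i) (\<tau> i) x y)"
proof -
  from assms obtain k :: nat and p \<sigma> \<tau> where *: "\<forall>i<k. 0 \<le> p i \<and> density c (\<sigma> i) \<and> density e (\<tau> i)" "(\<Sum>i<k. p i) = 1"
    "\<rho> = mk (c * e) (c * e) (\<lambda>x y. \<Sum>i<k. complex_of_real (p i) * kr c e (\<sigma> i) (\<tau> i) x y)"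
    unfolding separable_def by blast
  have "\<rho> = (\<lambda>x y. \<Sum>i<k. complex_of_real (p i) * kr c e (\<sigma> i) (\<tau> i) x y)"
    unfolding *(3) by (rule is_mat_eqI[of "c * e" "c * e"]) (simp_all add: is_mat_sum is_mat_scale, simp add: mk_def)
  with * that show ?thesis by blast
qed

lemma is_channel_kron_left:
  assumes "density c \<sigma>"
  shows "is_channel d (c * d) (\<lambda>X. kr c d \<sigma> X)"
proof -
  have "is_channel d (c * d) (\<lambda>X. flip d c (kr d c X \<sigma>))"
    by (rule is_channel_comp[OF is_channel_kron_right[OF assms] is_channel_flip])
  moreover have "flip d c (kr d c X \<sigma>) = kr c d \<sigma> X" if "is_mat d d X" for X
    using that assms by (simp add: flip_kron density_psd psd_is_mat)
  ultimately show ?thesis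
    unfolding is_channel_def by auto
qed

text \<open>Shared randomness selects a term of the convex decomposition and each party prepares its
  own factor. In the reduction from codes to states this adds the fresh seizing input beside the
  stored copies.\<close>

lemma locc_prepare_right:
  assumes "separable c e \<rho>"
  shows "locc a b (a * c) (b * e) (\<lambda>X. swap_mid a b c e (kr (a * b) (c * e) X \<rho>))"
proof -
  obtain k :: nat and p \<sigma> \<tau> where p0: "\<And>i. i < k \<Longrightarrow> 0 \<le> p i"
    and \<sigma>: "\<And>i. i < k \<Longrightarrow> density c (\<sigma> i)" and \<tau>: "\<And>i. i < k \<Longrightarrow> density e (\<tau> i)"
    and p1: "(\<Sum>i<k. p i) = 1"
    and \<rho>: "\<rho> = (\<lambda>x y. \<Sum>i<k. complex_of_real (p i) * kr c e (\<sigma> i) (\<tau> i) x y)"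
    by (rule separable_eq[OF assms]) blast
  note F = is_channel_kron_right[OF \<sigma>] and G = is_channel_kron_right[OF \<tau>]
  let ?H = "\<lambda>X x y. \<Sum>j<k. of_real (p j) * id_tensor (a * c) b (b * e) (\<lambda>X. kr b e X (\<tau> j)) (tensor_id a (a * c) b (\<lambda>X. kr a c X (\<sigma> j)) X) x y"
  show ?thesis
  proof (rule locc_shared_randomness[OF p0 p1 F G])
    fix X assume X: "is_mat (a * b) (a * b) X"
    show "swap_mid a b c e (kr (a * b) (c * e) X \<rho>) = ?H X"
    proof (rule lin_ext_kron[OF _ _ _ X])
      show "lin (a * b) (\<lambda>X. swap_mid a b c e (kr (a * b) (c * e) X \<rho>))"
        by (rule lin_comp[OF lin_kron_left lin_swap_mid is_mat_kron])
      have "lin (a * b) (\<lambda>X. id_tensor (a * c) b (b * e) (\<lambda>X. kr b e X (\<tau> j)) (tensor_id a (a * c) b (\<lambda>X. kr a c X (\<sigma> j)) X))" for j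
        by (rule lin_comp[OF lin_tensor_id[OF lin_kron_left] lin_id_tensor[OF lin_kron_left] is_mat_tensor_id])
      then show "lin (a * b) ?H"
        by (intro lin_sum_maps) (simp add: lin_def algebra_simps)
      fix A B assume "is_mat a a A" "is_mat b b B"
      then show "swap_mid a b c e (kr (a * b) (c * e) (kr a b A B) \<rho>) = ?H (kr a b A B)"
        by (simp add: \<rho> kron_sum_right kron_scale_right swap_mid_sum lin_scaleD[OF lin_swap_mid is_mat_kron]
            swap_mid_kron tensor_id_kron id_tensor_kron lin_kron_left)
    qed
  qed
qed

text \<open>The mirrored order serves the first round, where the prepared input stands before the
  maximally entangled state.\<close>

lemma locc_prepare_left:
  assumes "separable c e \<rho>"
  shows "locc a b (c * a) (e * b) (\<lambda>X. swap_mid c e a b (kr (c * e) (a * b) \<rho> X))"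
proof -
  obtain k :: nat and p \<sigma> \<tau> where p0: "\<And>i. i < k \<Longrightarrow> 0 \<le> p i"
    and \<sigma>: "\<And>i. i < k \<Longrightarrow> density c (\<sigma> i)" and \<tau>: "\<And>i. i < k \<Longrightarrow> density e (\<tau> i)"
    and p1: "(\<Sum>i<k. p i) = 1"
    and \<rho>: "\<rho> = (\<lambda>x y. \<Sum>i<k. complex_of_real (p i) * kr c e (\<sigma> i) (\<tau> i) x y)"
    by (rule separable_eq[OF assms]) blast
  note F = is_channel_kron_left[OF \<sigma>] and G = is_channel_kron_left[OF \<tau>]
  let ?H = "\<lambda>X x y. \<Sum>j<k. of_real (p j) * id_tensor (c * a) b (e * b) (\<lambda>X. kr e b (\<tau> j) X) (tensor_id a (c * a) b (\<lambda>X. kr c a (\<sigma> j) X) X) x y"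
  show ?thesis
  proof (rule locc_shared_randomness[OF p0 p1 F G])
    fix X assume X: "is_mat (a * b) (a * b) X"
    show "swap_mid c e a b (kr (c * e) (a * b) \<rho> X) = ?H X"
    proof (rule lin_ext_kron[OF _ _ _ X])
      show "lin (a * b) (\<lambda>X. swap_mid c e a b (kr (c * e) (a * b) \<rho> X))"
        by (rule lin_comp[OF lin_kron_right lin_swap_mid is_mat_kron])
      have "lin (a * b) (\<lambda>X. id_tensor (c * a) b (e * b) (\<lambda>X. kr e b (\<tau> j) X) (tensor_id a (c * a) b (\<lambda>X. kr c a (\<sigma> j) X) X))" for j
        by (rule lin_comp[OF lin_tensor_id[OF lin_kron_right] lin_id_tensor[OF lin_kron_right] is_mat_tensor_id])
      then show "lin (a * b) ?H"
        by (intro lin_sum_maps) (simp add: lin_def algebra_simps)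
      fix A B assume "is_mat a a A" "is_mat b b B"
      then show "swap_mid c e a b (kr (c * e) (a * b) \<rho> (kr a b A B)) = ?H (kr a b A B)"
        by (simp add: \<rho> kron_sum_left kron_scale_left swap_mid_sum lin_scaleD[OF lin_swap_mid is_mat_kron]
            swap_mid_kron tensor_id_kron id_tensor_kron lin_kron_right)
    qed
  qed
qed

text \<open>Two local partial traces amount to the partial trace over the joint system, once the
  regrouping is undone.\<close>

lemma locc_discard_right:
  obtains T where "locc (a * c) (b * e) a b T"
    "\<And>Z. is_mat (a * b * (c * e)) (a * b * (c * e)) Z \<Longrightarrow> T (swap_mid a b c e Z) = ptrace_right (a * b) (c * e) Z"
proof
  let ?T = "\<lambda>X. id_tensor a (b * e) b (ptrace_right b e) (tensor_id (a * c) a (b * e) (ptrace_right a c) X)"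
  show T: "locc (a * c) (b * e) a b ?T"
    by (rule locc_comp[OF locc_local_alice[OF is_channel_ptrace_right] locc_local_bob[OF is_channel_ptrace_right]])
  fix Z assume Z: "is_mat (a * b * (c * e)) (a * b * (c * e)) Z"
  show "?T (swap_mid a b c e Z) = ptrace_right (a * b) (c * e) Z"
  proof (rule lin_ext_kron4[OF _ lin_ptrace_right _ Z])
    show "lin (a * b * (c * e)) (\<lambda>Z. ?T (swap_mid a b c e Z))"
      by (rule is_channel_lin[OF is_channel_comp[OF is_channel_swap_mid' locc_channel[OF T]]])
    fix A B C E assume "is_mat a a A" "is_mat b b B"
    then show "?T (swap_mid a b c e (kr (a * b) (c * e) (kr a b A B) (kr c e C E)))
        = ptrace_right (a * b) (c * e) (kr (a * b) (c * e) (kr a b A B) (kr c e C E))"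
      by (simp add: swap_mid_kron tensor_id_kron id_tensor_kron lin_ptrace_right ptrace_right_kron tr_kron
          kron_scale_left kron_scale_right lin_scaleD[OF lin_id_tensor[OF lin_ptrace_right] is_mat_kron]) (simp add: mult_ac)
  qed
qed

section \<open>Tensor powers and the maximally entangled state\<close>

text \<open>The tensor product of two bipartite operators across the cut: Alice's factors
  \<open>a\<close>, \<open>c\<close> come first, then Bob's \<open>b\<close>,
  \<open>e\<close>.\<close>

abbreviation bt :: "nat \<Rightarrow> nat \<Rightarrow> nat \<Rightarrow> nat \<Rightarrow> cmat \<Rightarrow> cmat \<Rightarrow> cmat" where
  "bt a b c e X Y \<equiv> swap_mid a b c e (kr (a * b) (c * e) X Y)"

lemma bt_assoc:
  assumes "is_mat (a * b) (a * b) X" "is_mat (c * d) (c * d) Y" "is_mat (e * f) (e * f) Z"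
  shows "bt a b (c * e) (d * f) X (bt c d e f Y Z) = bt (a * c) (b * d) e f (bt a b c d X Y) Z"
  using swap_mid_assoc[of a b c d e f "kr (a * b * (c * d)) (e * f) (kr (a * b) (c * d) X Y) Z"]
  by (simp add: tensor_id_kron lin_swap_mid) (simp add: kron_assoc id_tensor_kron lin_swap_mid)

lemma bt_one_left:
  assumes "is_mat (a * b) (a * b) X"
  shows "bt 1 1 a b (idm 1) X = X"
proof (rule lin_ext_kron[OF _ _ _ assms])
  show "lin (a * b) (\<lambda>X. bt 1 1 a b (idm 1) X)"
    by (rule lin_comp[OF lin_kron_right lin_swap_mid is_mat_kron])
  show "lin (a * b) (\<lambda>X. X)" by (simp add: lin_def)
  fix A B assume AB: "is_mat a a A" "is_mat b b B"
  have "idm 1 = kr 1 1 (idm 1) (idm 1)" using kron_one_left[of 1 "idm 1"] by simp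
  then show "bt 1 1 a b (idm 1) (kr a b A B) = kr a b A B"
    using swap_mid_kron[of 1 1 a b "idm 1" "idm 1" A B] AB
    by (simp only: kron_one_left mult_1_left)
qed

lemma density_bt:
  assumes "density (a * b) X" "density (c * e) Y"
  shows "density (a * c * (b * e)) (bt a b c e X Y)"
  by (rule density_channel[OF is_channel_swap_mid' density_kron[OF assms]])

lemma digit_Suc: "u < b \<Longrightarrow> digit b (x * b + u) (Suc k) = digit b x k"
  by (simp add: digit_def div_mult2_eq)

lemma digit_0: "u < b \<Longrightarrow> digit b (x * b + u) 0 = u"
  by (simp add: digit_def)

lemma digit_top: "u < b \<Longrightarrow> x < b ^ n \<Longrightarrow> digit b (u * b ^ n + x) n = u"
  by (simp add: digit_def)

lemma digit_low:
  assumes "k < n"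
  shows "digit b (u * b ^ n + x) k = digit b x k"
proof (cases "b = 0")
  case True
  then show ?thesis using assms by (cases k) (simp_all add: digit_def)
next
  case False
  have "b ^ n = b ^ (n - Suc k) * b * b ^ k"
    using assms by (simp add: power_Suc[symmetric] power_add[symmetric] mult.commute del: power_Suc)
  then have "u * b ^ n + x = x + (u * b ^ (n - Suc k) * b) * b ^ k" by simp
  then have "(u * b ^ n + x) div b ^ k = (x + (u * b ^ (n - Suc k) * b) * b ^ k) div b ^ k" by (rule arg_cong)
  also have "\<dots> = (u * b ^ (n - Suc k)) * b + x div b ^ k"
    using False by (intro div_mult_self1) simp
  finally have "(u * b ^ n + x) div b ^ k = (u * b ^ (n - Suc k)) * b + x div b ^ k" .
  then show ?thesis by (simp add: digit_def)
qed

lemma btpow_0: "btpow la lb 0 \<theta> = idm 1"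
  by (auto simp: btpow_def idm_def mk_def fun_eq_iff)

lemma is_mat_btpow [simp]: "is_mat (la ^ n * lb ^ n) (la ^ n * lb ^ n) (btpow la lb n \<theta>)"
  by (simp add: btpow_def)

lemma btpow_at:
  assumes "p < la ^ n" "q < lb ^ n" "p' < la ^ n" "q' < lb ^ n"
  shows "btpow la lb n \<theta> (p * lb ^ n + q) (p' * lb ^ n + q')
    = (\<Prod>k<n. \<theta> (digit la p k * lb + digit lb q k) (digit la p' k * lb + digit lb q' k))"
  using assms by (simp add: btpow_def mk_def idx_less)

lemma bt_at:
  assumes "i1 < d1" "i2 < d2" "i3 < d3" "i4 < d4" "j1 < d1" "j2 < d2" "j3 < d3" "j4 < d4"
  shows "bt d1 d2 d3 d4 X Y ((i1 * d3 + i3) * (d2 * d4) + (i2 * d4 + i4)) ((j1 * d3 + j3) * (d2 * d4) + (j2 * d4 + j4))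
    = X (i1 * d2 + i2) (j1 * d2 + j2) * Y (i3 * d4 + i4) (j3 * d4 + j4)"
proof -
  have less: "(i1 * d3 + i3) * (d2 * d4) + (i2 * d4 + i4) < d1 * d2 * d3 * d4"
    "(j1 * d3 + j3) * (d2 * d4) + (j2 * d4 + j4) < d1 * d2 * d3 * d4"
    using idx_less[OF idx_less[OF assms(1,3)] idx_less[OF assms(2,4)]]
      idx_less[OF idx_less[OF assms(5,7)] idx_less[OF assms(6,8)]] by (simp_all add: mult_ac)
  have "sm_idx d1 d2 d3 d4 ((i1 * d3 + i3) * (d2 * d4) + (i2 * d4 + i4)) = (i1 * d2 + i2) * (d3 * d4) + (i3 * d4 + i4)"
    if "i2 < d2" "i3 < d3" "i4 < d4" for i1 i2 i3 i4
    using sm_idx_at[OF that, of d1 i1] by (simp add: algebra_simps)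
  with less show ?thesis
    using assms by (simp add: swap_mid_def mk_def kron_at idx_less)
qed

text \<open>Splits off the least significant digits, so the extra copy stands last. The seizing
  strategy appends its new copies at this end.\<close>

lemma btpow_Suc: "btpow la lb (Suc n) \<theta> = bt (la ^ n) (lb ^ n) la lb (btpow la lb n \<theta>) \<theta>"
proof (rule is_mat_eqI[of "la ^ n * la * (lb ^ n * lb)" "la ^ n * la * (lb ^ n * lb)"])
  show "is_mat (la ^ n * la * (lb ^ n * lb)) (la ^ n * la * (lb ^ n * lb)) (btpow la lb (Suc n) \<theta>)"
    using is_mat_btpow[of la "Suc n" lb \<theta>] by (simp add: mult_ac)
  fix x y assume "x < la ^ n * la * (lb ^ n * lb)" "y < la ^ n * la * (lb ^ n * lb)"
  then obtain i1 i2 i3 i4 j1 j2 j3 j4 where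
    x: "x = (i1 * la + i3) * (lb ^ n * lb) + (i2 * lb + i4)" "i1 < la ^ n" "i3 < la" "i2 < lb ^ n" "i4 < lb"
    and y: "y = (j1 * la + j3) * (lb ^ n * lb) + (j2 * lb + j4)" "j1 < la ^ n" "j3 < la" "j2 < lb ^ n" "j4 < lb"
    by (elim idx_cases) blast
  have l: "i1 * la + i3 < la ^ Suc n" "j1 * la + j3 < la ^ Suc n" "i2 * lb + i4 < lb ^ Suc n" "j2 * lb + j4 < lb ^ Suc n"
    using idx_less[OF x(2,3)] idx_less[OF y(2,3)] idx_less[OF x(4,5)] idx_less[OF y(4,5)] by (simp_all add: mult.commute)
  have e: "lb ^ n * lb = lb ^ Suc n" by (simp add: mult.commute)
  have "btpow la lb (Suc n) \<theta> x y = \<theta> (i3 * lb + i4) (j3 * lb + j4) *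
      (\<Prod>k<n. \<theta> (digit la i1 k * lb + digit lb i2 k) (digit la j1 k * lb + digit lb j2 k))"
    unfolding x(1) y(1) e btpow_at[OF l(1,3,2,4)] prod.lessThan_Suc_shift
    using x(2-) y(2-) by (simp add: digit_Suc digit_0)
  also have "\<dots> = bt (la ^ n) (lb ^ n) la lb (btpow la lb n \<theta>) \<theta> x y"
    unfolding x(1) y(1) bt_at[OF x(2,4,3,5) y(2,4,3,5)] btpow_at[OF x(2,4) y(2,4)] by (rule mult.commute)
  finally show "btpow la lb (Suc n) \<theta> x y = bt (la ^ n) (lb ^ n) la lb (btpow la lb n \<theta>) \<theta> x y" .
qed simp

text \<open>Splits off the most significant digits, so the extra copy stands first, next to the
  channel input, where teleportation simulation consumes it.\<close>

lemma btpow_Suc2: "btpow la lb (Suc n) \<theta> = bt la lb (la ^ n) (lb ^ n) \<theta> (btpow la lb n \<theta>)"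
proof (rule is_mat_eqI[of "la * la ^ n * (lb * lb ^ n)" "la * la ^ n * (lb * lb ^ n)"])
  show "is_mat (la * la ^ n * (lb * lb ^ n)) (la * la ^ n * (lb * lb ^ n)) (btpow la lb (Suc n) \<theta>)"
    using is_mat_btpow[of la "Suc n" lb \<theta>] by simp
  fix x y assume "x < la * la ^ n * (lb * lb ^ n)" "y < la * la ^ n * (lb * lb ^ n)"
  then obtain i1 i2 i3 i4 j1 j2 j3 j4 where
    x: "x = (i1 * la ^ n + i3) * (lb * lb ^ n) + (i2 * lb ^ n + i4)" "i1 < la" "i3 < la ^ n" "i2 < lb" "i4 < lb ^ n"
    and y: "y = (j1 * la ^ n + j3) * (lb * lb ^ n) + (j2 * lb ^ n + j4)" "j1 < la" "j3 < la ^ n" "j2 < lb" "j4 < lb ^ n"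
    by (elim idx_cases) blast
  have l: "i1 * la ^ n + i3 < la ^ Suc n" "j1 * la ^ n + j3 < la ^ Suc n" "i2 * lb ^ n + i4 < lb ^ Suc n" "j2 * lb ^ n + j4 < lb ^ Suc n"
    using idx_less[OF x(2,3)] idx_less[OF y(2,3)] idx_less[OF x(4,5)] idx_less[OF y(4,5)] by simp_all
  have e: "lb * lb ^ n = lb ^ Suc n" by simp
  have "btpow la lb (Suc n) \<theta> x y = (\<Prod>k<n. \<theta> (digit la i3 k * lb + digit lb i4 k) (digit la j3 k * lb + digit lb j4 k))
      * \<theta> (i1 * lb + i2) (j1 * lb + j2)"
    unfolding x(1) y(1) e btpow_at[OF l(1,3,2,4)] prod.lessThan_Suc
    using x(2-) y(2-) by (simp add: digit_low digit_top)
  also have "\<dots> = bt la lb (la ^ n) (lb ^ n) \<theta> (btpow la lb n \<theta>) x y"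
    unfolding x(1) y(1) bt_at[OF x(2,4,3,5) y(2,4,3,5)] btpow_at[OF x(3,5) y(3,5)] by (rule mult.commute)
  finally show "btpow la lb (Suc n) \<theta> x y = bt la lb (la ^ n) (lb ^ n) \<theta> (btpow la lb n \<theta>) x y" .
qed simp

lemma density_idm1: "density 1 (idm 1)"
proof -
  have "idm 1 = mk 1 1 (\<lambda>i j. \<Sum>a<1::nat. 1 * cnj 1)" by (auto simp: idm_def mk_def fun_eq_iff)
  then have "psd 1 (idm 1)" using psd_sum_rank_oneI[of 1 "\<lambda>a i. 1" 1] by simp
  then show ?thesis by (simp add: density_def tr_def idm_def mk_def)
qed

lemma density_btpow: "density (la * lb) \<theta> \<Longrightarrow> density (la ^ n * lb ^ n) (btpow la lb n \<theta>)"
proof (induction n)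
  case 0
  then show ?case using density_idm1 by (simp only: btpow_0 power_0 mult_1_left)
next
  case (Suc n)
  then show ?case
    unfolding btpow_Suc2 using density_bt[of la lb \<theta> "la ^ n" "lb ^ n"] by simp
qed

lemma density_maxent:
  assumes "1 \<le> M"
  shows "density (M * M) (maxent M)"
proof -
  define w where "w p = (if p mod M = p div M then complex_of_real (1 / sqrt (real M)) else 0)" for p :: nat
  have "sqrt (real M) * sqrt (real M) = real M" by simp
  then have "complex_of_real (1 / sqrt (real M)) * complex_of_real (1 / sqrt (real M)) = 1 / of_nat M"
    unfolding of_real_mult[symmetric] times_divide_times_eq by simp
  then have "maxent M = mk (M * M) (M * M) (\<lambda>i j. \<Sum>a<1::nat. w i * cnj (w j))"
    by (auto simp: maxent_def mk_def w_def fun_eq_iff)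
  then have "psd (M * M) (maxent M)" using psd_sum_rank_oneI[of "M * M" "\<lambda>_. w" 1] by simp
  moreover have "tr (M * M) (maxent M) = (\<Sum>i<M. \<Sum>k<M. if k = i then 1 / of_nat M else 0)"
    unfolding tr_def sum_idx by (intro sum.cong refl) (auto simp: maxent_def mk_def idx_less)
  ultimately show ?thesis using assms by (simp add: density_def)
qed

section \<open>From the resource state to the channel\<close>

text \<open>Carries a rule for \<open>f\<close> on inputs with a fixed right factor to inputs
  entangled with a reference system \<open>r\<close>; by linearity it is enough to have a product
  with the reference.\<close>

lemma id_tensor_kron_map:
  assumes f: "cpm (m * q) (m' * q') f" and g: "cpm m m' g"
    and fg: "\<And>Y. is_mat m m Y \<Longrightarrow> f (kr m q Y T) = kr m' q' (g Y) T'"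
    and T: "is_mat q q T" and X: "is_mat (r * m) (r * m) X"
  shows "id_tensor r (m * q) (m' * q') f (kr (r * m) q X T) = kr (r * m') q' (id_tensor r m m' g X) T'"
proof (rule lin_ext_kron[OF _ _ _ X])
  have l: "lin (r * m * q) (id_tensor r (m * q) (m' * q') f)"
    using lin_id_tensor[OF cpm_lin[OF f]] by (simp only: mult.assoc)
  show "lin (r * m) (\<lambda>X. id_tensor r (m * q) (m' * q') f (kr (r * m) q X T))"
    by (rule lin_comp[OF lin_kron_left l is_mat_kron])
  show "lin (r * m) (\<lambda>X. kr (r * m') q' (id_tensor r m m' g X) T')"
    by (rule lin_comp[OF lin_id_tensor[OF cpm_lin[OF g]] lin_kron_left is_mat_id_tensor])
  fix A Y assume Y: "is_mat m m Y"
  show "id_tensor r (m * q) (m' * q') f (kr (r * m) q (kr r m A Y) T) = kr (r * m') q' (id_tensor r m m' g (kr r m A Y)) T'"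
    unfolding kron_assoc id_tensor_kron[OF cpm_lin[OF f] is_mat_kron] fg[OF Y] id_tensor_kron[OF cpm_lin[OF g] Y] ..
qed

text \<open>Both sides are linear and density matrices span, so the simulation identity becomes one
  between maps, which can then be tensored with the discriminator's memory.\<close>

lemma tele_simulable_all:
  assumes N: "is_channel (ai * bi) (ao * bo) N" and "tele_simulable N ai bi ao bo la lb \<theta>"
  obtains L where "locc (ai * la) (bi * lb) ao bo L"
    "\<And>X. is_mat (ai * bi) (ai * bi) X \<Longrightarrow> N X = L (bt ai bi la lb X \<theta>)"
proof -
  from assms(2) obtain L where L: "locc (ai * la) (bi * lb) ao bo L"
    and d: "\<And>\<rho>. density (ai * bi) \<rho> \<Longrightarrow> N \<rho> = L (bt ai bi la lb \<rho> \<theta>)" and t: "density (la * lb) \<theta>"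
    unfolding tele_simulable_def by blast
  have "lin (ai * bi) (\<lambda>X. L (bt ai bi la lb X \<theta>))"
    by (rule is_channel_lin[OF is_channel_comp[OF is_channel_kron_right[OF t] is_channel_comp[OF is_channel_swap_mid' locc_channel[OF L]]]])
  from lin_ext_density[OF is_channel_lin[OF N] this d] that[OF L] show ?thesis by blast
qed

text \<open>One simulated use of the channel: the first copy is consumed and \<open>k\<close> counts
  the copies that remain idle.\<close>

definition step :: "nat \<Rightarrow> nat \<Rightarrow> nat \<Rightarrow> nat \<Rightarrow> nat \<Rightarrow> nat \<Rightarrow> (cmat \<Rightarrow> cmat) \<Rightarrow> nat \<Rightarrow> cmat \<Rightarrow> cmat" where
  "step ai bi ao bo la lb L k = liftR (ai * la) (bi * lb) ao bo (la ^ k) (lb ^ k) L"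

lemma locc_step:
  assumes "locc (ai * la) (bi * lb) ao bo L"
  shows "locc (ai * la ^ Suc k) (bi * lb ^ Suc k) (ao * la ^ k) (bo * lb ^ k) (step ai bi ao bo la lb L k)"
  using locc_liftR[OF assms, of "la ^ k" "lb ^ k"] by (simp add: step_def mult.assoc)

lemma is_channel_regrouped:
  assumes "locc (ai * c) (bi * e) (ao * c') (bo * e') L"
  shows "is_channel (ai * bi * (c * e)) (ao * bo * (c' * e')) (\<lambda>X. swap_mid ao c' bo e' (L (swap_mid ai bi c e X)))"
  by (rule is_channel_comp[OF is_channel_swap_mid' is_channel_comp[OF locc_channel[OF assms] is_channel_swap_mid']])

text \<open>Reassociation moves the first copy from the power over to the input; \<open>L\<close>
  turns this pair into the channel output and the other \<open>k\<close> copies pass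
  through.\<close>

lemma step_kron:
  assumes L: "locc (ai * la) (bi * lb) ao bo L" and N: "is_channel (ai * bi) (ao * bo) N"
    and eq: "\<And>X. is_mat (ai * bi) (ai * bi) X \<Longrightarrow> N X = L (bt ai bi la lb X \<theta>)"
    and \<theta>: "is_mat (la * lb) (la * lb) \<theta>" and X: "is_mat (ai * bi) (ai * bi) X"
  shows "swap_mid ao (la ^ k) bo (lb ^ k) (step ai bi ao bo la lb L k
      (bt ai bi (la ^ Suc k) (lb ^ Suc k) X (btpow la lb (Suc k) \<theta>)))
    = kr (ao * bo) (la ^ k * lb ^ k) (N X) (btpow la lb k \<theta>)"
proof -
  have "bt ai bi (la ^ Suc k) (lb ^ Suc k) X (btpow la lb (Suc k) \<theta>)
      = bt (ai * la) (bi * lb) (la ^ k) (lb ^ k) (bt ai bi la lb X \<theta>) (btpow la lb k \<theta>)"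
    unfolding btpow_Suc2 power_Suc by (rule bt_assoc[OF X \<theta> is_mat_btpow])
  moreover have "step ai bi ao bo la lb L k \<dots>
      = bt ao bo (la ^ k) (lb ^ k) (N X) (btpow la lb k \<theta>)"
    unfolding step_def liftR_swap[OF is_mat_kron]
    by (simp add: tensor_id_kron[OF is_channel_lin[OF locc_channel[OF L]]] eq[OF X])
  ultimately show ?thesis by (simp add: swap_mid_inverse')
qed

lemma tdist_tn_bound_states:
  assumes "1 \<le> M" "locc M M (la ^ n) (lb ^ n) L" "density (la * lb) \<theta>"
  shows "tdist (la ^ n * lb ^ n) (L (maxent M)) (btpow la lb n \<theta>) \<le> \<epsilon> \<longleftrightarrow>
    tn_bound (la ^ n * lb ^ n) (\<lambda>i j. L (maxent M) i j - btpow la lb n \<theta> i j) (2 * \<epsilon>)"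
  by (intro tdist_le_iff density_psd density_btpow assms density_channel[OF locc_channel[OF assms(2)]] density_maxent)

lemma density_real_run:
  assumes N: "is_channel (ai * bi) (ao * bo) N" and st: "seq_strategy ai bi ao bo n r \<rho>0 As"
  shows "i < n \<Longrightarrow> density (r i * (ao * bo)) (real_run N ai bi ao bo r \<rho>0 As i)"
proof (induction i)
  case 0
  then show ?case using st density_channel[OF is_channel_id_tensor[OF N]] by (simp add: seq_strategy_def)
next
  case (Suc i)
  then have "is_channel (r i * (ao * bo)) (r (Suc i) * (ai * bi)) (As i)"
    using st by (simp add: seq_strategy_def)
  from density_channel[OF is_channel_comp[OF this is_channel_id_tensor[OF N]]] Suc show ?case by simp
qed

lemma density_sim_run:
  assumes Ls: "\<And>i. i < n \<Longrightarrow> locc (ai * ma i) (bi * mb i) (ao * ma (Suc i)) (bo * mb (Suc i)) (Ls i)"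
    and m0: "ma 0 = M" "mb 0 = M" "1 \<le> M" and st: "seq_strategy ai bi ao bo n r \<rho>0 As"
  shows "i < n \<Longrightarrow> density (r i * (ao * bo) * (ma (Suc i) * mb (Suc i))) (sim_run ai bi ao bo ma mb Ls r \<rho>0 As i)"
proof (induction i)
  case 0
  have "density (r 0 * (ai * bi) * (ma 0 * mb 0)) (kr (r 0 * (ai * bi)) (ma 0 * mb 0) \<rho>0 (maxent (ma 0)))"
    using st m0 density_kron density_maxent by (simp add: seq_strategy_def)
  then show ?case
    using density_channel[OF is_channel_id_tensor[OF is_channel_regrouped[OF Ls[OF 0]]], of "r 0"]
    by (simp add: L_full_def[abs_def] mult.assoc)
next
  case (Suc i)
  then have "is_channel (r i * (ao * bo)) (r (Suc i) * (ai * bi)) (As i)"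
    using st by (simp add: seq_strategy_def)
  from density_channel[OF is_channel_tensor_id[OF this]] Suc
  have "density (r (Suc i) * (ai * bi) * (ma (Suc i) * mb (Suc i)))
      (tensor_id (r i * (ao * bo)) (r (Suc i) * (ai * bi)) (ma (Suc i) * mb (Suc i)) (As i) (sim_run ai bi ao bo ma mb Ls r \<rho>0 As i))"
    by simp
  then show ?case
    using density_channel[OF is_channel_id_tensor[OF is_channel_regrouped[OF Ls[OF Suc.prems]]], of "r (Suc i)"]
    by (simp add: L_full_def[abs_def] mult.assoc)
qed

lemma is_mat_density: "density d X \<Longrightarrow> is_mat d d X"
  by (simp add: density_def psd_def)

lemma seq_code_of_state_code:
  assumes N: "is_channel (ai * bi) (ao * bo) N" and tel: "tele_simulable N ai bi ao bo la lb \<theta>"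
    and pos: "0 < la" "0 < lb" and n: "1 \<le> n" and M: "1 \<le> M"
    and L0: "locc M M (la ^ n) (lb ^ n) L0" and dist: "tdist (la ^ n * lb ^ n) (L0 (maxent M)) (btpow la lb n \<theta>) \<le> \<epsilon>"
  shows "seq_code N ai bi ao bo n M \<epsilon>"
proof -
  obtain L where L: "locc (ai * la) (bi * lb) ao bo L"
    and eq: "\<And>X. is_mat (ai * bi) (ai * bi) X \<Longrightarrow> N X = L (bt ai bi la lb X \<theta>)"
    by (rule tele_simulable_all[OF N tel]) blast
  have \<theta>: "density (la * lb) \<theta>" using tel by (simp add: tele_simulable_def)
  define S where "S = step ai bi ao bo la lb L"
  \<comment> \<open>The simulated use in the order of \<open>sim_run\<close>, channel systems before
    memory, instead of the order of the LOCC cut.\<close>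
  define J where "J k = (\<lambda>X. swap_mid ao (la ^ k) bo (lb ^ k) (S k (swap_mid ai bi (la ^ Suc k) (lb ^ Suc k) X)))" for k
  \<comment> \<open>The memory starts as the maximally entangled state. After \<open>i\<close> uses,
    for \<open>i\<close> at least 1, it holds \<open>n - i\<close> copies, and after the last use it
    is one-dimensional.\<close>
  define ma where "ma i = (if i = 0 then M else la ^ (n - i))" for i
  define mb where "mb i = (if i = 0 then M else lb ^ (n - i))" for i
  \<comment> \<open>Round 0 both creates the \<open>n\<close> copies and consumes one of them; round
    \<open>i\<close> leaves \<open>n - 1 - i\<close> copies behind.\<close>
  define Ls where "Ls i = (if i = 0 then (\<lambda>X. S (n - 1) (liftL ai bi M M (la ^ n) (lb ^ n) L0 X)) else S (n - 1 - i))" for i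
  have locc_S: "locc (ai * la ^ Suc k) (bi * lb ^ Suc k) (ao * la ^ k) (bo * lb ^ k) (S k)" for k
    unfolding S_def by (rule locc_step[OF L])
  have J_channel: "is_channel (ai * bi * (la ^ Suc k * lb ^ Suc k)) (ao * bo * (la ^ k * lb ^ k)) (J k)" for k
    unfolding J_def by (rule is_channel_regrouped[OF locc_S])
  have J_kron: "J k (kr (ai * bi) (la ^ Suc k * lb ^ Suc k) X (btpow la lb (Suc k) \<theta>)) = kr (ao * bo) (la ^ k * lb ^ k) (N X) (btpow la lb k \<theta>)"
    if "is_mat (ai * bi) (ai * bi) X" for k X
    unfolding J_def S_def by (rule step_kron[OF L N eq is_mat_density[OF \<theta>] that])
  have J_kron': "id_tensor s (ai * bi * (la ^ Suc k * lb ^ Suc k)) (ao * bo * (la ^ k * lb ^ k)) (J k)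
      (kr (s * (ai * bi)) (la ^ Suc k * lb ^ Suc k) X (btpow la lb (Suc k) \<theta>))
    = kr (s * (ao * bo)) (la ^ k * lb ^ k) (id_tensor s (ai * bi) (ao * bo) N X) (btpow la lb k \<theta>)"
    if "is_mat (s * (ai * bi)) (s * (ai * bi)) X" for s k X
    by (rule id_tensor_kron_map[OF is_channel_cpm[OF J_channel] is_channel_cpm[OF N] J_kron is_mat_btpow that])
  have Suc_n: "Suc (n - 1) = n" using n by simp
  have locc_Ls: "locc (ai * ma i) (bi * mb i) (ao * ma (Suc i)) (bo * mb (Suc i)) (Ls i)" if "i < n" for i
  proof (cases i)
    case 0
    have "locc (ai * M) (bi * M) (ao * la ^ (n - 1)) (bo * lb ^ (n - 1)) (\<lambda>X. S (n - 1) (liftL ai bi M M (la ^ n) (lb ^ n) L0 X))"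
      by (rule locc_comp[OF locc_liftL[OF L0]]) (use locc_S[of "n - 1"] in \<open>simp only: Suc_n\<close>)
    with 0 show ?thesis by (simp add: ma_def mb_def Ls_def)
  next
    case (Suc j)
    with that have "n - i = Suc (n - 1 - i)" by simp
    with locc_S[of "n - 1 - i"] Suc show ?thesis by (simp add: ma_def mb_def Ls_def)
  qed
  have "tdist (r (n - 1) * (ao * bo)) (real_run N ai bi ao bo r \<rho>0 As (n - 1))
      (ptrace_right (r (n - 1) * (ao * bo)) (ma n * mb n) (sim_run ai bi ao bo ma mb Ls r \<rho>0 As (n - 1))) \<le> \<epsilon>"
    if st: "seq_strategy ai bi ao bo n r \<rho>0 As" for r \<rho>0 As
  proof -
    let ?R = "real_run N ai bi ao bo r \<rho>0 As" and ?Z = "sim_run ai bi ao bo ma mb Ls r \<rho>0 As"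
    have dR: "density (r i * (ao * bo)) (?R i)" if "i < n" for i by (rule density_real_run[OF N st that])
    have dZ: "density (r i * (ao * bo) * (ma (Suc i) * mb (Suc i))) (?Z i)" if "i < n" for i
      by (rule density_sim_run[where ma = ma and mb = mb and Ls = Ls and n = n, OF locc_Ls _ _ M st that])
        (simp_all add: ma_def mb_def)
    have d0: "density (r 0 * (ai * bi)) \<rho>0" using st by (simp add: seq_strategy_def)
    have "tn_bound (r i * (ao * bo) * (la ^ (n - 1 - i) * lb ^ (n - 1 - i)))
        (\<lambda>x y. ?Z i x y - kr (r i * (ao * bo)) (la ^ (n - 1 - i) * lb ^ (n - 1 - i)) (?R i) (btpow la lb (n - 1 - i) \<theta>) x y) (2 * \<epsilon>)"
      if "i < n" for i
      using that
    proof (induction i)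
      case 0
      let ?T = "id_tensor (r 0) (ai * bi * (la ^ n * lb ^ n)) (ao * bo * (la ^ (n - 1) * lb ^ (n - 1))) (J (n - 1))"
      let ?I = "id_tensor (ai * bi) (M * M) (la ^ n * lb ^ n) L0"
      have J1: "is_channel (ai * bi * (la ^ n * lb ^ n)) (ao * bo * (la ^ (n - 1) * lb ^ (n - 1))) (J (n - 1))"
        using J_channel[of "n - 1"] by (simp only: Suc_n)
      \<comment> \<open>Separates round 0 into \<open>L0\<close> on the simulator's memory alone,
        followed by an ordinary simulated use.\<close>
      have full: "L_full ai bi ao bo ma mb Ls 0 X = J (n - 1) (?I X)" if "is_mat (ai * bi * (M * M)) (ai * bi * (M * M)) X" for X
      proof -
        have "L_full ai bi ao bo ma mb Ls 0 X = swap_mid ao (la ^ (n - 1)) bo (lb ^ (n - 1))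
            (S (n - 1) (liftL ai bi M M (la ^ n) (lb ^ n) L0 (swap_mid ai bi M M X)))"
          by (simp add: L_full_def ma_def mb_def Ls_def)
        then show ?thesis unfolding liftL_swap[OF that] J_def Suc_n .
      qed
      have dm: "is_mat (M * M) (M * M) (maxent M)" by (rule is_mat_density[OF density_maxent[OF M]])
      let ?K = "kr (r 0 * (ai * bi)) (M * M) \<rho>0 (maxent M)"
      have K: "is_mat (r 0 * (ai * bi * (M * M))) (r 0 * (ai * bi * (M * M))) ?K"
        using is_mat_kron[of "r 0 * (ai * bi)" "M * M" "r 0 * (ai * bi)" "M * M" \<rho>0 "maxent M"] by (simp only: mult.assoc)
      have I: "is_channel (ai * bi * (M * M)) (ai * bi * (la ^ n * lb ^ n)) ?I"
        by (rule is_channel_id_tensor[OF locc_channel[OF L0]])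
      have "?Z 0 = id_tensor (r 0) (ai * bi * (M * M)) (ao * bo * (la ^ (n - 1) * lb ^ (n - 1))) (L_full ai bi ao bo ma mb Ls 0) ?K"
        by (simp add: ma_def mb_def)
      also have "\<dots> = id_tensor (r 0) (ai * bi * (M * M)) (ao * bo * (la ^ (n - 1) * lb ^ (n - 1))) (\<lambda>X. J (n - 1) (?I X)) ?K"
        by (rule id_tensor_cong) (rule full)
      also have "\<dots> = ?T (id_tensor (r 0) (ai * bi * (M * M)) (ai * bi * (la ^ n * lb ^ n)) ?I ?K)"
        by (rule id_tensor_comp[OF is_channel_cpm[OF I] is_channel_cpm[OF J1] K, symmetric])
      also have "id_tensor (r 0) (ai * bi * (M * M)) (ai * bi * (la ^ n * lb ^ n)) ?I ?K
          = id_tensor (r 0 * (ai * bi)) (M * M) (la ^ n * lb ^ n) L0 ?K"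
        by (rule id_tensor_assoc[OF is_channel_cpm[OF locc_channel[OF L0]] is_mat_kron, symmetric])
      also have "\<dots> = kr (r 0 * (ai * bi)) (la ^ n * lb ^ n) \<rho>0 (L0 (maxent M))"
        by (rule id_tensor_kron[OF is_channel_lin[OF locc_channel[OF L0]] dm])
      finally have Z0: "?Z 0 = ?T (kr (r 0 * (ai * bi)) (la ^ n * lb ^ n) \<rho>0 (L0 (maxent M)))" .
      have R0: "kr (r 0 * (ao * bo)) (la ^ (n - 1) * lb ^ (n - 1)) (?R 0) (btpow la lb (n - 1) \<theta>)
          = ?T (kr (r 0 * (ai * bi)) (la ^ n * lb ^ n) \<rho>0 (btpow la lb n \<theta>))"
        using J_kron'[OF is_mat_density[OF d0], of "n - 1"] by (simp only: Suc_n real_run.simps)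
      have T: "is_channel (r 0 * (ai * bi) * (la ^ n * lb ^ n)) (r 0 * (ao * bo) * (la ^ (n - 1) * lb ^ (n - 1))) ?T"
        using is_channel_id_tensor[OF J1, of "r 0"] by (simp only: mult.assoc)
      \<comment> \<open>The error enters here once; from now on the simulated and the ideal state
        undergo the same channels.\<close>
      have "tn_bound (la ^ n * lb ^ n) (\<lambda>i j. L0 (maxent M) i j - btpow la lb n \<theta> i j) (2 * \<epsilon>)"
        using dist tdist_tn_bound_states[OF M L0 \<theta>] by simp
      from tn_bound_channel_diff[OF is_channel_comp[OF is_channel_kron_left[OF d0] T] is_channel_is_mat[OF locc_channel[OF L0] dm] is_mat_btpow this]
      have "tn_bound (r 0 * (ao * bo) * (la ^ (n - 1) * lb ^ (n - 1)))
        (\<lambda>x y. ?Z 0 x y - kr (r 0 * (ao * bo)) (la ^ (n - 1) * lb ^ (n - 1)) (?R 0) (btpow la lb (n - 1) \<theta>) x y) (2 * \<epsilon>)"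
        unfolding Z0 R0 .
      then show ?case by simp
    next
      case (Suc i)
      define k where "k = n - 1 - Suc i"
      have k: "n - 1 - i = Suc k" "n - Suc i = Suc k" "n - Suc (Suc i) = k" "n - 1 - Suc i = k"
        using Suc.prems by (simp_all add: k_def)
      have A: "is_channel (r i * (ao * bo)) (r (Suc i) * (ai * bi)) (As i)"
        using st Suc.prems by (simp add: seq_strategy_def)
      let ?q = "la ^ Suc k * lb ^ Suc k" and ?q' = "la ^ k * lb ^ k"
      let ?A = "tensor_id (r i * (ao * bo)) (r (Suc i) * (ai * bi)) ?q (As i)"
      let ?T = "id_tensor (r (Suc i)) (ai * bi * ?q) (ao * bo * ?q') (J k)"
      have full: "L_full ai bi ao bo ma mb Ls (Suc i) = J k"
        using k by (simp add: L_full_def[abs_def] ma_def mb_def Ls_def J_def del: power_Suc)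
      have m: "ma (Suc i) * mb (Suc i) = ?q" "ma (Suc (Suc i)) * mb (Suc (Suc i)) = ?q'"
        by (simp_all only: ma_def mb_def k) simp_all
      have Z: "?Z (Suc i) = ?T (?A (?Z i))"
        by (simp only: sim_run.simps full m)
      \<comment> \<open>With exact copies the simulated use performs \<open>N\<close> and removes
        one copy, so the ideal state evolves under the very maps that drive the simulated
        one.\<close>
      have R: "kr (r (Suc i) * (ao * bo)) ?q' (?R (Suc i)) (btpow la lb k \<theta>)
          = ?T (?A (kr (r i * (ao * bo)) ?q (?R i) (btpow la lb (Suc k) \<theta>)))"
      proof -
        have Ri: "is_mat (r i * (ao * bo)) (r i * (ao * bo)) (?R i)"
          using dR[of i] Suc.prems by (intro is_mat_density) simp
        show ?thesis
          unfolding tensor_id_kron[OF is_channel_lin[OF A] Ri] J_kron'[OF is_channel_is_mat[OF A Ri]] by simp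
      qed
      have T: "is_channel (r (Suc i) * (ai * bi) * ?q) (r (Suc i) * (ao * bo) * ?q') ?T"
        using is_channel_id_tensor[OF J_channel[of k], of "r (Suc i)"] by (simp only: mult.assoc)
      have mZ: "is_mat (r i * (ao * bo) * ?q) (r i * (ao * bo) * ?q) (?Z i)"
        using dZ[of i] Suc.prems unfolding m by (intro is_mat_density) simp
      have "tn_bound (r i * (ao * bo) * ?q)
        (\<lambda>x y. ?Z i x y - kr (r i * (ao * bo)) ?q (?R i) (btpow la lb (Suc k) \<theta>) x y) (2 * \<epsilon>)"
        using Suc.IH Suc.prems unfolding k(1) by simp
      from tn_bound_channel_diff[OF is_channel_comp[OF is_channel_tensor_id[OF A] T] mZ is_mat_kron this]
      show ?case unfolding k(4) Z R .
    qed
    \<comment> \<open>No copy is left after the last use: the zeroth power is the 1 by 1 identity,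
      and tracing out the memory returns the real state.\<close>
    from this[of "n - 1"] n have *: "tn_bound (r (n - 1) * (ao * bo) * 1)
        (\<lambda>x y. ?Z (n - 1) x y - kr (r (n - 1) * (ao * bo)) 1 (?R (n - 1)) (idm 1) x y) (2 * \<epsilon>)"
      by (simp add: btpow_0)
    have m1: "ma n = 1" "mb n = 1" using n by (simp_all add: ma_def mb_def)
    have n1: "n - 1 < n" using n by simp
    have dZn: "density (r (n - 1) * (ao * bo) * 1) (?Z (n - 1))"
      using dZ[OF n1] unfolding Suc_n m1 by simp
    have pR: "ptrace_right (r (n - 1) * (ao * bo)) 1 (kr (r (n - 1) * (ao * bo)) 1 (?R (n - 1)) (idm 1)) = ?R (n - 1)"
      unfolding ptrace_right_kron[OF is_mat_density[OF dR[OF n1]]] by (simp add: tr_def idm_def mk_def)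
    from tn_bound_channel_diff[OF is_channel_ptrace_right is_mat_density[OF dZn] is_mat_kron *]
    have "tn_bound (r (n - 1) * (ao * bo)) (\<lambda>x y. ptrace_right (r (n - 1) * (ao * bo)) 1 (?Z (n - 1)) x y - ?R (n - 1) x y) (2 * \<epsilon>)"
      unfolding pR .
    moreover have "density (r (n - 1) * (ao * bo)) (ptrace_right (r (n - 1) * (ao * bo)) 1 (?Z (n - 1)))"
      by (rule density_channel[OF is_channel_ptrace_right dZn])
    ultimately show ?thesis
      unfolding m1 using tdist_le_iff[OF density_psd[OF dR[OF n1]] density_psd] tn_bound_minus by simp
  qed
  \<comment> \<open>Beyond index \<open>n\<close> truncated subtraction gives exponent 0 and
    dimension 1, so positivity holds at every index.\<close>
  moreover have "\<forall>i. 0 < ma i \<and> 0 < mb i" using pos M by (auto simp: ma_def mb_def)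
  ultimately show ?thesis
    unfolding seq_code_def using n locc_Ls
    by (intro conjI exI[of _ ma] exI[of _ mb] exI[of _ Ls]) (auto simp: ma_def mb_def)
qed

section \<open>From the channel to the resource state\<close>

lemma ptrace_right_tensor_id:
  assumes f: "cpm m m' f" and X: "is_mat (m * s) (m * s) X"
  shows "ptrace_right m' s (tensor_id m m' s f X) = f (ptrace_right m s X)"
proof (rule lin_ext_kron[OF _ _ _ X])
  show "lin (m * s) (\<lambda>X. ptrace_right m' s (tensor_id m m' s f X))"
    by (rule lin_comp[OF lin_tensor_id[OF cpm_lin[OF f]] lin_ptrace_right is_mat_tensor_id])
  show "lin (m * s) (\<lambda>X. f (ptrace_right m s X))"
    by (rule lin_comp[OF lin_ptrace_right cpm_lin[OF f] is_mat_ptrace_right])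
  fix A B assume A: "is_mat m m A"
  show "ptrace_right m' s (tensor_id m m' s f (kr m s A B)) = f (ptrace_right m s (kr m s A B))"
    unfolding tensor_id_kron[OF cpm_lin[OF f] A] ptrace_right_kron[OF A] ptrace_right_kron[OF cpm_is_mat[OF f A]]
    by (rule lin_scaleD[OF cpm_lin[OF f] A, symmetric])
qed

text \<open>\<open>N\<close> does not touch the reference systems, so Bob may move his in front of
  his channel input before the use and back after the output. With both references in front, the use
  takes the form of a single \<open>id_tensor\<close>.\<close>

lemma flip_systems_commute:
  assumes N: "cpm (ai * bi) (ao * bo) N" and X: "is_mat (am * ai * (bi * bm)) (am * ai * (bi * bm)) X"
  shows "id_tensor (am * ao) (bm * bo) (bo * bm) (flip bm bo) (swap_mid am bm ao bo
      (id_tensor (am * bm) (ai * bi) (ao * bo) N (swap_mid am ai bm bi (id_tensor (am * ai) (bi * bm) (bm * bi) (flip bi bm) X))))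
    = id_tensor am (ai * bi * bm) (ao * bo * bm) (tensor_id (ai * bi) (ao * bo) bm N) X"
    (is "?F X = ?G X")
proof -
  note fl = is_channel_flip and flin = is_channel_lin[OF is_channel_flip]
  have F: "lin (am * ai * (bi * bm)) ?F"
    by (rule cpm_lin[OF cpm_comp[OF is_channel_cpm[OF is_channel_id_tensor[OF fl]]
        cpm_comp[OF is_channel_cpm[OF is_channel_swap_mid'] cpm_comp[OF cpm_id_tensor[OF N]
        cpm_comp[OF is_channel_cpm[OF is_channel_swap_mid'] is_channel_cpm[OF is_channel_id_tensor[OF fl]]]]]]])
  have G: "lin (am * ai * (bi * bm)) ?G"
    using lin_id_tensor[OF lin_tensor_id[OF cpm_lin[OF N]]] by (simp only: mult.assoc)
  let ?K = "\<lambda>P Q Y. id_tensor (am * ao) (bm * bo) (bo * bm) (flip bm bo) (swap_mid am bm ao bo (kr (am * bm) (ao * bo) (kr am bm P Q) Y))"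
  have last: "?K P Q Y
      = kr am (ao * bo * bm) P (kr (ao * bo) bm Y Q)"
    if P: "is_mat am am P" and Q: "is_mat bm bm Q" and Y: "is_mat (ao * bo) (ao * bo) Y" for P Q Y
  proof (rule lin_ext_kron[OF _ _ _ Y])
    show "lin (ao * bo) (?K P Q)"
      by (rule lin_comp[OF lin_kron_right is_channel_lin[OF is_channel_comp[OF is_channel_swap_mid' is_channel_id_tensor[OF fl]]] is_mat_kron])
    show "lin (ao * bo) (\<lambda>Y. kr am (ao * bo * bm) P (kr (ao * bo) bm Y Q))"
      by (rule lin_comp[OF lin_kron_left lin_kron_right is_mat_kron])
    fix C D assume "is_mat ao ao C" "is_mat bo bo D"
    then show "?K P Q (kr ao bo C D)
        = kr am (ao * bo * bm) P (kr (ao * bo) bm (kr ao bo C D) Q)"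
      using Q by (simp add: swap_mid_kron id_tensor_kron flin flip_kron) (simp only: kron_assoc mult.assoc)
  qed
  show ?thesis
  proof (rule lin_ext_kron4[OF F G _ X])
    fix P A B Q assume m: "is_mat am am P" "is_mat ai ai A" "is_mat bi bi B" "is_mat bm bm Q"
    have Y: "is_mat (ao * bo) (ao * bo) (N (kr ai bi A B))" by (rule cpm_is_mat[OF N is_mat_kron])
    have "?F (kr (am * ai) (bi * bm) (kr am ai P A) (kr bi bm B Q)) = kr am (ao * bo * bm) P (kr (ao * bo) bm (N (kr ai bi A B)) Q)"
      using m by (simp add: id_tensor_kron flin flip_kron swap_mid_kron cpm_lin[OF N] last[OF m(1,4) Y])
    moreover have "?G (kr am (ai * bi * bm) P (kr (ai * bi) bm (kr ai bi A B) Q)) = kr am (ao * bo * bm) P (kr (ao * bo) bm (N (kr ai bi A B)) Q)"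
      by (simp add: id_tensor_kron tensor_id_kron lin_tensor_id cpm_lin[OF N])
    ultimately show "?F (kr (am * ai) (bi * bm) (kr am ai P A) (kr bi bm B Q)) = ?G (kr (am * ai) (bi * bm) (kr am ai P A) (kr bi bm B Q))"
      by (simp only: kron_assoc mult.assoc)
  qed
qed

lemma separable_id_tensor:
  assumes "separable a b \<rho>" and f: "is_channel b b' f"
  shows "separable a b' (id_tensor a b b' f \<rho>)"
proof -
  obtain k :: nat and p \<sigma> \<tau> where p: "\<And>i. i < k \<Longrightarrow> 0 \<le> p i"
    and \<sigma>: "\<And>i. i < k \<Longrightarrow> density a (\<sigma> i)" and \<tau>: "\<And>i. i < k \<Longrightarrow> density b (\<tau> i)"
    and p1: "(\<Sum>i<k. p i) = 1"
    and \<rho>: "\<rho> = (\<lambda>x y. \<Sum>i<k. complex_of_real (p i) * kr a b (\<sigma> i) (\<tau> i) x y)"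
    by (rule separable_eq[OF assms(1)]) blast
  have "id_tensor a b b' f \<rho> = (\<lambda>x y. \<Sum>i<k. complex_of_real (p i) * id_tensor a b b' f (kr a b (\<sigma> i) (\<tau> i)) x y)"
    unfolding \<rho> by (rule lin_sum[OF lin_id_tensor[OF is_channel_lin[OF f]]]) simp_all
  also have "\<dots> = (\<lambda>x y. \<Sum>i<k. complex_of_real (p i) * kr a b' (\<sigma> i) (f (\<tau> i)) x y)"
    by (intro ext sum.cong refl)
      (simp add: id_tensor_kron[OF is_channel_lin[OF f] is_mat_density[OF \<tau>]])
  also have "\<dots> = mk (a * b') (a * b') (\<lambda>x y. \<Sum>i<k. complex_of_real (p i) * kr a b' (\<sigma> i) (f (\<tau> i)) x y)"
    by (rule is_mat_eqI[of "a * b'" "a * b'"]) (simp_all add: is_mat_sum is_mat_scale, simp add: mk_def)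
  finally show ?thesis
    unfolding separable_def using p \<sigma> p1 density_channel[OF f \<tau>]
    by (intro exI[of _ k] exI[of _ p] exI[of _ \<sigma>] exI[of _ "\<lambda>i. f (\<tau> i)"]) simp
qed

text \<open>Puts Bob's reference system before his channel system, as it is for Alice.\<close>
lemma resource_seizable_aligned:
  assumes N: "is_channel (ai * bi) (ao * bo) N" and "resource_seizable N ai bi ao bo la lb \<theta>"
  obtains am bm \<rho> D where "0 < am" "0 < bm" "separable (am * ai) (bm * bi) \<rho>" "locc (am * ao) (bm * bo) la lb D"
    "D (swap_mid am bm ao bo (id_tensor (am * bm) (ai * bi) (ao * bo) N (swap_mid am ai bm bi \<rho>))) = \<theta>"
proof -
  from assms(2) obtain am bm \<rho> D where pos: "0 < am" "0 < bm" and \<rho>: "separable (am * ai) (bi * bm) \<rho>"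
    and D: "locc (am * ao) (bo * bm) la lb D"
    and \<theta>: "D (id_tensor am (ai * bi * bm) (ao * bo * bm) (tensor_id (ai * bi) (ao * bo) bm N) \<rho>) = \<theta>"
    unfolding resource_seizable_def by blast
  have m: "is_mat (am * ai * (bi * bm)) (am * ai * (bi * bm)) \<rho>"
    using \<rho> by (auto simp: separable_def)
  show ?thesis
  proof (rule that[OF pos separable_id_tensor[OF \<rho> is_channel_flip] locc_comp[OF locc_local_bob[OF is_channel_flip] D]])
    show "D (id_tensor (am * ao) (bm * bo) (bo * bm) (flip bm bo) (swap_mid am bm ao bo (id_tensor (am * bm) (ai * bi) (ao * bo) N
        (swap_mid am ai bm bi (id_tensor (am * ai) (bi * bm) (bm * bi) (flip bi bm) \<rho>))))) = \<theta>"
      unfolding flip_systems_commute[OF is_channel_cpm[OF N] m] by (rule \<theta>)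
  qed
qed

text \<open>Stored copies \<open>T\<close> and the references of the new input together form the
  discriminator's memory. \<open>N\<close> acts on none of them, so \<open>T\<close> remains a
  tensor factor and only the part that comes from \<open>\<rho>\<close> changes.\<close>

lemma channel_on_fresh_input:
  assumes N: "is_channel (ai * bi) (ao * bo) N" and T: "is_mat (t1 * t2) (t1 * t2) T"
    and \<rho>: "is_mat (am * ai * (bm * bi)) (am * ai * (bm * bi)) \<rho>"
  shows "swap_mid (t1 * am) (t2 * bm) ao bo (id_tensor (t1 * am * (t2 * bm)) (ai * bi) (ao * bo) N
      (swap_mid (t1 * am) ai (t2 * bm) bi (bt t1 t2 (am * ai) (bm * bi) T \<rho>)))
    = bt t1 t2 (am * ao) (bm * bo) T (swap_mid am bm ao bo (id_tensor (am * bm) (ai * bi) (ao * bo) N (swap_mid am ai bm bi \<rho>)))"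
proof -
  let ?V = "swap_mid am ai bm bi \<rho>"
  let ?W = "id_tensor (am * bm) (ai * bi) (ao * bo) N ?V"
  let ?sw = "swap_mid t1 t2 am bm"
  have V: "is_mat (am * bm * (ai * bi)) (am * bm * (ai * bi)) ?V" by (rule is_mat_swap_mid')
  have V\<rho>: "swap_mid am bm ai bi ?V = \<rho>" by (rule swap_mid_inverse'[OF \<rho>])
  have Z: "is_mat (t1 * t2 * (am * bm) * (x * y)) (t1 * t2 * (am * bm) * (x * y)) (kr (t1 * t2) (am * bm * (x * y)) T Y)" for x y Y
    using is_mat_kron[of "t1 * t2" "am * bm * (x * y)" "t1 * t2" "am * bm * (x * y)" T Y] by (simp only: mult.assoc)
  \<comment> \<open>Writes the product across the cut as a regrouping of the memory alone, followed
    by the swap with the channel systems \<open>x\<close>, \<open>y\<close>.\<close>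
  have sw_in: "bt t1 t2 (am * x) (bm * y) T (swap_mid am bm x y Y)
      = swap_mid (t1 * am) (t2 * bm) x y (tensor_id (t1 * t2 * (am * bm)) (t1 * am * (t2 * bm)) (x * y) ?sw (kr (t1 * t2) (am * bm * (x * y)) T Y))"
    if "is_mat (am * bm * (x * y)) (am * bm * (x * y)) Y" for x y Y
    using swap_mid_assoc[OF Z, of x y Y] by (simp add: id_tensor_kron[OF lin_swap_mid that])
  let ?TV = "kr (t1 * t2) (am * bm * (ai * bi)) T ?V"
  have 1: "swap_mid (t1 * am) ai (t2 * bm) bi (bt t1 t2 (am * ai) (bm * bi) T \<rho>)
      = tensor_id (t1 * t2 * (am * bm)) (t1 * am * (t2 * bm)) (ai * bi) ?sw ?TV"
    using sw_in[OF V] unfolding V\<rho> by (simp add: swap_mid_inverse'[OF is_mat_tensor_id])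
  \<comment> \<open>The regrouping concerns memory only and hence commutes with the channel
    use.\<close>
  have 2: "id_tensor (t1 * am * (t2 * bm)) (ai * bi) (ao * bo) N
        (tensor_id (t1 * t2 * (am * bm)) (t1 * am * (t2 * bm)) (ai * bi) ?sw ?TV)
      = tensor_id (t1 * t2 * (am * bm)) (t1 * am * (t2 * bm)) (ao * bo) ?sw
          (id_tensor (t1 * t2 * (am * bm)) (ai * bi) (ao * bo) N ?TV)"
    by (rule id_tensor_tensor_id_commute[OF is_channel_cpm[OF is_channel_swap_mid'] is_channel_cpm[OF N] Z])
  have "id_tensor (t1 * t2 * (am * bm)) (ai * bi) (ao * bo) N ?TV
      = id_tensor (t1 * t2) (am * bm * (ai * bi)) (am * bm * (ao * bo)) (id_tensor (am * bm) (ai * bi) (ao * bo) N) ?TV"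
    by (rule id_tensor_assoc[OF is_channel_cpm[OF N] Z])
  then have 3: "id_tensor (t1 * t2 * (am * bm)) (ai * bi) (ao * bo) N ?TV = kr (t1 * t2) (am * bm * (ao * bo)) T ?W"
    by (simp only: id_tensor_kron[OF is_channel_lin[OF is_channel_id_tensor[OF N]] V])
  show ?thesis
    unfolding 1 2 3 by (rule sw_in[symmetric]) (rule is_mat_id_tensor)
qed

text \<open>Regroups three bipartite systems so that Alice's parts come first; for a state of
  \<open>sim_run\<close> they are the discriminator's memory, the channel output and the simulator's memory.\<close>
definition grouped :: "nat \<Rightarrow> nat \<Rightarrow> nat \<Rightarrow> nat \<Rightarrow> nat \<Rightarrow> nat \<Rightarrow> cmat \<Rightarrow> cmat" where
  "grouped a b c d e f Z =
    swap_mid a b (c * e) (d * f) (id_tensor (a * b) (c * d * (e * f)) (c * e * (d * f)) (swap_mid c d e f) Z)"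

text \<open>The definition joins the last two systems first, which suits a round of the simulator;
  this form joins the first two, which suits a step of the discriminator.\<close>

lemma grouped_alt:
  "is_mat (a * b * (c * d) * (e * f)) (a * b * (c * d) * (e * f)) Z \<Longrightarrow>
    grouped a b c d e f Z = swap_mid (a * c) (b * d) e f (tensor_id (a * b * (c * d)) (a * c * (b * d)) (e * f) (swap_mid a b c d) Z)"
  unfolding grouped_def by (rule swap_mid_assoc)

text \<open>The swaps around the simulator's map cancel against those of \<open>grouped\<close>, and
  what remains is the LOCC map itself beside the idle memory \<open>a\<close>, \<open>b\<close> of
  the discriminator.\<close>

lemma grouped_simulation_step:
  assumes L: "locc (ai * e) (bi * f) (ao * e') (bo * f') L"
    and Y: "is_mat (a * b * (ai * bi * (e * f))) (a * b * (ai * bi * (e * f))) Y"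
  shows "grouped a b ao bo e' f' (id_tensor (a * b) (ai * bi * (e * f)) (ao * bo * (e' * f'))
      (\<lambda>X. swap_mid ao e' bo f' (L (swap_mid ai bi e f X))) Y)
    = liftL a b (ai * e) (bi * f) (ao * e') (bo * f') L (grouped a b ai bi e f Y)"
proof -
  let ?J = "\<lambda>X. swap_mid ao e' bo f' (L (swap_mid ai bi e f X))"
  have L': "cpm (ai * e * (bi * f)) (ao * e' * (bo * f')) L" by (rule is_channel_cpm[OF locc_channel[OF L]])
  have sw: "cpm (a * b * (c * d)) (a * c * (b * d)) (swap_mid a b c d)" for a b c d
    by (rule is_channel_cpm[OF is_channel_swap_mid'])
  have J: "cpm (ai * bi * (e * f)) (ao * bo * (e' * f')) ?J"
    by (rule cpm_comp[OF sw cpm_comp[OF L' sw]])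
  have "id_tensor (a * b) (ao * bo * (e' * f')) (ao * e' * (bo * f')) (swap_mid ao bo e' f')
        (id_tensor (a * b) (ai * bi * (e * f)) (ao * bo * (e' * f')) ?J Y)
      = id_tensor (a * b) (ai * bi * (e * f)) (ao * e' * (bo * f')) (\<lambda>X. swap_mid ao bo e' f' (?J X)) Y"
    by (rule id_tensor_comp[OF J sw Y])
  also have "\<dots> = id_tensor (a * b) (ai * bi * (e * f)) (ao * e' * (bo * f')) (\<lambda>X. L (swap_mid ai bi e f X)) Y"
    by (rule id_tensor_cong) (rule swap_mid_inverse'[OF cpm_is_mat[OF L' is_mat_swap_mid']])
  also have "\<dots> = id_tensor (a * b) (ai * e * (bi * f)) (ao * e' * (bo * f')) L
      (id_tensor (a * b) (ai * bi * (e * f)) (ai * e * (bi * f)) (swap_mid ai bi e f) Y)"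
    by (rule id_tensor_comp[OF sw L' Y, symmetric])
  finally show ?thesis
    unfolding grouped_def by (simp only: liftL_swap[OF is_mat_id_tensor])
qed

text \<open>The counterpart for a discriminator that respects the cut: its swaps cancel in the other
  form of \<open>grouped\<close>, and the simulator's memory \<open>e\<close>, \<open>f\<close> is
  idle.\<close>

lemma grouped_strategy_step:
  assumes B: "locc (a * c) (b * d) (a' * c') (b' * d') B"
    and W: "is_mat (a * b * (c * d) * (e * f)) (a * b * (c * d) * (e * f)) W"
  shows "grouped a' b' c' d' e f (tensor_id (a * b * (c * d)) (a' * b' * (c' * d')) (e * f)
      (\<lambda>X. swap_mid a' c' b' d' (B (swap_mid a b c d X))) W)
    = liftR (a * c) (b * d) (a' * c') (b' * d') e f B (grouped a b c d e f W)"
proof -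
  let ?A = "\<lambda>X. swap_mid a' c' b' d' (B (swap_mid a b c d X))"
  have B': "cpm (a * c * (b * d)) (a' * c' * (b' * d')) B" by (rule is_channel_cpm[OF locc_channel[OF B]])
  have sw: "cpm (a * b * (c * d)) (a * c * (b * d)) (swap_mid a b c d)" for a b c d
    by (rule is_channel_cpm[OF is_channel_swap_mid'])
  have A: "cpm (a * b * (c * d)) (a' * b' * (c' * d')) ?A"
    by (rule cpm_comp[OF sw cpm_comp[OF B' sw]])
  have "tensor_id (a' * b' * (c' * d')) (a' * c' * (b' * d')) (e * f) (swap_mid a' b' c' d')
        (tensor_id (a * b * (c * d)) (a' * b' * (c' * d')) (e * f) ?A W)
      = tensor_id (a * b * (c * d)) (a' * c' * (b' * d')) (e * f) (\<lambda>X. swap_mid a' b' c' d' (?A X)) W"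
    by (rule tensor_id_comp[OF A sw W])
  also have "\<dots> = tensor_id (a * b * (c * d)) (a' * c' * (b' * d')) (e * f) (\<lambda>X. B (swap_mid a b c d X)) W"
    by (rule tensor_id_cong) (rule swap_mid_inverse'[OF cpm_is_mat[OF B' is_mat_swap_mid']])
  also have "\<dots> = tensor_id (a * c * (b * d)) (a' * c' * (b' * d')) (e * f) B
      (tensor_id (a * b * (c * d)) (a * c * (b * d)) (e * f) (swap_mid a b c d) W)"
    by (rule tensor_id_comp[OF sw B' W, symmetric])
  finally show ?thesis
    by (simp only: grouped_alt[OF is_mat_tensor_id] grouped_alt[OF W] liftR_swap[OF is_mat_tensor_id])
qed

text \<open>Preparing the state next to a trivial one-dimensional system is an LOCC channel applied
  to a density matrix.\<close>

lemma separable_density: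
  assumes "separable c e \<rho>"
  shows "density (c * e) \<rho>"
proof -
  have "is_mat (c * e) (c * e) \<rho>" using assms by (auto simp: separable_def)
  then have "bt 1 1 c e (idm 1) \<rho> = \<rho>" by (rule bt_one_left)
  then show ?thesis
    using density_channel[OF locc_channel[OF locc_prepare_right[OF assms, of 1 1]], of "idm 1"] density_idm1
    by simp
qed

lemma state_code_of_seq_code:
  assumes N: "is_channel (ai * bi) (ao * bo) N" and sz: "resource_seizable N ai bi ao bo la lb \<theta>"
    and \<theta>: "density (la * lb) \<theta>" and pos: "0 < la" "0 < lb" and M: "1 \<le> M"
    and code: "seq_code N ai bi ao bo n M \<epsilon>"
  shows "\<exists>L. locc M M (la ^ n) (lb ^ n) L \<and> tdist (la ^ n * lb ^ n) (L (maxent M)) (btpow la lb n \<theta>) \<le> \<epsilon>"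
proof -
  obtain am bm \<rho> D where am: "0 < am" "0 < bm" and \<rho>: "separable (am * ai) (bm * bi) \<rho>"
    and D: "locc (am * ao) (bm * bo) la lb D"
    and D\<theta>: "D (swap_mid am bm ao bo (id_tensor (am * bm) (ai * bi) (ao * bo) N (swap_mid am ai bm bi \<rho>))) = \<theta>"
    by (rule resource_seizable_aligned[OF N sz]) blast
  from code obtain ma mb Ls where n: "1 \<le> n" and m0: "ma 0 = M" "mb 0 = M"
    and Ls: "\<And>i. i < n \<Longrightarrow> locc (ai * ma i) (bi * mb i) (ao * ma (Suc i)) (bo * mb (Suc i)) (Ls i)"
    and dist: "\<And>r \<rho>0 As. seq_strategy ai bi ao bo n r \<rho>0 As \<Longrightarrow> tdist (r (n - 1) * (ao * bo))
             (real_run N ai bi ao bo r \<rho>0 As (n - 1))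
             (ptrace_right (r (n - 1) * (ao * bo)) (ma n * mb n) (sim_run ai bi ao bo ma mb Ls r \<rho>0 As (n - 1))) \<le> \<epsilon>"
    unfolding seq_code_def by blast
  define \<omega> where "\<omega> = swap_mid am bm ao bo (id_tensor (am * bm) (ai * bi) (ao * bo) N (swap_mid am ai bm bi \<rho>))"
  \<comment> \<open>In round \<open>i\<close> each party stores its share of \<open>i\<close>
    finished copies and its reference of the seizing input in use.\<close>
  define ra where "ra i = la ^ i * am" for i
  define rb where "rb i = lb ^ i * bm" for i
  \<comment> \<open>Seizes a copy from the latest output and leaves it as the last of now
    \<open>i + 1\<close> stored copies.\<close>
  define E where "E i = liftL (la ^ i) (lb ^ i) (am * ao) (bm * bo) la lb D" for i
  \<comment> \<open>The discriminator's step as an LOCC map: seize, then prepare the next separable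
    input; \<open>As\<close> is the same step in the order of \<open>real_run\<close>.\<close>
  define B where "B i = (\<lambda>X. bt (la ^ Suc i) (lb ^ Suc i) (am * ai) (bm * bi) (E i X) \<rho>)" for i
  define As where "As i = (\<lambda>X. swap_mid (ra (Suc i)) ai (rb (Suc i)) bi (B i (swap_mid (ra i) (rb i) ao bo X)))" for i
  define r where "r i = ra i * rb i" for i
  define \<rho>0 where "\<rho>0 = swap_mid am ai bm bi \<rho>"
  have d\<rho>: "density (am * ai * (bm * bi)) \<rho>" by (rule separable_density[OF \<rho>])
  have m\<rho>: "is_mat (am * ai * (bm * bi)) (am * ai * (bm * bi)) \<rho>" by (rule is_mat_density[OF d\<rho>])
  have E: "locc (ra i * ao) (rb i * bo) (la ^ Suc i) (lb ^ Suc i) (E i)" for i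
    using locc_liftL[OF D, of "la ^ i" "lb ^ i"]
    unfolding E_def ra_def rb_def power_Suc2 by (simp only: mult.assoc)
  have B: "locc (ra i * ao) (rb i * bo) (ra (Suc i) * ai) (rb (Suc i) * bi) (B i)" for i
    using locc_comp[OF E locc_prepare_right[OF \<rho>], of i]
    unfolding B_def ra_def rb_def by (simp only: mult.assoc)
  have As: "is_channel (r i * (ao * bo)) (r (Suc i) * (ai * bi)) (As i)" for i
    unfolding As_def r_def
    by (rule is_channel_comp[OF is_channel_swap_mid' is_channel_comp[OF locc_channel[OF B] is_channel_swap_mid']])
  have r0: "ra 0 = am" "rb 0 = bm" by (simp_all add: ra_def rb_def)
  have st: "seq_strategy ai bi ao bo n r \<rho>0 As"
    unfolding seq_strategy_def
  proof (intro conjI allI impI)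
    show "0 < r i" for i using pos am by (simp add: r_def ra_def rb_def)
    show "density (r 0 * (ai * bi)) \<rho>0"
      unfolding r_def r0 \<rho>0_def by (rule density_channel[OF is_channel_swap_mid' d\<rho>])
    show "is_channel (r i * (ao * bo)) (r (Suc i) * (ai * bi)) (As i)" for i by (rule As)
  qed
  let ?R = "real_run N ai bi ao bo r \<rho>0 As" and ?Z = "sim_run ai bi ao bo ma mb Ls r \<rho>0 As"
  have E_\<omega>: "E i (bt (la ^ i) (lb ^ i) (am * ao) (bm * bo) (btpow la lb i \<theta>) \<omega>) = btpow la lb (Suc i) \<theta>" for i
  proof -
    have "is_mat (am * ao * (bm * bo)) (am * ao * (bm * bo)) \<omega>" unfolding \<omega>_def by (rule is_mat_swap_mid')
    then show ?thesis
      unfolding E_def liftL_swap[OF is_mat_kron] btpow_Suc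
      using D\<theta> by (simp add: id_tensor_kron[OF is_channel_lin[OF locc_channel[OF D]]] \<omega>_def)
  qed
  have fresh: "swap_mid (ra i) (rb i) ao bo (id_tensor (r i) (ai * bi) (ao * bo) N
      (swap_mid (ra i) ai (rb i) bi (bt (la ^ i) (lb ^ i) (am * ai) (bm * bi) T \<rho>)))
      = bt (la ^ i) (lb ^ i) (am * ao) (bm * bo) T \<omega>" if "is_mat (la ^ i * lb ^ i) (la ^ i * lb ^ i) T" for i T
    unfolding ra_def rb_def r_def \<omega>_def by (rule channel_on_fresh_input[OF N that m\<rho>])
  \<comment> \<open>In the real run the stored copies are exact. The last output is not yet
    converted, so \<open>i\<close> copies stand beside the raw seizing state
    \<open>\<omega>\<close>.\<close>
  have R: "swap_mid (ra i) (rb i) ao bo (?R i) = bt (la ^ i) (lb ^ i) (am * ao) (bm * bo) (btpow la lb i \<theta>) \<omega>" for i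
  proof (induction i)
    case 0
    have w: "is_mat (am * ao * (bm * bo)) (am * ao * (bm * bo)) \<omega>" unfolding \<omega>_def by (rule is_mat_swap_mid')
    then have "bt 1 1 (am * ao) (bm * bo) (idm 1) \<omega> = \<omega>" by (rule bt_one_left)
    then show ?case
      unfolding real_run.simps r_def r0 \<rho>0_def by (simp add: btpow_0 \<omega>_def)
  next
    case (Suc i)
    have "As i (?R i) = swap_mid (ra (Suc i)) ai (rb (Suc i)) bi
        (bt (la ^ Suc i) (lb ^ Suc i) (am * ai) (bm * bi) (btpow la lb (Suc i) \<theta>) \<rho>)"
      unfolding As_def Suc.IH B_def E_\<omega> ..
    then show ?case
      unfolding real_run.simps using fresh[OF is_mat_btpow, of "Suc i"] by simp
  qed
  have dZ: "density (r i * (ao * bo) * (ma (Suc i) * mb (Suc i))) (?Z i)" if "i < n" for i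
    by (rule density_sim_run[where ma = ma and mb = mb and Ls = Ls and n = n, OF Ls m0 M st that])
  \<comment> \<open>Simulator and discriminator up to round \<open>i\<close> are fused into one LOCC
    map of the maximally entangled state. The state is read in the order of \<open>grouped\<close>,
    where both kinds of step are LOCC.\<close>
  have sim: "\<exists>F. locc M M (ra i * ao * ma (Suc i)) (rb i * bo * mb (Suc i)) F \<and>
      F (maxent M) = grouped (ra i) (rb i) ao bo (ma (Suc i)) (mb (Suc i)) (?Z i)" if "i < n" for i
    using that
  proof (induction i)
    case 0
    let ?K = "kr (ra 0 * rb 0 * (ai * bi)) (M * M) \<rho>0 (maxent M)"
    have K: "is_mat (ra 0 * rb 0 * (ai * bi) * (M * M)) (ra 0 * rb 0 * (ai * bi) * (M * M)) ?K" by (rule is_mat_kron)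
    have Z0: "?Z 0 = id_tensor (ra 0 * rb 0) (ai * bi * (M * M)) (ao * bo * (ma 1 * mb 1))
        (\<lambda>X. swap_mid ao (ma 1) bo (mb 1) (Ls 0 (swap_mid ai bi M M X))) ?K"
      by (simp add: L_full_def[abs_def] m0 r_def)
    \<comment> \<open>Regrouped, the initial state is the seizing input beside the maximally
      entangled state, which separability makes available by LOCC.\<close>
    have g0: "grouped (ra 0) (rb 0) ai bi M M ?K = bt (am * ai) (bm * bi) M M \<rho> (maxent M)"
    proof -
      have "is_mat (am * bm * (ai * bi)) (am * bm * (ai * bi)) \<rho>0" unfolding \<rho>0_def by (rule is_mat_swap_mid')
      then show ?thesis
        unfolding grouped_alt[OF K] unfolding r0
        by (simp add: tensor_id_kron[OF lin_swap_mid] \<rho>0_def swap_mid_inverse'[OF m\<rho>])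
    qed
    have L0: "locc (ai * M) (bi * M) (ao * ma 1) (bo * mb 1) (Ls 0)" using Ls[of 0] n by (simp add: m0)
    have "grouped (ra 0) (rb 0) ao bo (ma 1) (mb 1) (?Z 0)
        = liftL (ra 0) (rb 0) (ai * M) (bi * M) (ao * ma 1) (bo * mb 1) (Ls 0) (bt (am * ai) (bm * bi) M M \<rho> (maxent M))"
      unfolding Z0 g0[symmetric]
      by (rule grouped_simulation_step[OF L0]) (use K in \<open>simp only: mult.assoc\<close>)
    moreover have "locc M M (ra 0 * (ao * ma 1)) (rb 0 * (bo * mb 1))
        (\<lambda>X. liftL (ra 0) (rb 0) (ai * M) (bi * M) (ao * ma 1) (bo * mb 1) (Ls 0) (bt (am * ai) (bm * bi) M M \<rho> X))"
    proof (rule locc_comp[OF _ locc_liftL[OF L0]])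
      show "locc M M (ra 0 * (ai * M)) (rb 0 * (bi * M)) (\<lambda>X. bt (am * ai) (bm * bi) M M \<rho> X)"
        using locc_prepare_left[OF \<rho>, of M M] unfolding r0 by (simp only: mult.assoc)
    qed
    ultimately show ?case by (auto simp: mult.assoc)
  next
    case (Suc i)
    then obtain F where F: "locc M M (ra i * ao * ma (Suc i)) (rb i * bo * mb (Suc i)) F"
      "F (maxent M) = grouped (ra i) (rb i) ao bo (ma (Suc i)) (mb (Suc i)) (?Z i)" by auto
    let ?e = "ma (Suc i)" and ?f = "mb (Suc i)" and ?e' = "ma (Suc (Suc i))" and ?f' = "mb (Suc (Suc i))"
    let ?A = "tensor_id (ra i * rb i * (ao * bo)) (ra (Suc i) * rb (Suc i) * (ai * bi)) (?e * ?f) (As i)"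
    have mZ: "is_mat (ra i * rb i * (ao * bo) * (?e * ?f)) (ra i * rb i * (ao * bo) * (?e * ?f)) (?Z i)"
      using is_mat_density[OF dZ[of i]] Suc.prems by (simp add: r_def)
    have ZS: "?Z (Suc i) = id_tensor (ra (Suc i) * rb (Suc i)) (ai * bi * (?e * ?f)) (ao * bo * (?e' * ?f'))
        (\<lambda>X. swap_mid ao ?e' bo ?f' (Ls (Suc i) (swap_mid ai bi ?e ?f X))) (?A (?Z i))"
      by (simp only: sim_run.simps L_full_def[abs_def] r_def)
    let ?G = "\<lambda>X. liftL (ra (Suc i)) (rb (Suc i)) (ai * ?e) (bi * ?f) (ao * ?e') (bo * ?f') (Ls (Suc i))
        (liftR (ra i * ao) (rb i * bo) (ra (Suc i) * ai) (rb (Suc i) * bi) ?e ?f (B i) X)"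
    have "grouped (ra (Suc i)) (rb (Suc i)) ao bo ?e' ?f' (?Z (Suc i))
        = liftL (ra (Suc i)) (rb (Suc i)) (ai * ?e) (bi * ?f) (ao * ?e') (bo * ?f') (Ls (Suc i))
          (grouped (ra (Suc i)) (rb (Suc i)) ai bi ?e ?f (?A (?Z i)))"
      unfolding ZS
      by (rule grouped_simulation_step[OF Ls[OF Suc.prems]])
        (use is_mat_tensor_id[of "ra (Suc i) * rb (Suc i) * (ai * bi)" "?e * ?f"] in \<open>simp only: mult.assoc\<close>)
    also have "grouped (ra (Suc i)) (rb (Suc i)) ai bi ?e ?f (?A (?Z i))
        = liftR (ra i * ao) (rb i * bo) (ra (Suc i) * ai) (rb (Suc i) * bi) ?e ?f (B i)
          (grouped (ra i) (rb i) ao bo ?e ?f (?Z i))"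
      by (subst As_def) (rule grouped_strategy_step[OF B mZ])
    finally have "grouped (ra (Suc i)) (rb (Suc i)) ao bo ?e' ?f' (?Z (Suc i)) = ?G (F (maxent M))"
      unfolding F(2) .
    moreover have "locc M M (ra (Suc i) * (ao * ?e')) (rb (Suc i) * (bo * ?f')) (\<lambda>X. ?G (F X))"
    proof (rule locc_comp[OF F(1) locc_comp[OF locc_liftR[OF B] _]])
      show "locc (ra (Suc i) * ai * ?e) (rb (Suc i) * bi * ?f) (ra (Suc i) * (ao * ?e')) (rb (Suc i) * (bo * ?f'))
          (liftL (ra (Suc i)) (rb (Suc i)) (ai * ?e) (bi * ?f) (ao * ?e') (bo * ?f') (Ls (Suc i)))"
        using locc_liftL[OF Ls[OF Suc.prems], of "ra (Suc i)" "rb (Suc i)"] by (simp only: mult.assoc)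
    qed
    ultimately show ?case by (auto simp: mult.assoc)
  qed
  \<comment> \<open>The strategy ends with output number \<open>n - 1\<close>, counted from 0; the
    last copy is seized afterwards by \<open>E k\<close>.\<close>
  define k where "k = n - 1"
  have k: "k < n" "Suc k = n" using n by (simp_all add: k_def)
  from sim[OF k(1)] obtain F where F: "locc M M (ra k * ao * ma n) (rb k * bo * mb n) F"
    "F (maxent M) = grouped (ra k) (rb k) ao bo (ma n) (mb n) (?Z k)" unfolding k(2) by blast
  obtain T where T: "locc (ra k * ao * ma n) (rb k * bo * mb n) (ra k * ao) (rb k * bo) T"
    and T_eq: "\<And>Z. is_mat (ra k * ao * (rb k * bo) * (ma n * mb n)) (ra k * ao * (rb k * bo) * (ma n * mb n)) Z \<Longrightarrow>
      T (swap_mid (ra k * ao) (rb k * bo) (ma n) (mb n) Z) = ptrace_right (ra k * ao * (rb k * bo)) (ma n * mb n) Z"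
    by (rule locc_discard_right) blast
  let ?G = "\<lambda>X. E k (T (F X))"
  have E': "locc (ra k * ao) (rb k * bo) (la ^ n) (lb ^ n) (E k)" using E[of k] unfolding k(2) .
  have G: "locc M M (la ^ n) (lb ^ n) ?G"
    by (rule locc_comp[OF F(1) locc_comp[OF T E']])
  let ?P = "ptrace_right (ra k * rb k * (ao * bo)) (ma n * mb n) (?Z k)"
  \<comment> \<open>The same final seizing map is applied to both runs, so the distance guaranteed
    by the code cannot grow.\<close>
  let ?\<Psi> = "\<lambda>X. E k (swap_mid (ra k) (rb k) ao bo X)"
  have \<Psi>: "is_channel (ra k * rb k * (ao * bo)) (la ^ n * lb ^ n) ?\<Psi>"
    by (rule is_channel_comp[OF is_channel_swap_mid' locc_channel[OF E']])
  have dZk: "density (ra k * rb k * (ao * bo) * (ma n * mb n)) (?Z k)" using dZ[OF k(1)] by (simp only: k(2) r_def)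
  \<comment> \<open>Discarding the simulator's memory commutes with regrouping the other systems, so
    doing it locally agrees with the partial trace in the code condition.\<close>
  have "?G (maxent M) = ?\<Psi> ?P"
    unfolding F(2) grouped_alt[OF is_mat_density[OF dZk]] T_eq[OF is_mat_tensor_id]
      ptrace_right_tensor_id[OF is_channel_cpm[OF is_channel_swap_mid'] is_mat_density[OF dZk]] ..
  moreover have "btpow la lb n \<theta> = ?\<Psi> (?R k)" unfolding R E_\<omega> k(2) ..
  moreover have dP: "density (ra k * rb k * (ao * bo)) ?P"
    by (rule density_channel[OF is_channel_ptrace_right dZk])
  moreover have dR: "density (ra k * rb k * (ao * bo)) (?R k)"
    using density_real_run[OF N st k(1)] by (simp only: r_def)
  moreover have "tn_bound (ra k * rb k * (ao * bo)) (\<lambda>x y. ?P x y - ?R k x y) (2 * \<epsilon>)"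
    using dist[OF st] tdist_le_iff[OF density_psd[OF dR] density_psd[OF dP]] tn_bound_minus
    unfolding k_def[symmetric] r_def by blast
  ultimately have "tn_bound (la ^ n * lb ^ n) (\<lambda>x y. ?G (maxent M) x y - btpow la lb n \<theta> x y) (2 * \<epsilon>)"
    using tn_bound_channel_diff[OF \<Psi> is_mat_density[OF dP] is_mat_density[OF dR]] by simp
  with G show ?thesis using tdist_tn_bound_states[OF M G \<theta>] by blast
qed

section \<open>Equality of the sets of achievable rates\<close>

theorem theorem1:
  fixes N :: "cmat \<Rightarrow> cmat" and ai bi ao bo la lb :: nat and \<theta> :: cmat
  assumes "0 < ai" "0 < bi" "0 < ao" "0 < bo" "0 < la" "0 < lb"
    and "is_channel (ai * bi) (ao * bo) N"
    and "tele_simulable N ai bi ao bo la lb \<theta>"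
    and "resource_seizable N ai bi ao bo la lb \<theta>"
  shows "EC_chan N ai bi ao bo = EC_state la lb \<theta>"
proof -
  have \<theta>: "density (la * lb) \<theta>" using assms(8) by (simp add: tele_simulable_def)
  have to_state: "\<exists>M L. 1 \<le> M \<and> real M \<le> b \<and> locc M M (la ^ n) (lb ^ n) L \<and>
      tdist (la ^ n * lb ^ n) (L (maxent M)) (btpow la lb n \<theta>) \<le> \<epsilon>"
    if "\<exists>M. 1 \<le> M \<and> real M \<le> b \<and> seq_code N ai bi ao bo n M \<epsilon>" for n b \<epsilon>
    using that state_code_of_seq_code[OF assms(7,9) \<theta> assms(5,6)] by blast
  have to_chan: "\<exists>M. 1 \<le> M \<and> real M \<le> b \<and> seq_code N ai bi ao bo n M \<epsilon>"
    if "1 \<le> n" "\<exists>M L. 1 \<le> M \<and> real M \<le> b \<and> locc M M (la ^ n) (lb ^ n) L \<and>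
      tdist (la ^ n * lb ^ n) (L (maxent M)) (btpow la lb n \<theta>) \<le> \<epsilon>" for n b \<epsilon>
    using that seq_code_of_state_code[OF assms(7,8,5,6)] by blast
  \<comment> \<open>The codes correspond with the same \<open>n\<close>, bound on \<open>M\<close>
    and error, so the two predicates coincide. Their infima then agree as terms, whatever
    \<open>Inf\<close> returns on the common set.\<close>
  have "achievable_chan N ai bi ao bo R \<longleftrightarrow> achievable_state la lb \<theta> R" for R
  proof
    assume chan: "achievable_chan N ai bi ao bo R"
    show "achievable_state la lb \<theta> R"
      unfolding achievable_state_def
    proof (intro allI impI)
      fix \<epsilon> \<delta> :: real assume "0 < \<epsilon> \<and> \<epsilon> \<le> 1 \<and> 0 < \<delta>"
      with chan have "\<forall>\<^sub>F n in sequentially. \<exists>M. 1 \<le> M \<and> real M \<le> 2 powr (real n * (R + \<delta>)) \<and> seq_code N ai bi ao bo n M \<epsilon>"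
        unfolding achievable_chan_def by blast
      then show "\<forall>\<^sub>F n in sequentially. \<exists>M L. 1 \<le> M \<and> real M \<le> 2 powr (real n * (R + \<delta>)) \<and>
           locc M M (la ^ n) (lb ^ n) L \<and> tdist (la ^ n * lb ^ n) (L (maxent M)) (btpow la lb n \<theta>) \<le> \<epsilon>"
        by (rule eventually_mono) (rule to_state)
    qed
  next
    assume state: "achievable_state la lb \<theta> R"
    show "achievable_chan N ai bi ao bo R"
      unfolding achievable_chan_def
    proof (intro allI impI)
      fix \<epsilon> \<delta> :: real assume "0 < \<epsilon> \<and> \<epsilon> \<le> 1 \<and> 0 < \<delta>"
      with state have "\<forall>\<^sub>F n in sequentially. \<exists>M L. 1 \<le> M \<and> real M \<le> 2 powr (real n * (R + \<delta>)) \<and>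
           locc M M (la ^ n) (lb ^ n) L \<and> tdist (la ^ n * lb ^ n) (L (maxent M)) (btpow la lb n \<theta>) \<le> \<epsilon>"
        unfolding achievable_state_def by blast
      \<comment> \<open>\<open>seq_code\<close> demands at least one channel use, so the condition
        on states is combined with \<open>1 \<le> n\<close>, which holds eventually.\<close>
      with eventually_ge_at_top[of 1]
      show "\<forall>\<^sub>F n in sequentially. \<exists>M. 1 \<le> M \<and> real M \<le> 2 powr (real n * (R + \<delta>)) \<and> seq_code N ai bi ao bo n M \<epsilon>"
        by eventually_elim (rule to_chan)
    qed
  qed
  then have "achievable_chan N ai bi ao bo = achievable_state la lb \<theta>" by (intro ext)
  then show ?thesis unfolding EC_chan_def EC_state_def by simp
qed

end
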